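(* For any $\rho>0$, there is no polynomial-time algorithm that, given a weighted undirected network $G$, finds a community structure $\mathcal C$ of $G$ with modularity $Q(\mathcal C)\ge \rho\, Q_{OPT}(G)$, unless $\mathbf P=\mathbf{NP}$. Here $Q_{OPT}(G)$ denotes the maximum modularity value among all possible divisions of the network $G$ into communities.
   Context: A weighted network is a finite undirected graph $G=(V,E)$ with nonnegative rational edge weights (encoded in binary), not all zero; self-loops are allowed. $M>0$ is the total weight of all edges (each edge, including each loop, counted once). The degree $d_v$ of a vertex is the total weight of the edges incident to $v$, where a loop contributes twice its weight, so $\sum_v d_v=2M$. A community structure (CS) of $G$ is a partition $\mathcal C=\{C_1,\dots,C_l\}$ of $V$ into disjoint nonempty subsets with union $V$; the number $l\ge 1$ of communities is not prescribed. The modularity of $\mathcal C$ is $$Q(\mathcal C)=\sum_{t=1}^{l}\left(\frac{E(C_t)}{M}-\frac{vol(C_t)^2}{4M^2}\right),$$ where $E(C_t)$ is the total weight of edges (including loops) with both endpoints in $C_t$ and $vol(C_t)=\sum_{v\in C_t}d_v$. *)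

theory Defs
  imports Complex_Main "HOL-Library.Disjoint_Sets" "HOL-Computational_Algebra.Polynomial"
begin

section \<open>Weighted networks and modularity\<close>

text \<open>An undirected edge is the set of its endpoints, so a self-loop at \<open>v\<close> is the
  singleton \<open>{v}\<close>. The weight function is only meaningful on the edge set.\<close>

record 'v network =
  verts  :: "'v set"
  edges  :: "'v set set"
  weight :: "'v set \<Rightarrow> rat"

definition total_weight :: "'v network \<Rightarrow> rat" where
  "total_weight G = (\<Sum>e\<in>edges G. weight G e)"

definition weighted_network :: "'v network \<Rightarrow> bool" where
  "weighted_network G \<longleftrightarrow>
     finite (verts G) \<and>
     (\<forall>e\<in>edges G. e \<subseteq> verts G \<and> (card e = 1 \<or> card e = 2)) \<and>
     (\<forall>e\<in>edges G. weight G e \<ge> 0) \<and>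
     (\<exists>e\<in>edges G. weight G e \<noteq> 0)"

definition vertex_degree :: "'v network \<Rightarrow> 'v \<Rightarrow> rat" where
  "vertex_degree G v = (\<Sum>e\<in>{e \<in> edges G. v \<in> e}. if e = {v} then 2 * weight G e else weight G e)"

definition inner_weight :: "'v network \<Rightarrow> 'v set \<Rightarrow> rat" where
  "inner_weight G C = (\<Sum>e\<in>{e \<in> edges G. e \<subseteq> C}. weight G e)"

definition vol :: "'v network \<Rightarrow> 'v set \<Rightarrow> rat" where
  "vol G C = (\<Sum>v\<in>C. vertex_degree G v)"

definition community_structure :: "'v network \<Rightarrow> 'v set set \<Rightarrow> bool" where
  "community_structure G \<C> \<longleftrightarrow> partition_on (verts G) \<C>"

definition modularity :: "'v network \<Rightarrow> 'v set set \<Rightarrow> rat" where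
  "modularity G \<C> =
     (\<Sum>C\<in>\<C>. inner_weight G C / total_weight G - (vol G C)\<^sup>2 / (4 * (total_weight G)\<^sup>2))"

definition Q_OPT :: "'v network \<Rightarrow> rat" where
  "Q_OPT G = Max (modularity G ` {\<C>. community_structure G \<C>})"

lemma sum_vertex_degree:
  assumes "weighted_network G"
  shows "(\<Sum>v\<in>verts G. vertex_degree G v) = 2 * total_weight G"
proof -
  have fV: "finite (verts G)" and sub: "\<And>e. e \<in> edges G \<Longrightarrow> e \<subseteq> verts G"
    and cd: "\<And>e. e \<in> edges G \<Longrightarrow> card e = 1 \<or> card e = 2"
    using assms by (auto simp: weighted_network_def)
  have fE: "finite (edges G)"
    using fV sub by (meson Pow_iff finite_Pow_iff finite_subset subsetI)
  let ?f = "\<lambda>v e. if e = {v} then 2 * weight G e else weight G e"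
  have "(\<Sum>v\<in>verts G. vertex_degree G v) = (\<Sum>e\<in>edges G. \<Sum>v\<in>{v \<in> verts G. v \<in> e}. ?f v e)"
    unfolding vertex_degree_def using fV fE by (rule sum.swap_restrict)
  also have "\<dots> = (\<Sum>e\<in>edges G. 2 * weight G e)"
  proof (rule sum.cong[OF refl])
    fix e assume e: "e \<in> edges G"
    have "{v \<in> verts G. v \<in> e} = e" using sub[OF e] by auto
    moreover have "(\<Sum>v\<in>e. ?f v e) = 2 * weight G e"
      using cd[OF e] by (auto simp: card_1_singleton_iff card_2_iff doubleton_eq_iff)
    ultimately show "(\<Sum>v\<in>{v \<in> verts G. v \<in> e}. ?f v e) = 2 * weight G e" by simp
  qed
  finally show ?thesis by (simp add: total_weight_def sum_distrib_left)
qed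


section \<open>Multi-tape Turing machines\<close>

text \<open>Tapes are infinite to the right, and a left move on cell 0 leaves the head there.
  Symbol 0 is the blank; 1 and 2 stand for the input bits \<open>False\<close> and \<open>True\<close>.
  State 0 is initial and state 1 is accepting. \<open>tm_delta M q xs\<close> is the set of
  actions possible in state \<open>q\<close> when the tape heads read \<open>xs\<close>; an action consists of
  the next state and, for each tape, the symbol written and the head movement.
  The machine halts when no action is possible.\<close>

datatype move = Go_Left | Go_Right | Stay

type_synonym action = "nat \<times> (nat \<times> move) list"

record tm =
  tm_tapes  :: nat
  tm_syms   :: nat
  tm_states :: nat
  tm_delta  :: "nat \<Rightarrow> nat list \<Rightarrow> action set"

definition wf_tm :: "tm \<Rightarrow> bool" where
  "wf_tm M \<longleftrightarrow> tm_tapes M \<ge> 1 \<and> tm_syms M \<ge> 3 \<and> tm_states M \<ge> 2 \<and>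
     (\<forall>q < tm_states M. \<forall>xs. length xs = tm_tapes M \<and> set xs \<subseteq> {..<tm_syms M} \<longrightarrow>
        (\<forall>(q', as) \<in> tm_delta M q xs.
           q' < tm_states M \<and> length as = tm_tapes M \<and> fst ` set as \<subseteq> {..<tm_syms M}))"

definition deterministic :: "tm \<Rightarrow> bool" where
  "deterministic M \<longleftrightarrow> (\<forall>q xs. \<forall>a\<in>tm_delta M q xs. \<forall>b\<in>tm_delta M q xs. a = b)"

type_synonym tape = "(nat \<Rightarrow> nat) \<times> nat"
type_synonym config = "nat \<times> tape list"

fun read_tape :: "tape \<Rightarrow> nat" where
  "read_tape (t, h) = t h"

fun move_head :: "move \<Rightarrow> nat \<Rightarrow> nat" where
  "move_head Go_Left h = h - 1"
| "move_head Go_Right h = h + 1"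
| "move_head Stay h = h"

fun act :: "nat \<times> move \<Rightarrow> tape \<Rightarrow> tape" where
  "act (s, m) (t, h) = (t(h := s), move_head m h)"

definition step :: "tm \<Rightarrow> config \<Rightarrow> config \<Rightarrow> bool" where
  "step M c c' \<longleftrightarrow>
     (\<exists>(q', as) \<in> tm_delta M (fst c) (map read_tape (snd c)). c' = (q', map2 act as (snd c)))"

definition halted :: "tm \<Rightarrow> config \<Rightarrow> bool" where
  "halted M c \<longleftrightarrow> \<not> (\<exists>c'. step M c c')"

definition bit_sym :: "bool \<Rightarrow> nat" where
  "bit_sym b = (if b then 2 else 1)"

definition input_tape :: "bool list \<Rightarrow> tape" where
  "input_tape x = (\<lambda>i. if i < length x then bit_sym (x ! i) else 0, 0)"

definition init :: "tm \<Rightarrow> bool list \<Rightarrow> config" where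
  "init M x = (0, input_tape x # replicate (tm_tapes M - 1) (input_tape []))"

definition accepts :: "tm \<Rightarrow> bool list \<Rightarrow> bool" where
  "accepts M x \<longleftrightarrow> (\<exists>c. (step M)\<^sup>*\<^sup>* (init M x) c \<and> halted M c \<and> fst c = 1)"

text \<open>The output is the bit string on the last tape that starts in cell 0 and ends before
  the first blank.\<close>

definition output_is :: "config \<Rightarrow> bool list \<Rightarrow> bool" where
  "output_is c y \<longleftrightarrow>
     (\<forall>i < length y. fst (last (snd c)) i = bit_sym (y ! i)) \<and> fst (last (snd c)) (length y) = 0"

definition computes :: "tm \<Rightarrow> bool list \<Rightarrow> bool list \<Rightarrow> bool" where
  "computes M x y \<longleftrightarrow> (\<exists>c. (step M)\<^sup>*\<^sup>* (init M x) c \<and> halted M c \<and> output_is c y)"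

text \<open>Every computation on an input \<open>x \<in> X\<close>, whatever the nondeterministic choices,
  has length at most polynomial in the length of \<open>x\<close>.\<close>

definition poly_time_on :: "tm \<Rightarrow> bool list set \<Rightarrow> bool" where
  "poly_time_on M X \<longleftrightarrow>
     (\<exists>p :: nat poly. \<forall>x\<in>X. \<forall>t c. (step M ^^ t) (init M x) c \<longrightarrow> t \<le> poly p (length x))"

definition class_P :: "bool list set set" where
  "class_P = {L. \<exists>M. wf_tm M \<and> deterministic M \<and> poly_time_on M UNIV \<and> L = {x. accepts M x}}"

definition class_NP :: "bool list set set" where
  "class_NP = {L. \<exists>M. wf_tm M \<and> poly_time_on M UNIV \<and> L = {x. accepts M x}}"


section \<open>Encodings\<close>

text \<open>Binary digits, least significant first.\<close>

fun bits :: "nat \<Rightarrow> bool list" where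
  "bits n = (if n = 0 then [] else odd n # bits (n div 2))"

declare bits.simps [simp del]

text \<open>Self-delimiting: each digit is preceded by \<open>True\<close>, and \<open>False\<close> ends the number.\<close>

definition enc_nat :: "nat \<Rightarrow> bool list" where
  "enc_nat n = concat (map (\<lambda>b. [True, b]) (bits n)) @ [False]"

text \<open>Applied only to nonnegative rationals; numerator and denominator in lowest terms.\<close>

definition enc_rat :: "rat \<Rightarrow> bool list" where
  "enc_rat w = (case quotient_of w of (a, b) \<Rightarrow> enc_nat (nat a) @ enc_nat (nat b))"

definition enc_entry :: "nat network \<Rightarrow> nat set \<Rightarrow> bool list" where
  "enc_entry G e = (if e \<in> edges G then True # enc_rat (weight G e) else [False])"

text \<open>Instances have vertex set \<open>{0..<n}\<close>. A network is written as \<open>n\<close> in unary followed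
  by the lower triangle of its weighted adjacency matrix, diagonal included.\<close>

definition network_instance :: "nat network \<Rightarrow> bool" where
  "network_instance G \<longleftrightarrow> weighted_network G \<and> (\<exists>n. verts G = {0..<n})"

definition enc_network :: "nat network \<Rightarrow> bool list" where
  "enc_network G =
     (let n = card (verts G) in
      replicate n True @ [False] @
      concat (map (\<lambda>i. concat (map (\<lambda>j. enc_entry G {i, j}) [0..<Suc i])) [0..<n]))"

text \<open>A partition of \<open>{0..<n}\<close> is written as a list of \<open>n\<close> community labels: two vertices
  are in the same community iff their labels agree.\<close>

definition partition_of_labels :: "nat list \<Rightarrow> nat set set" where
  "partition_of_labels ls =
     (\<lambda>u. {v. v < length ls \<and> ls ! v = ls ! u}) ` {0..<length ls}"

definition encodes_partition :: "nat \<Rightarrow> bool list \<Rightarrow> nat set set \<Rightarrow> bool" where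
  "encodes_partition n y \<C> \<longleftrightarrow>
     (\<exists>ls. length ls = n \<and> y = concat (map enc_nat ls) \<and> \<C> = partition_of_labels ls)"


section \<open>Approximation algorithms\<close>

definition poly_time_modularity_approx :: "real \<Rightarrow> tm \<Rightarrow> bool" where
  "poly_time_modularity_approx \<rho> M \<longleftrightarrow>
     wf_tm M \<and> deterministic M \<and>
     poly_time_on M (enc_network ` {G. network_instance G}) \<and>
     (\<forall>G. network_instance G \<longrightarrow>
        (\<exists>y \<C>. computes M (enc_network G) y \<and>
               encodes_partition (card (verts G)) y \<C> \<and>
               community_structure G \<C> \<and>
               of_rat (modularity G \<C>) \<ge> \<rho> * of_rat (Q_OPT G)))"

end

(*
  Put b u v = a u v - c, where c is the average of a complete weighting a whose loops make all
  degrees equal. Then the modularity of a partition is a negative multiple of the total b-weight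
  of the cuts around its communities. So a partition of positive modularity exists iff some cut
  has negative b-weight, and b may be any symmetric integer function. For a graph of conflicts
  on N items take b i j = 2 - (N^2 + 1) [i and j are in conflict], and add a root that brings each
  item's row sum to 2m - 3. The cut around t items without conflict then weighs
  t (2m - 1 - 2t), which is negative iff t >= m, and a single conflict makes the cut positive.
  Hence Q_OPT > 0 iff there are m items without conflict; otherwise every partition but the
  trivial one has negative modularity. An approximation algorithm with any ratio rho > 0 therefore
  answers with the trivial partition iff there are no such m items, and its labels tell which.

  A run of a nondeterministic machine is encoded by one item per tape and time: the transition, the
  head position and the time of the last visit to the current cell. All consistency conditions
  relate two items only, so accepting runs correspond to conflict-free sets of full size.

  The network is printed by a deterministic machine in polynomial time because its weights are
  values of expressions built from +, truncated -, *, bounded sums and access to the input;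
  these are evaluated with unary counters, each of which is the head position on a tape.
*)
theory Submission
  imports Defs
begin

text \<open>Hardness comes from a sign, not from a gap: the step from \<open>Q_OPT = 0\<close> to
  \<open>Q_OPT > 0\<close> survives every factor \<rho> > 0. For this the trivial partition must be
  the only acceptable answer to a no-instance, so no other cut may weigh exactly 0. This explains
  the odd row sum 2m - 3: a cut around t conflict-free items weighs t times the odd number 2m - 1 -
  2t. A conflict is counted in both orders, and 2 (N^2 + 1) exceeds t (2t - 1) for every t <= N.
  Since b is symmetric, a cut can always be described by its side without the root.

  All weights are polynomial in value, not only in length; this makes unary counters affordable. A
  conflict relates two items, whereas the symbol under a head depends on the whole past; the time of
  the last visit splits this dependency into pairs of times. The approximation algorithm is promised
  to be fast only on encodings of networks, so the printed string must be a genuine instance for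
  every input, accepted or not.\<close>

section \<open>Modularity of regular networks\<close>

definition complete_network :: "'v set \<Rightarrow> ('v set \<Rightarrow> rat) \<Rightarrow> 'v network" where
  "complete_network V w = \<lparr>verts = V, edges = {{i, j} | i j. i \<in> V \<and> j \<in> V}, weight = w\<rparr>"

lemma complete_network_sel [simp]:
  "verts (complete_network V w) = V"
  "edges (complete_network V w) = {{i, j} | i j. i \<in> V \<and> j \<in> V}"
  "weight (complete_network V w) = w"
  by (simp_all add: complete_network_def)

lemma vertex_degree_complete:
  assumes "finite V" "v \<in> V"
  shows "vertex_degree (complete_network V w) v = 2 * w {v} + (\<Sum>j\<in>V - {v}. w {v, j})"
proof -
  let ?f = "\<lambda>e. if e = {v} then 2 * w e else w e"
  have "{e \<in> {{i, j} | i j. i \<in> V \<and> j \<in> V}. v \<in> e} = (\<lambda>j. {v, j}) ` V"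
    using assms by (auto simp: insert_commute)
  then have "vertex_degree (complete_network V w) v = (\<Sum>e\<in>(\<lambda>j. {v, j}) ` V. ?f e)"
    by (simp add: vertex_degree_def cong: if_cong)
  also have "\<dots> = (\<Sum>j\<in>V. ?f {v, j})"
    by (subst sum.reindex) (auto simp: inj_on_def doubleton_eq_iff)
  also have "\<dots> = ?f {v, v} + (\<Sum>j\<in>V - {v}. ?f {v, j})"
    using assms by (simp add: sum.remove)
  also have "(\<Sum>j\<in>V - {v}. ?f {v, j}) = (\<Sum>j\<in>V - {v}. w {v, j})"
    by (rule sum.cong) auto
  finally show ?thesis by simp
qed

lemma weighted_complete_network:
  assumes "finite V" "v \<in> V" "\<And>e. w e \<ge> 0" "w {v} > 0"
  shows "weighted_network (complete_network V w)"
proof -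
  have "{v, v} \<in> {{i, j} | i j. i \<in> V \<and> j \<in> V}" using assms(2) by blast
  then show ?thesis using assms unfolding weighted_network_def
    by (auto simp: card_insert_if card_2_iff intro!: exI[of _ "{v}"])
qed

text \<open>The edges inside \<open>C\<close> are those of the complete network on \<open>C\<close>,
  so this is the handshake lemma \<open>sum_vertex_degree\<close> there. A nonempty \<open>C\<close>
  and positive loops make the smaller network a legal one.\<close>

lemma inner_weight_complete:
  assumes "finite V" "C \<subseteq> V" "C \<noteq> {}" "\<And>e. w e \<ge> 0" "\<And>v. v \<in> C \<Longrightarrow> w {v} > 0"
  shows "2 * inner_weight (complete_network V w) C =
    (\<Sum>v\<in>C. 2 * w {v} + (\<Sum>j\<in>C - {v}. w {v, j}))"
proof -
  have fC: "finite C" using assms(1,2) finite_subset by blast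
  obtain v where v: "v \<in> C" using assms(3) by blast
  have wn: "weighted_network (complete_network C w)"
    using weighted_complete_network[OF fC v] assms v by auto
  have e: "{e \<in> {{i, j} | i j. i \<in> V \<and> j \<in> V}. e \<subseteq> C} = {{i, j} | i j. i \<in> C \<and> j \<in> C}"
    using assms(2) by auto
  have "inner_weight (complete_network V w) C = total_weight (complete_network C w)"
    using e by (simp add: inner_weight_def total_weight_def)
  then show ?thesis
    using sum_vertex_degree[OF wn] fC by (simp add: vertex_degree_complete)
qed

text \<open>The weights are viewed as a matrix: an edge \<open>{u, v}\<close> stands for the two
  entries \<open>a u v\<close> and \<open>a v u\<close>, hence the factor 2, and a loop is a
  diagonal entry. The loops fill up the rows to equal sums, so that \<open>c\<close> is the average
  entry.\<close>

locale regular_network =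
  fixes V :: "'v set" and w :: "'v set \<Rightarrow> rat" and a :: "'v \<Rightarrow> 'v \<Rightarrow> rat" and c :: rat
  assumes fin: "finite V" and ne: "V \<noteq> {}" and c_pos: "c > 0"
    and w_nonneg: "\<And>e. w e \<ge> 0" and loop_pos: "\<And>v. v \<in> V \<Longrightarrow> w {v} > 0"
    and w_edge: "\<And>u v. u \<in> V \<Longrightarrow> v \<in> V \<Longrightarrow> u \<noteq> v \<Longrightarrow> w {u, v} = 2 * a u v"
    and row: "\<And>v. v \<in> V \<Longrightarrow> w {v} + (\<Sum>j\<in>V - {v}. a v j) = c * of_nat (card V)"
begin

abbreviation "G \<equiv> complete_network V w"

lemma wn: "weighted_network G"
  using ne weighted_complete_network[of V _ w, OF fin _ w_nonneg] loop_pos by blast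

lemma degree: "vertex_degree G v = 2 * c * of_nat (card V)" if v: "v \<in> V"
proof -
  have "(\<Sum>j\<in>V - {v}. w {v, j}) = 2 * (\<Sum>j\<in>V - {v}. a v j)"
    using v w_edge[of v] by (auto simp: sum_distrib_left intro!: sum.cong)
  then show ?thesis using row[OF v] v fin by (simp add: vertex_degree_complete)
qed

lemma total: "total_weight G = c * (of_nat (card V))\<^sup>2"
  using sum_vertex_degree[OF wn] by (simp add: degree power2_eq_square mult_ac)

text \<open>Each vertex of \<open>C\<close> carries its loop and half of its other edges inside
  \<open>C\<close>; what is missing from the full row sum leads to \<open>V - C\<close>.\<close>

lemma inner:
  assumes "C \<subseteq> V" "C \<noteq> {}"
  shows "inner_weight G C = (\<Sum>v\<in>C. c * of_nat (card V) - (\<Sum>j\<in>V - C. a v j))"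
proof -
  have "w {v} + (\<Sum>j\<in>C - {v}. w {v, j}) / 2 = c * of_nat (card V) - (\<Sum>j\<in>V - C. a v j)"
    if v: "v \<in> C" for v
  proof -
    have "(\<Sum>j\<in>C - {v}. w {v, j}) / 2 = (\<Sum>j\<in>C - {v}. a v j)"
      unfolding sum_divide_distrib using v assms(1) by (intro sum.cong) (auto simp: w_edge subset_iff)
    moreover have "V - {v} = (C - {v}) \<union> (V - C)" using v assms(1) by auto
    then have "(\<Sum>j\<in>V - {v}. a v j) = (\<Sum>j\<in>C - {v}. a v j) + (\<Sum>j\<in>V - C. a v j)"
      using fin assms(1) by (simp add: sum.union_disjoint disjoint_iff finite_subset)
    ultimately show ?thesis using row[of v] v assms(1) by (auto simp: algebra_simps)
  qed
  then have "(\<Sum>v\<in>C. c * of_nat (card V) - (\<Sum>j\<in>V - C. a v j)) =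
      (\<Sum>v\<in>C. w {v} + (\<Sum>j\<in>C - {v}. w {v, j}) / 2)"
    by simp
  also have "\<dots> = (\<Sum>v\<in>C. 2 * w {v} + (\<Sum>j\<in>C - {v}. w {v, j})) / 2"
    by (simp add: sum_divide_distrib add_divide_distrib)
  also have "\<dots> = inner_weight G C"
    using inner_weight_complete[of V C w, OF fin assms w_nonneg] loop_pos assms(1) by (auto simp: subset_iff)
  finally show ?thesis by simp
qed

text \<open>For a regular network, \<open>a v j - c\<close> is half the off-diagonal entry of the
  usual modularity matrix (weight minus product of degrees over twice the total weight).\<close>

definition excess_cut :: "'v set \<Rightarrow> rat" where
  "excess_cut C = (\<Sum>v\<in>C. \<Sum>j\<in>V - C. a v j - c)"

text \<open>With the loops on the diagonal, the rows of the matrix \<open>a - c\<close> sum to 0. So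
  its block on \<open>C\<close> is minus its block on \<open>C \<times> (V - C)\<close>, and
  \<open>c * (card C)^2\<close> is the sum of \<open>c\<close> over the first block.\<close>

lemma inner_excess:
  assumes "C \<subseteq> V" "C \<noteq> {}"
  shows "inner_weight G C - c * (of_nat (card C))\<^sup>2 = - excess_cut C"
proof -
  have cc: "rat_of_nat (card (V - C)) = of_nat (card V) - of_nat (card C)"
    using assms(1) fin by (simp add: card_Diff_subset card_mono finite_subset of_nat_diff)
  have "excess_cut C = (\<Sum>v\<in>C. (\<Sum>j\<in>V - C. a v j) - (of_nat (card V) - of_nat (card C)) * c)"
    unfolding excess_cut_def by (simp add: sum_subtractf cc)
  also have "\<dots> = (\<Sum>v\<in>C. (\<Sum>j\<in>V - C. a v j)) - of_nat (card C) * ((of_nat (card V) - of_nat (card C)) * c)"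
    by (simp add: sum_subtractf)
  finally show ?thesis
    by (simp add: inner[OF assms] sum_subtractf algebra_simps power2_eq_square)
qed

text \<open>Equal degrees turn \<open>vol G C\<close> into \<open>2 * c * card V * card C\<close>,
  so the quadratic term becomes \<open>c * (card C)^2\<close> over the total weight and
  \<open>inner_excess\<close> applies to each community.\<close>

lemma modularity_excess:
  assumes "community_structure G P"
  shows "modularity G P = - (\<Sum>C\<in>P. excess_cut C) / (c * (of_nat (card V))\<^sup>2)"
proof -
  have nz: "rat_of_nat (card V) \<noteq> 0" using ne fin by simp
  have part: "partition_on V P" using assms by (simp add: community_structure_def)
  have "modularity G P = (\<Sum>C\<in>P. - excess_cut C / (c * (of_nat (card V))\<^sup>2))"
    unfolding modularity_def
  proof (rule sum.cong[OF refl])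
    fix C assume "C \<in> P"
    then have C: "C \<subseteq> V" "C \<noteq> {}" using part by (auto simp: partition_on_def)
    have "vol G C = (\<Sum>v\<in>C. 2 * c * of_nat (card V))"
      unfolding vol_def using C(1) degree by (intro sum.cong) auto
    then have "vol G C = of_nat (card C) * (2 * c * of_nat (card V))" by simp
    then have "(vol G C)\<^sup>2 / (4 * (total_weight G)\<^sup>2) = c * (of_nat (card C))\<^sup>2 / (c * (of_nat (card V))\<^sup>2)"
      unfolding total using nz c_pos by (simp add: field_simps power2_eq_square)
    then show "inner_weight G C / total_weight G - (vol G C)\<^sup>2 / (4 * (total_weight G)\<^sup>2) =
        - excess_cut C / (c * (of_nat (card V))\<^sup>2)"
      unfolding inner_excess[OF C, symmetric] total by (simp add: diff_divide_distrib)
  qed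
  then show ?thesis by (simp add: sum_negf flip: sum_divide_distrib)
qed

lemma excess_cut_compl:
  assumes "C \<subseteq> V" and sym: "\<And>u v. u \<in> V \<Longrightarrow> v \<in> V \<Longrightarrow> a u v = a v u"
  shows "excess_cut (V - C) = excess_cut C"
proof -
  have "V - (V - C) = C" using assms(1) by auto
  then have "excess_cut (V - C) = (\<Sum>j\<in>C. \<Sum>v\<in>V - C. a v j - c)"
    unfolding excess_cut_def by (simp only: sum.swap[of _ C])
  also have "\<dots> = excess_cut C"
    unfolding excess_cut_def using assms by (intro sum.cong refl) (auto intro!: sum.cong simp: subset_iff sym)
  finally show ?thesis .
qed

end

section \<open>Cliques as cuts of negative excess\<close>

definition penalty :: "nat \<Rightarrow> nat" where
  "penalty N = N * N + 1"

text \<open>The offset serves three purposes: \<open>2 * N * m + penalty N * (N * N)\<close> bounds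
  the surplus of the root row and so keeps the loops positive; \<open>penalty N\<close> and
  \<open>2 * N + 1\<close> keep the subtractions in \<open>attr\<close> and \<open>root_attr\<close>
  from truncating.\<close>

definition base_attr :: "nat \<Rightarrow> nat \<Rightarrow> nat" where
  "base_attr N m = 2 * N * m + penalty N * (N * N) + penalty N + 2 * N + 1"

text \<open>Solves the row equation of item \<open>i\<close>: relative to \<open>base_attr\<close>,
  the other items contribute \<open>2 * (N - 1)\<close> minus the penalties of \<open>i\<close>, and
  the whole row must contribute \<open>2 * m - 3\<close>.\<close>

definition root_attr :: "nat \<Rightarrow> nat \<Rightarrow> (nat \<Rightarrow> nat \<Rightarrow> bool) \<Rightarrow> nat \<Rightarrow> nat" where
  "root_attr N m conf i =
     base_attr N m + 2 * m + penalty N * (\<Sum>j<N. of_bool (conf i j)) - (2 * N + 1)"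

definition attr :: "nat \<Rightarrow> nat \<Rightarrow> (nat \<Rightarrow> nat \<Rightarrow> bool) \<Rightarrow> nat \<Rightarrow> nat \<Rightarrow> nat" where
  "attr N m conf i j =
     (if i = N then root_attr N m conf j
      else if j = N then root_attr N m conf i
      else base_attr N m + 2 - penalty N * of_bool (conf i j))"

text \<open>The loop fills row \<open>i\<close> up to \<open>base_attr N m * (N + 1)\<close>, making
  \<open>base_attr N m\<close> the average entry. The sum runs over an initial segment with a test,
  a form that can later be copied verbatim by an expression over counters.\<close>

definition clique_weight :: "nat \<Rightarrow> nat \<Rightarrow> (nat \<Rightarrow> nat \<Rightarrow> bool) \<Rightarrow> nat \<Rightarrow> nat \<Rightarrow> nat" where
  "clique_weight N m conf i j =
     (if i = j then base_attr N m * (N + 1) - (\<Sum>k<N + 1. if k = i then 0 else attr N m conf i k)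
      else 2 * attr N m conf i j)"

locale conflict_graph =
  fixes N m :: nat and conf :: "nat \<Rightarrow> nat \<Rightarrow> bool"
  assumes m_pos: "m \<ge> 1" and N_pos: "N \<ge> 1"
    and conf_sym: "\<And>i j. conf i j \<Longrightarrow> conf j i" and conf_irrefl: "\<And>i. \<not> conf i i"
begin

abbreviation "V \<equiv> {0..<Suc N}"
abbreviation "att \<equiv> attr N m conf"
abbreviation "K \<equiv> base_attr N m"
text \<open>\<open>Max\<close> and \<open>Min\<close> recover an ordered pair from an edge; on a
  loop they coincide.\<close>

abbreviation "w \<equiv> \<lambda>e. rat_of_nat (clique_weight N m conf (Max e) (Min e))"

lemma conf_commute: "conf i j \<longleftrightarrow> conf j i"
  using conf_sym by blast

lemma att_sym: "att i j = att j i"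
  by (auto simp: attr_def conf_commute)

lemma att_item: "i < N \<Longrightarrow> j < N \<Longrightarrow> int (att i j) - int K = 2 - int (penalty N) * of_bool (conf i j)"
  by (auto simp: attr_def base_attr_def penalty_def)

lemma att_root:
  assumes "i < N"
  shows "int (att i N) - int K = 2 * int m - 3 - (\<Sum>j\<in>{..<N} - {i}. int (att i j) - int K)"
proof -
  have "(\<Sum>j\<in>{..<N} - {i}. int (att i j) - int K) =
      (\<Sum>j\<in>{..<N} - {i}. 2 - int (penalty N) * of_bool (conf i j))"
    using assms by (intro sum.cong) (auto simp: att_item)
  also have "\<dots> = 2 * (int N - 1) - int (penalty N) * (\<Sum>j\<in>{..<N} - {i}. of_bool (conf i j))"
    using assms by (simp add: sum_subtractf sum_distrib_left of_nat_diff)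
  also have "(\<Sum>j\<in>{..<N} - {i}. of_bool (conf i j)) = (\<Sum>j<N. of_bool (conf i j) :: int)"
    using assms by (intro sum.mono_neutral_left) (auto simp: conf_irrefl)
  finally have *: "(\<Sum>j\<in>{..<N} - {i}. int (att i j) - int K) =
      2 * (int N - 1) - int (penalty N) * (\<Sum>j<N. of_bool (conf i j))" .
  have "2 * N + 1 \<le> K" by (simp add: base_attr_def)
  then have "int (root_attr N m conf i) =
      int K + 2 * int m + int (penalty N) * (\<Sum>j<N. of_bool (conf i j)) - (2 * int N + 1)"
    unfolding root_attr_def by (subst of_nat_diff) (auto simp: of_nat_sum)
  then show ?thesis using assms * by (simp add: attr_def)
qed

lemma row_item:
  assumes "i < N"
  shows "(\<Sum>j\<in>V - {i}. int (att i j) - int K) = 2 * int m - 3"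
proof -
  have "V - {i} = insert N ({..<N} - {i})" using assms by auto
  then show ?thesis using assms att_root[OF assms] by simp
qed

text \<open>A crude bound: at most \<open>N\<close> conflicts raise the root entry of an item by at
  most \<open>2 * m + penalty N * N\<close>, and there are \<open>N\<close> items.\<close>

lemma row_root: "(\<Sum>j\<in>V - {N}. int (att N j) - int K) < int K"
proof -
  have "- (\<Sum>j\<in>{..<N} - {i}. int (att i j) - int K) \<le> int (penalty N) * int N" if "i < N" for i
  proof -
    have "- (\<Sum>j\<in>{..<N} - {i}. int (att i j) - int K) = (\<Sum>j\<in>{..<N} - {i}. int K - int (att i j))"
      by (simp flip: sum_negf)
    also have "\<dots> \<le> (\<Sum>j\<in>{..<N} - {i}. int (penalty N))"
    proof (intro sum_mono)
      fix j assume "j \<in> {..<N} - {i}"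
      then show "int K - int (att i j) \<le> int (penalty N)"
        using att_item[OF that, of j] by (cases "conf i j") auto
    qed
    also have "\<dots> \<le> int (penalty N) * int N"
      using that by (simp add: algebra_simps)
    finally show ?thesis .
  qed
  then have "int (att N i) - int K \<le> 2 * int m + int (penalty N) * int N" if "i < N" for i
    using that att_root[OF that] att_sym[of N i] by fastforce
  then have "(\<Sum>j<N. int (att N j) - int K) \<le> (\<Sum>j<N. 2 * int m + int (penalty N) * int N)"
    by (intro sum_mono) auto
  also have "\<dots> < int K"
    by (simp add: base_attr_def algebra_simps)
  finally show ?thesis
    by (simp add: atLeast0_lessThan_Suc lessThan_atLeast0)
qed

text \<open>Ensures that the natural-number subtraction in the loop weight does not truncate and
  leaves something positive.\<close>

lemma sum_att_less:
  assumes "i < Suc N"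
  shows "(\<Sum>j\<in>V - {i}. att i j) < K * (N + 1)"
proof -
  have "(\<Sum>j\<in>V - {i}. int (att i j) - int K) < int K"
  proof (cases "i = N")
    case False
    then have "i < N" using assms by simp
    moreover have "2 * m < K"
    proof -
      have "1 * (2 * m) \<le> N * (2 * m)" using N_pos by (intro mult_le_mono1)
      then show ?thesis unfolding base_attr_def by linarith
    qed
    ultimately show ?thesis using row_item by simp
  qed (use row_root in simp)
  moreover have "(\<Sum>j\<in>V - {i}. int (att i j) - int K) = int (\<Sum>j\<in>V - {i}. att i j) - int N * int K"
    using assms by (simp add: sum_subtractf of_nat_sum)
  ultimately have "int (\<Sum>j\<in>V - {i}. att i j) < int (K * (N + 1))"
    by (simp add: algebra_simps)
  then show ?thesis by linarith
qed

lemma loop_sum: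
  assumes i: "i < Suc N"
  shows "(\<Sum>k<N + 1. if k = i then 0 else att i k) = (\<Sum>j\<in>V - {i}. att i j)"
proof -
  have "(\<Sum>k\<in>V. if k = i then 0 else att i k) = (\<Sum>j\<in>V - {i}. if j = i then 0 else att i j)"
    using i by (subst sum.remove[of _ i]) auto
  also have "\<dots> = (\<Sum>j\<in>V - {i}. att i j)" by (intro sum.cong) auto
  finally show ?thesis by (simp add: lessThan_atLeast0)
qed

lemma loop_weight:
  "i < Suc N \<Longrightarrow> clique_weight N m conf i i = K * (N + 1) - (\<Sum>j\<in>V - {i}. att i j)"
  unfolding clique_weight_def by (simp only: loop_sum if_True simp_thms)

sublocale regular_network V w "\<lambda>i j. of_nat (att i j)" "of_nat K"
proof
  show "0 < w {v}" if "v \<in> V" for v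
  proof -
    have "clique_weight N m conf v v > 0"
      using that sum_att_less[of v] loop_weight[of v] by simp
    then show ?thesis by simp
  qed
  show "w {u, v} = 2 * of_nat (att u v)" if "u \<noteq> v" for u v
    using that by (auto simp: clique_weight_def att_sym max_def min_def)
  show "w {v} + (\<Sum>j\<in>V - {v}. of_nat (att v j)) = of_nat K * of_nat (card V)" if "v \<in> V" for v
    using that sum_att_less[of v] loop_weight[of v]
    by (simp add: of_nat_diff algebra_simps flip: of_nat_sum)
  have "K > 0" by (simp add: base_attr_def)
  then show "0 < rat_of_nat K" by (simp only: of_nat_0_less_iff)
qed auto

text \<open>The row of an item, without the diagonal, sums to \<open>2 * m - 3\<close>. The part
  inside \<open>I\<close> is \<open>2 * (card I - 1)\<close> minus penalties; what remains for the
  cut is \<open>2 * m - 1 - 2 * card I\<close> plus penalties.\<close>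

lemma excess_cut_items:
  assumes "I \<subseteq> {..<N}"
  shows "excess_cut I = of_int (int (card I) * (2 * int m - 1 - 2 * int (card I)) +
    int (penalty N) * (\<Sum>i\<in>I. \<Sum>j\<in>I. of_bool (conf i j)))"
proof -
  have fI: "finite I" using assms finite_subset by blast
  have "(\<Sum>j\<in>V - I. int (att i j) - int K) =
      2 * int m - 1 - 2 * int (card I) + int (penalty N) * (\<Sum>j\<in>I. of_bool (conf i j))"
    if i: "i \<in> I" for i
  proof -
    have "V - {i} = (V - I) \<union> (I - {i})" using i assms by auto
    then have "(\<Sum>j\<in>V - {i}. int (att i j) - int K) =
        (\<Sum>j\<in>V - I. int (att i j) - int K) + (\<Sum>j\<in>I - {i}. int (att i j) - int K)"
      using fI by (simp add: sum.union_disjoint disjoint_iff)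
    moreover have "(\<Sum>j\<in>I - {i}. int (att i j) - int K) =
        (\<Sum>j\<in>I - {i}. 2 - int (penalty N) * of_bool (conf i j))"
      using i assms by (intro sum.cong refl att_item) auto
    moreover have "\<dots> = 2 * int (card I) - 2 - int (penalty N) * (\<Sum>j\<in>I - {i}. of_bool (conf i j))"
    proof -
      have "int (card (I - {i})) = int (card I) - 1"
        using i fI card_Suc_Diff1[OF fI i] by linarith
      then show ?thesis by (simp add: sum_subtractf sum_distrib_left del: card_Diff_insert)
    qed
    moreover have "(\<Sum>j\<in>I - {i}. of_bool (conf i j)) = (\<Sum>j\<in>I. of_bool (conf i j) :: int)"
      using fI by (intro sum.mono_neutral_left) (auto simp: conf_irrefl)
    ultimately show ?thesis using row_item[of i] i assms by (auto simp: subset_iff)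
  qed
  then have "(\<Sum>i\<in>I. \<Sum>j\<in>V - I. int (att i j) - int K) =
      int (card I) * (2 * int m - 1 - 2 * int (card I)) +
      int (penalty N) * (\<Sum>i\<in>I. \<Sum>j\<in>I. of_bool (conf i j))"
    by (simp add: sum.distrib sum_subtractf sum_distrib_left)
  moreover have "excess_cut I = of_int (\<Sum>i\<in>I. \<Sum>j\<in>V - I. int (att i j) - int K)"
    by (simp add: excess_cut_def)
  ultimately show ?thesis by simp
qed

text \<open>A clique of size \<open>m\<close> in the complement of the conflict graph; the root
  \<open>N\<close> cannot be a member.\<close>

definition clique :: "nat set \<Rightarrow> bool" where
  "clique I \<longleftrightarrow> I \<subseteq> {..<N} \<and> card I = m \<and> (\<forall>i\<in>I. \<forall>j\<in>I. \<not> conf i j)"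

lemma excess_cut_clique:
  assumes I: "clique I"
  shows "excess_cut I < 0"
proof -
  have "(\<Sum>i\<in>I. \<Sum>j\<in>I. of_bool (conf i j)) = (0::int)"
    using I by (intro sum.neutral) (auto simp: clique_def)
  moreover have "I \<subseteq> {..<N}" "card I = m" using I by (auto simp: clique_def)
  moreover have "int m * (2 * int m - 1 - 2 * int m) < 0" using m_pos by simp
  ultimately show ?thesis by (simp only: excess_cut_items of_int_less_0_iff)
qed

text \<open>If \<open>I\<close> has no conflicts, it has fewer than \<open>m\<close> elements, as
  otherwise a subset of it would be a clique; then \<open>2 * m - 1 - 2 * card I\<close> is at least
  1. A conflict is outweighed by no set size.\<close>

lemma excess_cut_no_clique_items:
  assumes no: "\<nexists>I. clique I" and I: "I \<subseteq> {..<N}" "I \<noteq> {}"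
  shows "excess_cut I > 0"
proof -
  have fI: "finite I" using I finite_subset by blast
  let ?t = "int (card I)"
  have t: "1 \<le> ?t" "?t \<le> int N"
    using I fI card_mono[of "{..<N}" I] by (auto simp: Suc_le_eq card_gt_0_iff)
  have "?t * (2 * int m - 1 - 2 * ?t) + int (penalty N) * (\<Sum>i\<in>I. \<Sum>j\<in>I. of_bool (conf i j)) > 0"
  proof (cases "\<forall>i\<in>I. \<forall>j\<in>I. \<not> conf i j")
    case True
    have "card I < m"
    proof (rule ccontr)
      assume "\<not> card I < m"
      then obtain J where "J \<subseteq> I" "card J = m" by (meson obtain_subset_with_card_n not_less)
      then have "clique J" using True I by (auto simp: clique_def)
      then show False using no by blast
    qed
    then have "?t * (2 * int m - 1 - 2 * ?t) > 0" using t by (intro mult_pos_pos) auto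
    then show ?thesis using True by simp
  next
    case False
    then obtain i j where ij: "i \<in> I" "j \<in> I" "conf i j" by blast
    \<comment> \<open>The double sum meets the conflict in both orders, so it contributes
      \<open>2 * penalty N\<close>, which exceeds \<open>2 * (card I)^2\<close>.\<close>
    then have ne: "(i, j) \<noteq> (j, i)" using conf_irrefl by auto
    have "(\<Sum>i\<in>I. \<Sum>j\<in>I. of_bool (conf i j)) = (\<Sum>(i, j)\<in>I \<times> I. of_bool (conf i j) :: int)"
      by (rule sum.cartesian_product)
    also have "\<dots> \<ge> (\<Sum>(i, j)\<in>{(i, j), (j, i)}. of_bool (conf i j))"
      using fI ij by (intro sum_mono2) auto
    also have "(\<Sum>(i, j)\<in>{(i, j), (j, i)}. of_bool (conf i j) :: int) = 2"
      using ne ij conf_sym by simp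
    finally have "int (penalty N) * 2 \<le> int (penalty N) * (\<Sum>i\<in>I. \<Sum>j\<in>I. of_bool (conf i j))"
      by (intro mult_left_mono) auto
    moreover have "?t * (2 * int m - 1 - 2 * ?t) \<ge> ?t * (1 - 2 * ?t)"
      using t m_pos by (intro mult_left_mono) auto
    moreover have "?t * ?t \<le> int N * int N" using t by (intro mult_mono) auto
    moreover have "int (penalty N) * 2 = 2 + 2 * (int N * int N)"
      by (simp add: penalty_def)
    moreover have "?t * (1 - 2 * ?t) = ?t - 2 * (?t * ?t)" by (simp add: algebra_simps)
    ultimately show ?thesis using t by linarith
  qed
  then show ?thesis by (simp only: excess_cut_items[OF I(1)] of_int_0_less_iff)
qed

text \<open>One of \<open>I\<close> and \<open>V - I\<close> avoids the root, and both have the same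
  excess.\<close>

lemma excess_cut_no_clique:
  assumes no: "\<nexists>I. clique I" and I: "I \<subset> V" "I \<noteq> {}"
  shows "excess_cut I > 0"
proof (cases "N \<in> I")
  case True
  then have "V - I \<subseteq> {..<N}" "V - I \<noteq> {}" using I by (auto simp: less_Suc_eq)
  then have "excess_cut (V - I) > 0" using excess_cut_no_clique_items[OF no] by blast
  then show ?thesis using I by (subst (asm) excess_cut_compl) (auto simp: att_sym)
next
  case False
  then have "I \<subseteq> {..<N}" using I by (auto simp: less_Suc_eq)
  then show ?thesis using excess_cut_no_clique_items[OF no] I by blast
qed

lemma finite_structures: "finite {P. community_structure G P}"
  by (rule finite_subset[of _ "Pow (Pow V)"]) (auto simp: community_structure_def partition_on_def)

lemma modularity_le_Q_OPT: "community_structure G P \<Longrightarrow> modularity G P \<le> Q_OPT G"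
  unfolding Q_OPT_def using finite_structures by (intro Max_ge) auto

lemma community_structure_trivial: "community_structure G {V}"
  by (auto simp: community_structure_def partition_on_def)

lemma modularity_trivial: "modularity G {V} = 0"
  by (simp add: modularity_excess[OF community_structure_trivial] excess_cut_def)

text \<open>Two communities suffice: both sides of the cut around the clique have the same negative
  excess.\<close>

lemma Q_OPT_clique:
  assumes "clique I"
  shows "Q_OPT G > 0"
proof -
  have I: "I \<subseteq> V" "V - I \<noteq> {}" "I \<noteq> {}" "I \<noteq> V - I"
    using assms m_pos by (auto simp: clique_def)
  then have cs: "community_structure G {I, V - I}"
    by (auto simp: community_structure_def partition_on_def disjoint_def)
  have "excess_cut (V - I) = excess_cut I"
    using I by (subst excess_cut_compl) (auto simp: att_sym)
  then have "modularity G {I, V - I} > 0"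
    using excess_cut_clique[OF assms] I c_pos
    by (simp add: modularity_excess[OF cs] divide_neg_pos)
  then show ?thesis using modularity_le_Q_OPT[OF cs] by simp
qed

lemma modularity_no_clique:
  assumes no: "\<nexists>I. clique I" and cs: "community_structure G P" and P: "P \<noteq> {V}"
  shows "modularity G P < 0"
proof -
  have part: "partition_on V P" using cs by (simp add: community_structure_def)
  have proper: "C \<subset> V" "C \<noteq> {}" if "C \<in> P" for C
  proof -
    show "C \<noteq> {}" using that part by (auto simp: partition_on_def)
    have "C \<subseteq> V" using that part by (auto simp: partition_on_def)
    \<comment> \<open>If \<open>V\<close> itself is a community, disjointness leaves no room for
      another one and \<open>P = {V}\<close>.\<close>
    moreover have "C \<noteq> V"
    proof
      assume "C = V"
      have "D = V" if "D \<in> P" for D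
      proof (rule ccontr)
        assume "D \<noteq> V"
        then have "D \<inter> V = {}"
          using part \<open>C \<in> P\<close> that \<open>C = V\<close> by (auto simp: partition_on_def dest: disjointD)
        moreover have "D \<subseteq> V" "D \<noteq> {}" using part that by (auto simp: partition_on_def)
        ultimately show False by blast
      qed
      then show False using P \<open>C \<in> P\<close> by blast
    qed
    ultimately show "C \<subset> V" by blast
  qed
  have "finite P" "P \<noteq> {}"
    using part by (auto simp: partition_on_def intro!: finite_UnionD)
  then have "(\<Sum>C\<in>P. excess_cut C) > 0"
    using excess_cut_no_clique[OF no] proper by (intro sum_pos) auto
  then show ?thesis
    using c_pos by (simp add: modularity_excess[OF cs] divide_neg_pos)
qed

text \<open>Without a clique, \<open>Q_OPT G \<ge> 0\<close> forces
  \<open>modularity G P \<ge> 0\<close>, which only the trivial partition attains. With a clique,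
  \<rho> times the optimum is positive, but the trivial partition has modularity 0.\<close>

lemma approximation_detects_clique:
  assumes "community_structure G P" "\<rho> > 0" "real_of_rat (modularity G P) \<ge> \<rho> * of_rat (Q_OPT G)"
  shows "P \<noteq> {V} \<longleftrightarrow> (\<exists>I. clique I)"
proof
  have Q: "Q_OPT G \<ge> 0"
    using modularity_le_Q_OPT[OF community_structure_trivial] by (simp add: modularity_trivial)
  then have "modularity G P \<ge> 0" using assms(2,3)
    by (smt (verit) mult_nonneg_nonneg zero_le_of_rat_iff)
  then show "\<exists>I. clique I" if "P \<noteq> {V}"
    using modularity_no_clique[OF _ assms(1) that] by (meson not_less)
  show "P \<noteq> {V}" if ex: "\<exists>I. clique I"
  proof
    assume "P = {V}"
    moreover have "\<rho> * of_rat (Q_OPT G) > 0"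
      using Q_OPT_clique ex assms(2) by auto
    ultimately show False using assms(3) by (simp add: modularity_trivial)
  qed
qed

end

section \<open>Machines: a structured language and its translation to Turing machines\<close>

section \<open>Tape programs\<close>

text \<open>Conditions see only the symbols under the heads, and \<open>Act\<close> touches a single
  tape. \<open>Run\<close> embeds the transition function of a machine with \<open>n\<close> states;
  through it the approximation algorithm is called as a subroutine.\<close>

datatype prog =
    Skip
  | Act nat "nat option" move
  | Seq prog prog
  | Cond "nat list \<Rightarrow> bool" prog prog
  | While "nat list \<Rightarrow> bool" prog
  | Run nat "nat \<Rightarrow> nat list \<Rightarrow> action option"

definition stay :: "nat list \<Rightarrow> (nat \<times> move) list" where
  "stay xs = map (\<lambda>s. (s, Stay)) xs"

fun goto :: "(nat \<Rightarrow> nat) \<Rightarrow> action option \<Rightarrow> action option" where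
  "goto g None = None"
| "goto g (Some (q, as)) = Some (g q, as)"

text \<open>A program \<open>p\<close> uses the states below \<open>prog_size p\<close>; it starts in state 0 and
  terminates by entering state \<open>prog_size p\<close>.\<close>

fun prog_size :: "prog \<Rightarrow> nat" where
  "prog_size Skip = 1"
| "prog_size (Act j w m) = 1"
| "prog_size (Seq a b) = prog_size a + prog_size b"
| "prog_size (Cond P a b) = 1 + prog_size a + prog_size b"
| "prog_size (While P a) = 1 + prog_size a"
| "prog_size (Run n d) = Suc n"

fun prog_delta :: "prog \<Rightarrow> nat \<Rightarrow> nat list \<Rightarrow> action option" where
  "prog_delta Skip q xs = Some (1, stay xs)"
| "prog_delta (Act j w m) q xs =
     Some (1, (stay xs)[j := (case w of None \<Rightarrow> xs ! j | Some s \<Rightarrow> s, m)])"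
| "prog_delta (Seq a b) q xs =
     (if q < prog_size a then prog_delta a q xs
      else goto (\<lambda>q. q + prog_size a) (prog_delta b (q - prog_size a) xs))"
| "prog_delta (Cond P a b) q xs =
     (if q = 0 then Some (if P xs then 1 else 1 + prog_size a, stay xs)
      else if q \<le> prog_size a then
        goto (\<lambda>q. if q = prog_size a then 1 + prog_size a + prog_size b else q + 1)
          (prog_delta a (q - 1) xs)
      else goto (\<lambda>q. q + 1 + prog_size a) (prog_delta b (q - 1 - prog_size a) xs))"
| "prog_delta (While P a) q xs =
     (if q = 0 then Some (if P xs then 1 else 1 + prog_size a, stay xs)
      else goto (\<lambda>q. if q = prog_size a then 0 else q + 1) (prog_delta a (q - 1) xs))"
| "prog_delta (Run n d) q xs =
     (case if q < n then d q xs else None of None \<Rightarrow> Some (Suc n, stay xs) | Some a \<Rightarrow> Some a)"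

definition pstep :: "prog \<Rightarrow> config \<Rightarrow> config \<Rightarrow> bool" where
  "pstep p c c' \<longleftrightarrow> fst c < prog_size p \<and>
     (\<exists>q' as. prog_delta p (fst c) (map read_tape (snd c)) = Some (q', as) \<and>
       c' = (q', map2 act as (snd c)))"

text \<open>\<open>T\<close> is only an upper bound, so that branches of different cost can share
  one time.\<close>

definition exec :: "prog \<Rightarrow> tape list \<Rightarrow> nat \<Rightarrow> tape list \<Rightarrow> bool" where
  "exec p ts T ts' \<longleftrightarrow> (\<exists>t\<le>T. (pstep p ^^ t) (0, ts) (prog_size p, ts'))"

lemma act_stay [simp]: "map2 act (stay (map read_tape ts)) ts = ts"
  by (induction ts) (auto simp: stay_def)

lemma relpowp_lift:
  assumes "(R ^^ t) c c'" and "\<And>c c'. R c c' \<Longrightarrow> R' (f c) (f c')"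
  shows "(R' ^^ t) (f c) (f c')"
  using assms(1) by (induction t arbitrary: c') (auto intro: assms(2) relcomppI)

lemma prog_delta_goto:
  assumes "pstep p c c'"
    and "\<And>q xs. q < prog_size p \<Longrightarrow> prog_delta p' (g q) xs = goto h (prog_delta p q xs)"
    and "\<And>q. q < prog_size p \<Longrightarrow> g q < prog_size p'"
  shows "pstep p' (g (fst c), snd c) (h (fst c'), snd c')"
  using assms by (auto simp: pstep_def)

text \<open>The source of all composition rules: a subprogram runs inside a larger program if some
  renaming \<open>g\<close> of its states commutes with the transition functions; \<open>g\<close>
  also says where its exit state leads.\<close>

lemma pstep_embed:
  assumes "(pstep p ^^ t) (0, ts) (prog_size p, ts')"
    and "\<And>q xs. q < prog_size p \<Longrightarrow> prog_delta p' (g q) xs = goto g (prog_delta p q xs)"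
    and "\<And>q. q < prog_size p \<Longrightarrow> g q < prog_size p'"
  shows "(pstep p' ^^ t) (g 0, ts) (g (prog_size p), ts')"
proof -
  have "(pstep p' ^^ t) ((\<lambda>(q, ts). (g q, ts)) (0, ts)) ((\<lambda>(q, ts). (g q, ts)) (prog_size p, ts'))"
    using assms(1)
  proof (rule relpowp_lift)
    fix c c' assume "pstep p c c'"
    from prog_delta_goto[OF this assms(2,3)]
    show "pstep p' ((\<lambda>(q, ts). (g q, ts)) c) ((\<lambda>(q, ts). (g q, ts)) c')"
      by (simp add: case_prod_beta)
  qed
  then show ?thesis by simp
qed

lemma goto_id [simp]: "goto (\<lambda>q. q) a = a"
  by (cases a) auto

lemma relpowp_trans: "(R ^^ s) a b \<Longrightarrow> (R ^^ t) b c \<Longrightarrow> (R ^^ (s + t)) a c"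
  by (auto simp: relpowp_add)

lemma prog_size_pos: "prog_size p > 0"
  by (induction p) auto

lemma exec_mono: "exec p ts T ts' \<Longrightarrow> T \<le> T' \<Longrightarrow> exec p ts T' ts'"
  unfolding exec_def by (meson order_trans)

lemma exec_Skip: "exec Skip ts 1 ts"
  unfolding exec_def by (intro exI[of _ 1]) (auto simp: pstep_def)

lemma exec_Act:
  assumes "j < length ts"
  shows "exec (Act j w m) ts 1
    (ts[j := act (case w of None \<Rightarrow> read_tape (ts ! j) | Some s \<Rightarrow> s, m) (ts ! j)])"
proof -
  let ?a = "(case w of None \<Rightarrow> map read_tape ts ! j | Some s \<Rightarrow> s, m)"
  have "map2 act ((stay (map read_tape ts))[j := ?a]) ts = ts[j := act ?a (ts ! j)]"
  proof (rule nth_equalityI)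
    fix i assume "i < length (map2 act ((stay (map read_tape ts))[j := ?a]) ts)"
    then have i: "i < length ts" by simp
    show "map2 act ((stay (map read_tape ts))[j := ?a]) ts ! i = ts[j := act ?a (ts ! j)] ! i"
      using i assms by (cases "ts ! i") (auto simp: stay_def nth_list_update)
  qed (simp add: stay_def)
  then show ?thesis
    using assms unfolding exec_def
    by (intro exI[of _ 1]) (auto simp: pstep_def eq_OO cong: option.case_cong)
qed

lemma exec_Seq:
  assumes "exec a ts T ts'" "exec b ts' T' ts''"
  shows "exec (Seq a b) ts (T + T') ts''"
proof -
  from assms obtain t t' where t: "t \<le> T" "(pstep a ^^ t) (0, ts) (prog_size a, ts')"
    and t': "t' \<le> T'" "(pstep b ^^ t') (0, ts') (prog_size b, ts'')"
    unfolding exec_def by blast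
  have "(pstep (Seq a b) ^^ t) (0, ts) (prog_size a, ts')"
    using pstep_embed[OF t(2), of "Seq a b" "\<lambda>q. q"] by simp
  moreover have "(pstep (Seq a b) ^^ t') (prog_size a, ts') (prog_size (Seq a b), ts'')"
    using pstep_embed[OF t'(2), of "Seq a b" "\<lambda>q. q + prog_size a"] by (simp add: add.commute)
  ultimately have "(pstep (Seq a b) ^^ (t + t')) (0, ts) (prog_size (Seq a b), ts'')"
    by (rule relpowp_trans)
  then show ?thesis using t t' unfolding exec_def by (intro exI[of _ "t + t'"]) simp
qed

lemma exec_Cond:
  assumes "P (map read_tape ts) \<Longrightarrow> exec a ts T ts'"
    and "\<not> P (map read_tape ts) \<Longrightarrow> exec b ts T ts'"
  shows "exec (Cond P a b) ts (1 + T) ts'"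
proof -
  let ?c = "Cond P a b"
  let ?g = "\<lambda>q. if q = prog_size a then 1 + prog_size a + prog_size b else q + 1"
  have start: "(pstep ?c ^^ 1) (0, ts) (if P (map read_tape ts) then 1 else 1 + prog_size a, ts)"
    by (auto simp: pstep_def)
  show ?thesis
  proof (cases "P (map read_tape ts)")
    case True
    then obtain t where t: "t \<le> T" "(pstep a ^^ t) (0, ts) (prog_size a, ts')"
      using assms(1) unfolding exec_def by blast
    have "(pstep ?c ^^ t) (?g 0, ts) (?g (prog_size a), ts')"
      by (rule pstep_embed[OF t(2)]) auto
    then have "(pstep ?c ^^ t) (1, ts) (prog_size ?c, ts')" using prog_size_pos[of a] by simp
    then have "(pstep ?c ^^ (1 + t)) (0, ts) (prog_size ?c, ts')"
      using start True by (intro relpowp_trans[where b = "(1, ts)"]) auto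
    then show ?thesis using t unfolding exec_def by (intro exI[of _ "1 + t"]) simp
  next
    case False
    then obtain t where t: "t \<le> T" "(pstep b ^^ t) (0, ts) (prog_size b, ts')"
      using assms(2) unfolding exec_def by blast
    have "(pstep ?c ^^ t) (0 + 1 + prog_size a, ts) (prog_size b + 1 + prog_size a, ts')"
      by (rule pstep_embed[OF t(2)]) auto
    then have "(pstep ?c ^^ (1 + t)) (0, ts) (prog_size ?c, ts')"
      using start False by (intro relpowp_trans[where b = "(1 + prog_size a, ts)"]) (auto simp: add_ac)
    then show ?thesis using t unfolding exec_def by (intro exI[of _ "1 + t"]) simp
  qed
qed

lemma exec_While_False:
  assumes "\<not> P (map read_tape ts)"
  shows "exec (While P a) ts 1 ts"
  using assms unfolding exec_def by (intro exI[of _ 1]) (auto simp: pstep_def)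

lemma exec_While_True:
  assumes "P (map read_tape ts)" "exec a ts T ts'" "exec (While P a) ts' T' ts''"
  shows "exec (While P a) ts (1 + T + T') ts''"
proof -
  let ?c = "While P a"
  let ?g = "\<lambda>q. if q = prog_size a then 0 else q + 1"
  from assms obtain t t' where t: "t \<le> T" "(pstep a ^^ t) (0, ts) (prog_size a, ts')"
    and t': "t' \<le> T'" "(pstep ?c ^^ t') (0, ts') (prog_size ?c, ts'')"
    unfolding exec_def by blast
  have "(pstep ?c ^^ 1) (0, ts) (1, ts)"
    using assms(1) by (auto simp: pstep_def)
  moreover have "(pstep ?c ^^ t) (?g 0, ts) (?g (prog_size a), ts')"
    by (rule pstep_embed[OF t(2)]) auto
  then have "(pstep ?c ^^ t) (1, ts) (0, ts')" using prog_size_pos[of a] by simp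
  ultimately have "(pstep ?c ^^ (1 + t + t')) (0, ts) (prog_size ?c, ts'')"
    using t'(2) by (meson relpowp_trans)
  then show ?thesis using t t' unfolding exec_def by (intro exI[of _ "1 + t + t'"]) simp
qed

text \<open>The loop invariant is the sequence \<open>S\<close> itself: \<open>S i\<close> is the
  exact tape list before iteration \<open>i\<close>.\<close>

lemma exec_While:
  assumes "\<And>i. i < n \<Longrightarrow> P (map read_tape (S i))" "\<not> P (map read_tape (S n))"
    and "\<And>i. i < n \<Longrightarrow> exec a (S i) T (S (Suc i))"
  shows "exec (While P a) (S 0) (n * (T + 1) + 1) (S n)"
  using assms
proof (induction n arbitrary: S)
  case 0
  then show ?case using exec_While_False by simp
next
  case (Suc n)
  have "exec (While P a) (S (Suc 0)) (n * (T + 1) + 1) (S (Suc n))"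
    by (rule Suc.IH[of "\<lambda>i. S (Suc i)"]) (use Suc.prems in auto)
  from exec_While_True[OF _ _ this] Suc.prems
  have "exec (While P a) (S 0) (1 + T + (n * (T + 1) + 1)) (S (Suc n))" by blast
  then show ?case by (simp add: add_ac)
qed

text \<open>When the embedded machine has no action, one further step leads to the exit state, hence
  \<open>t + 1\<close>.\<close>

lemma exec_Run:
  assumes "((\<lambda>c c'. fst c < n \<and> (\<exists>q' as. d (fst c) (map read_tape (snd c)) = Some (q', as) \<and>
      c' = (q', map2 act as (snd c)))) ^^ t) (0, ts) (q, ts')"
    and "q < n" "d q (map read_tape ts') = None"
  shows "exec (Run n d) ts (t + 1) ts'"
proof -
  have "(pstep (Run n d) ^^ t) (0, ts) (q, ts')"
    using relpowp_lift[OF assms(1), of "pstep (Run n d)" "\<lambda>c. c"] by (fastforce simp: pstep_def)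
  moreover have "(pstep (Run n d) ^^ 1) (q, ts') (prog_size (Run n d), ts')"
    using assms(2,3) by (auto simp: pstep_def)
  ultimately have "(pstep (Run n d) ^^ (t + 1)) (0, ts) (prog_size (Run n d), ts')"
    by (rule relpowp_trans)
  then show ?thesis unfolding exec_def by blast
qed

section \<open>Well-formed programs as Turing machines\<close>

fun wf_prog :: "nat \<Rightarrow> nat \<Rightarrow> prog \<Rightarrow> bool" where
  "wf_prog K S Skip \<longleftrightarrow> True"
| "wf_prog K S (Act j w m) \<longleftrightarrow> j < K \<and> (\<forall>s. w = Some s \<longrightarrow> s < S)"
| "wf_prog K S (Seq a b) \<longleftrightarrow> wf_prog K S a \<and> wf_prog K S b"
| "wf_prog K S (Cond P a b) \<longleftrightarrow> wf_prog K S a \<and> wf_prog K S b"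
| "wf_prog K S (While P a) \<longleftrightarrow> wf_prog K S a"
| "wf_prog K S (Run n d) \<longleftrightarrow>
     (\<forall>q<n. \<forall>xs q' as. length xs = K \<and> set xs \<subseteq> {..<S} \<and> d q xs = Some (q', as) \<longrightarrow>
        q' < n \<and> length as = K \<and> fst ` set as \<subseteq> {..<S})"

definition proper_move :: "nat \<Rightarrow> nat \<Rightarrow> (nat \<times> move) list \<Rightarrow> bool" where
  "proper_move K S as \<longleftrightarrow> length as = K \<and> fst ` set as \<subseteq> {..<S}"

lemma proper_stay: "length xs = K \<Longrightarrow> set xs \<subseteq> {..<S} \<Longrightarrow> proper_move K S (stay xs)"
  by (auto simp: proper_move_def stay_def)

lemma goto_eq_Some: "goto g a = Some (q, as) \<longleftrightarrow> (\<exists>q'. a = Some (q', as) \<and> q = g q')"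
  by (cases a) auto

lemma prog_delta_proper:
  assumes "wf_prog K S p" "length xs = K" "set xs \<subseteq> {..<S}"
    and "q < prog_size p" "prog_delta p q xs = Some (q', as)"
  shows "q' \<le> prog_size p \<and> proper_move K S as"
  using assms
proof (induction p arbitrary: q q')
  case (Act j w m)
  have "fst ` set ((stay xs)[j := (case w of None \<Rightarrow> xs ! j | Some s \<Rightarrow> s, m)]) \<subseteq>
      insert (case w of None \<Rightarrow> xs ! j | Some s \<Rightarrow> s) (fst ` set (stay xs))"
    using set_update_subset_insert by fastforce
  also have "\<dots> \<subseteq> {..<S}"
    using Act proper_stay[OF Act(2,3)] nth_mem[of j xs] subsetD[OF Act(3), of "xs ! j"]
    by (auto simp: proper_move_def split: option.splits)
  finally show ?case using Act by (auto simp: proper_move_def stay_def)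
next
  case (Seq a b)
  show ?case
  proof (cases "q < prog_size a")
    case True
    then show ?thesis using Seq.IH(1)[of q q'] Seq.prems by auto
  next
    case False
    then obtain r where "prog_delta b (q - prog_size a) xs = Some (r, as)" "q' = r + prog_size a"
      using Seq.prems by (auto simp: goto_eq_Some)
    then show ?thesis using Seq.IH(2)[of "q - prog_size a" r] Seq.prems False by auto
  qed
next
  case (Cond P a b)
  consider "q = 0" | "0 < q" "q \<le> prog_size a" | "q > prog_size a" by linarith
  then show ?case
  proof cases
    case 1
    then show ?thesis using Cond.prems proper_stay[of xs K S] by auto
  next
    case 2
    then obtain r where "prog_delta a (q - 1) xs = Some (r, as)"
      "q' = (if r = prog_size a then 1 + prog_size a + prog_size b else r + 1)"
      using Cond.prems by (auto simp: goto_eq_Some)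
    moreover have "q - 1 < prog_size a" using 2 by linarith
    ultimately have "r \<le> prog_size a \<and> proper_move K S as"
      using Cond.IH(1)[of "q - 1" r] Cond.prems by simp
    then show ?thesis using \<open>q' = _\<close> by auto
  next
    case 3
    then obtain r where "prog_delta b (q - 1 - prog_size a) xs = Some (r, as)"
      "q' = r + 1 + prog_size a"
      using Cond.prems by (auto simp: goto_eq_Some)
    then show ?thesis using Cond.IH(2)[of "q - 1 - prog_size a" r] Cond.prems 3 by auto
  qed
next
  case (While P a)
  show ?case
  proof (cases "q = 0")
    case True
    then show ?thesis using While.prems proper_stay[of xs K S] by auto
  next
    case False
    then obtain r where "prog_delta a (q - 1) xs = Some (r, as)"
      "q' = (if r = prog_size a then 0 else r + 1)"
      using While.prems by (auto simp: goto_eq_Some)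
    then show ?thesis using While.IH[of "q - 1" r] While.prems False by auto
  qed
next
  case (Run n d)
  show ?case
  proof (cases "if q < n then d q xs else None")
    case None
    then show ?thesis using Run proper_stay[of xs K S] by auto
  next
    case (Some a)
    then have "q < n" "d q xs = Some (q', as)"
      using Run by (auto split: if_splits)
    then show ?thesis using Run by (fastforce simp: proper_move_def)
  qed
qed (auto simp: proper_stay)

text \<open>States 0 and 1 are reserved as initial and accepting, so program states are shifted by
  2. State 0 only jumps into the program; the exit state \<open>prog_size p + 2\<close> moves to
  state 1 or halts, as \<open>P\<close> decides.\<close>

definition tm_of :: "nat \<Rightarrow> nat \<Rightarrow> prog \<Rightarrow> (nat list \<Rightarrow> bool) \<Rightarrow> tm" where
  "tm_of K S p P = \<lparr>tm_tapes = K, tm_syms = S, tm_states = prog_size p + 3,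
     tm_delta = (\<lambda>q xs.
       if q = 0 then {(2, stay xs)}
       else if q = 1 then {}
       else if q = prog_size p + 2 then (if P xs then {(1, stay xs)} else {})
       else if q < prog_size p + 2 then
         (case prog_delta p (q - 2) xs of None \<Rightarrow> {} | Some (q', as) \<Rightarrow> {(q' + 2, as)})
       else {})\<rparr>"

lemma wf_tm_of:
  assumes "K \<ge> 1" "S \<ge> 3" "wf_prog K S p"
  shows "wf_tm (tm_of K S p P)"
  unfolding wf_tm_def
proof (intro conjI allI impI ballI)
  fix q xs a
  assume q: "q < tm_states (tm_of K S p P)"
    and xs: "length xs = tm_tapes (tm_of K S p P) \<and> set xs \<subseteq> {..<tm_syms (tm_of K S p P)}"
    and a: "a \<in> tm_delta (tm_of K S p P) q xs"
  have xs': "length xs = K" "set xs \<subseteq> {..<S}" using xs by (auto simp: tm_of_def)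
  note stay = proper_stay[OF xs', unfolded proper_move_def]
  show "case a of (q', as) \<Rightarrow> q' < tm_states (tm_of K S p P) \<and>
      length as = tm_tapes (tm_of K S p P) \<and> fst ` set as \<subseteq> {..<tm_syms (tm_of K S p P)}"
  proof (cases "2 \<le> q \<and> q < prog_size p + 2")
    case True
    then obtain q' as where d: "prog_delta p (q - 2) xs = Some (q', as)" "a = (q' + 2, as)"
      using a by (auto simp: tm_of_def split: option.splits)
    then show ?thesis
      using prog_delta_proper[OF assms(3) xs' _ d(1)] True
      by (auto simp: tm_of_def proper_move_def less_diff_conv2)
  next
    case False
    then show ?thesis using a stay by (auto simp: tm_of_def split: if_splits)
  qed
qed (use assms in \<open>auto simp: tm_of_def\<close>)

lemma deterministic_tm_of: "deterministic (tm_of K S p P)"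
  by (auto simp: deterministic_def tm_of_def split: option.splits)

lemma deterministic_step: "deterministic M \<Longrightarrow> step M c c' \<Longrightarrow> step M c c'' \<Longrightarrow> c' = c''"
  unfolding deterministic_def step_def by fastforce

text \<open>Every computation is a prefix of the halting one. This yields the time bound for all
  computations as well as the uniqueness of the result.\<close>

lemma deterministic_run:
  assumes "deterministic M" "(step M ^^ t) c c'" "halted M c'" "(step M ^^ s) c d"
  shows "s \<le> t \<and> (step M ^^ (t - s)) d c'"
  using assms(2,4)
proof (induction s arbitrary: d)
  case 0
  then show ?case by simp
next
  case (Suc s)
  then obtain e where e: "(step M ^^ s) c e" "step M e d" by auto
  with Suc have IH: "s \<le> t" "(step M ^^ (t - s)) e c'" by auto
  have "t \<noteq> s"
  proof
    assume "t = s"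
    then have "e = c'" using IH(2) by simp
    then show False using e(2) assms(3) unfolding halted_def by blast
  qed
  then obtain r where r: "t - s = Suc r" using IH(1) by (metis Suc_diff_Suc le_neq_implies_less)
  then obtain f where "step M e f" "(step M ^^ r) f c'"
    using IH(2) by (metis relpowp_Suc_D2)
  then have "(step M ^^ r) d c'" using e(2) deterministic_step[OF assms(1)] by blast
  moreover have "r = t - Suc s" "Suc s \<le> t" using r by auto
  ultimately show ?case by simp
qed

lemma deterministic_halted_unique:
  assumes "deterministic M" "(step M)\<^sup>*\<^sup>* c d" "halted M d" "(step M)\<^sup>*\<^sup>* c e" "halted M e"
  shows "d = e"
proof -
  obtain t s where ts: "(step M ^^ t) c d" "(step M ^^ s) c e"
    using assms by (meson rtranclp_imp_relpowp)
  have "(step M ^^ (t - s)) e d"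
    using deterministic_run[OF assms(1) ts(1) assms(3) ts(2)] by blast
  then show ?thesis
  proof (cases "t - s")
    case (Suc n)
    then obtain f where "step M e f" using \<open>(step M ^^ (t - s)) e d\<close> by (metis relpowp_Suc_D2)
    then show ?thesis using assms(5) unfolding halted_def by blast
  qed simp
qed

lemma tm_of_run:
  assumes "exec p (snd (init (tm_of K S p P) x)) T ts"
  obtains t c where "t \<le> T + 2" "(step (tm_of K S p P) ^^ t) (init (tm_of K S p P) x) c"
    "halted (tm_of K S p P) c" "fst c = 1 \<longleftrightarrow> P (map read_tape ts)"
proof -
  let ?M = "tm_of K S p P"
  let ?ts = "snd (init ?M x)"
  obtain t where t: "t \<le> T" "(pstep p ^^ t) (0, ?ts) (prog_size p, ts)"
    using assms unfolding exec_def by blast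
  have "(step ?M ^^ t) ((\<lambda>(q, ts). (q + 2, ts)) (0, ?ts)) ((\<lambda>(q, ts). (q + 2, ts)) (prog_size p, ts))"
    using t(2) by (rule relpowp_lift) (auto simp: pstep_def step_def tm_of_def)
  then have run: "(step ?M ^^ t) (2, ?ts) (prog_size p + 2, ts)"
    by (simp add: numeral_2_eq_2)
  have first: "(step ?M ^^ 1) (init ?M x) (2, ?ts)"
  proof -
    have "(step ?M ^^ 1) (0, us) (2, us)" for us by (auto simp: step_def tm_of_def eq_OO)
    moreover have "init ?M x = (0, ?ts)" by (simp add: init_def)
    ultimately show ?thesis by metis
  qed
  have reach: "(step ?M ^^ (1 + t)) (init ?M x) (prog_size p + 2, ts)"
    using first run by (rule relpowp_trans)
  show ?thesis
  proof (cases "P (map read_tape ts)")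
    case True
    then have "(step ?M ^^ 1) (prog_size p + 2, ts) (1, ts)"
      by (auto simp: step_def tm_of_def eq_OO)
    then have "(step ?M ^^ (1 + t + 1)) (init ?M x) (1, ts)"
      using reach by (rule relpowp_trans[rotated])
    moreover have "halted ?M (1, ts)" by (auto simp: halted_def step_def tm_of_def)
    ultimately show ?thesis using True t(1) by (intro that[of "1 + t + 1" "(1, ts)"]) auto
  next
    case False
    then have "halted ?M (prog_size p + 2, ts)"
      by (auto simp: halted_def step_def tm_of_def)
    then show ?thesis using reach False t(1)
      by (intro that[of "1 + t" "(prog_size p + 2, ts)"]) auto
  qed
qed

lemma class_P_intro:
  assumes "K \<ge> 1" "S \<ge> 3" "wf_prog K S p"
    and "\<And>x. \<exists>ts. exec p (snd (init (tm_of K S p P) x)) (poly r (length x)) ts \<and>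
      (P (map read_tape ts) \<longleftrightarrow> x \<in> L)"
  shows "L \<in> class_P"
proof -
  let ?M = "tm_of K S p P"
  have *: "\<exists>t c. t \<le> poly r (length x) + 2 \<and> (step ?M ^^ t) (init ?M x) c \<and> halted ?M c \<and>
      (fst c = 1 \<longleftrightarrow> x \<in> L)" for x
    using assms(4)[of x] by (elim exE conjE) (erule tm_of_run, blast)
  have "x \<in> L \<longleftrightarrow> accepts ?M x" for x
  proof -
    obtain t c where c: "(step ?M ^^ t) (init ?M x) c" "halted ?M c" "fst c = 1 \<longleftrightarrow> x \<in> L"
      using * by blast
    have "accepts ?M x \<longleftrightarrow> fst c = 1"
      using deterministic_halted_unique[OF deterministic_tm_of] c(2) relpowp_imp_rtranclp[OF c(1)]
      unfolding accepts_def by blast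
    then show ?thesis using c by simp
  qed
  moreover have "poly_time_on ?M UNIV"
    unfolding poly_time_on_def
  \<comment> \<open>The two extra steps are the jump from state 0 and the move to state 1.\<close>
  proof (intro exI[of _ "r + [:2:]"] ballI allI impI)
    fix x s d assume s: "(step ?M ^^ s) (init ?M x) d"
    obtain t c where c: "t \<le> poly r (length x) + 2" "(step ?M ^^ t) (init ?M x) c" "halted ?M c"
      using * by blast
    have "s \<le> t" using deterministic_run[OF deterministic_tm_of c(2,3) s] by blast
    then show "s \<le> poly (r + [:2:]) (length x)" using c(1) by simp
  qed
  ultimately show ?thesis
    unfolding class_P_def using wf_tm_of[OF assms(1-3)] deterministic_tm_of by blast
qed

section \<open>Arithmetic with unary counters in polynomial time\<close>

section \<open>Unary registers\<close>

text \<open>A register is a tape that carries the symbol 1 in cell 0 and blanks elsewhere; its value is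
  the position of the head. Tape 0 is the input tape and register \<open>r\<close> is tape \<open>r + 1\<close>.\<close>

definition layout :: "bool list \<Rightarrow> nat \<Rightarrow> nat \<Rightarrow> (nat \<Rightarrow> nat) \<Rightarrow> tape list \<Rightarrow> tape list" where
  "layout x h R \<rho> rest =
     (fst (input_tape x), h) # map (\<lambda>r. (\<lambda>i. if i = 0 then 1 else 0, \<rho> r)) [0..<R] @ rest"

text \<open>The mark in cell 0 is the zero test: a blank under the head means that the head has left
  cell 0.\<close>

definition nonzero :: "nat \<Rightarrow> nat list \<Rightarrow> bool" where
  "nonzero r xs \<longleftrightarrow> xs ! Suc r = 0"

abbreviation "Inc r \<equiv> Act (Suc r) None Go_Right"
abbreviation "Dec r \<equiv> Act (Suc r) None Go_Left"

lemma length_layout: "length (layout x h R \<rho> rest) = Suc R + length rest"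
  by (simp add: layout_def)

lemma layout_0 [simp]: "layout x h R \<rho> rest ! 0 = (fst (input_tape x), h)"
  by (simp add: layout_def)

lemma layout_reg [simp]: "r < R \<Longrightarrow> layout x h R \<rho> rest ! Suc r = (\<lambda>i. if i = 0 then 1 else 0, \<rho> r)"
  by (simp add: layout_def nth_append)

lemma layout_rest [simp]: "layout x h R \<rho> rest ! Suc (R + i) = rest ! i"
  by (simp add: layout_def nth_append)

lemma layout_update_0 [simp]:
  "(layout x h R \<rho> rest)[0 := (fst (input_tape x), h')] = layout x h' R \<rho> rest"
  by (simp add: layout_def)

lemma layout_update_reg [simp]:
  assumes "r < R"
  shows "(layout x h R \<rho> rest)[Suc r := (\<lambda>i. if i = 0 then 1 else 0, n)] = layout x h R (\<rho>(r := n)) rest"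
proof -
  let ?f = "\<lambda>\<rho> r. (\<lambda>i. if i = 0 then 1 else 0 :: nat, \<rho> r :: nat)"
  have "(map (?f \<rho>) [0..<R])[r := (\<lambda>i. if i = 0 then 1 else 0, n)] = map (?f (\<rho>(r := n))) [0..<R]"
    using assms by (intro nth_equalityI) (auto simp: nth_list_update)
  then show ?thesis using assms by (simp add: layout_def list_update_append)
qed

lemma layout_update_rest [simp]:
  "(layout x h R \<rho> rest)[Suc (R + i) := t] = layout x h R \<rho> (rest[i := t])"
  by (simp add: layout_def list_update_append)

lemma nonzero_layout [simp]:
  "r < R \<Longrightarrow> nonzero r (map read_tape (layout x h R \<rho> rest)) \<longleftrightarrow> \<rho> r \<noteq> 0"
  by (simp add: nonzero_def length_layout)

lemma exec_Inc: "r < R \<Longrightarrow> exec (Inc r) (layout x h R \<rho> rest) 1 (layout x h R (\<rho>(r := \<rho> r + 1)) rest)"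
  using exec_Act[of "Suc r" "layout x h R \<rho> rest" None Go_Right]
  by (simp add: length_layout fun_upd_idem)

text \<open>The subtraction is truncated because a left move on cell 0 stays there.\<close>

lemma exec_Dec: "r < R \<Longrightarrow> exec (Dec r) (layout x h R \<rho> rest) 1 (layout x h R (\<rho>(r := \<rho> r - 1)) rest)"
  using exec_Act[of "Suc r" "layout x h R \<rho> rest" None Go_Left]
  by (simp add: length_layout fun_upd_idem)

lemma exec_input_move:
  "exec (Act 0 None d) (layout x h R \<rho> rest) 1 (layout x (move_head d h) R \<rho> rest)"
  using exec_Act[of 0 "layout x h R \<rho> rest" None d]
  by (simp add: length_layout fun_upd_idem)

lemma exec_rest:
  assumes "i < length rest" "rest ! i = (t, h')"
  shows "exec (Act (Suc (R + i)) w d) (layout x h R \<rho> rest) 1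
    (layout x h R \<rho> (rest[i := (case w of None \<Rightarrow> t | Some s \<Rightarrow> t(h' := s), move_head d h')]))"
  using exec_Act[of "Suc (R + i)" "layout x h R \<rho> rest" w d] assms
  by (simp add: length_layout fun_upd_idem split: option.splits)

text \<open>The number \<open>n\<close> of iterations depends on the data; the cost is stated with a
  bound \<open>n'\<close> that may depend on the input length only.\<close>

lemma exec_While_le:
  assumes "n \<le> n'" "\<And>i. i < n \<Longrightarrow> P (map read_tape (S i))" "\<not> P (map read_tape (S n))"
    and "\<And>i. i < n \<Longrightarrow> exec a (S i) T (S (Suc i))"
  shows "exec (While P a) (S 0) (n' * (T + 1) + 1) (S n)"
proof -
  have "exec (While P a) (S 0) (n * (T + 1) + 1) (S n)"
    using assms(2-4) by (rule exec_While[where S = S])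
  then show ?thesis by (rule exec_mono) (use mult_le_mono1[OF assms(1), of "T + 1"] in simp)
qed

definition Clear :: "nat \<Rightarrow> prog" where
  "Clear r = While (nonzero r) (Dec r)"

definition Move :: "nat \<Rightarrow> nat \<Rightarrow> prog" where
  "Move r s = While (nonzero r) (Seq (Dec r) (Inc s))"

text \<open>Counting down destroys \<open>r\<close>; a second copy in \<open>f\<close> restores
  it.\<close>

definition Copy :: "nat \<Rightarrow> nat \<Rightarrow> nat \<Rightarrow> prog" where
  "Copy r s f = Seq (While (nonzero r) (Seq (Dec r) (Seq (Inc s) (Inc f)))) (Move f r)"

lemma exec_Clear:
  assumes "r < R" "\<rho> r \<le> m"
  shows "exec (Clear r) (layout x h R \<rho> rest) (2 * m + 1) (layout x h R (\<rho>(r := 0)) rest)"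
proof -
  let ?S = "\<lambda>i. layout x h R (\<rho>(r := \<rho> r - i)) rest"
  have "exec (While (nonzero r) (Dec r)) (?S 0) (m * (1 + 1) + 1) (?S (\<rho> r))"
  proof (rule exec_While_le[where S = ?S])
    fix i assume "i < \<rho> r"
    show "exec (Dec r) (?S i) 1 (?S (Suc i))"
      using exec_Dec[OF assms(1), of x h "\<rho>(r := \<rho> r - i)"] by simp
  qed (use assms in auto)
  then have "exec (Clear r) (layout x h R \<rho> rest) (m * (1 + 1) + 1) (layout x h R (\<rho>(r := 0)) rest)"
    by (simp add: Clear_def)
  then show ?thesis by (rule exec_mono) simp
qed

lemma exec_Move:
  assumes "r < R" "s < R" "r \<noteq> s" "\<rho> r \<le> m"
  shows "exec (Move r s) (layout x h R \<rho> rest) (3 * m + 1)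
    (layout x h R (\<rho>(r := 0, s := \<rho> s + \<rho> r)) rest)"
proof -
  let ?\<sigma> = "\<lambda>i. \<rho>(r := \<rho> r - i, s := \<rho> s + i)"
  let ?S = "\<lambda>i. layout x h R (?\<sigma> i) rest"
  have "exec (While (nonzero r) (Seq (Dec r) (Inc s))) (?S 0) (m * ((1 + 1) + 1) + 1) (?S (\<rho> r))"
  proof (rule exec_While_le[where S = ?S])
    fix i assume "i < \<rho> r"
    have "(?\<sigma> i)(r := ?\<sigma> i r - 1, s := ((?\<sigma> i)(r := ?\<sigma> i r - 1)) s + 1) = ?\<sigma> (Suc i)"
      using assms(3) by (auto simp: fun_eq_iff)
    then show "exec (Seq (Dec r) (Inc s)) (?S i) (1 + 1) (?S (Suc i))"
      using exec_Seq[OF exec_Dec[OF assms(1)] exec_Inc[OF assms(2)], of x h "?\<sigma> i" rest] by simp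
  qed (use assms in auto)
  then have "exec (Move r s) (layout x h R \<rho> rest) (m * ((1 + 1) + 1) + 1)
      (layout x h R (\<rho>(r := 0, s := \<rho> s + \<rho> r)) rest)"
    by (simp add: Move_def)
  then show ?thesis by (rule exec_mono) simp
qed

lemma exec_Copy:
  assumes "r < R" "s < R" "f < R" "r \<noteq> s" "r \<noteq> f" "s \<noteq> f" "\<rho> r \<le> m" "\<rho> f = 0"
  shows "exec (Copy r s f) (layout x h R \<rho> rest) (7 * m + 2)
    (layout x h R (\<rho>(s := \<rho> s + \<rho> r)) rest)"
proof -
  let ?\<sigma> = "\<lambda>i. \<rho>(r := \<rho> r - i, s := \<rho> s + i, f := i)"
  let ?S = "\<lambda>i. layout x h R (?\<sigma> i) rest"
  have "exec (While (nonzero r) (Seq (Dec r) (Seq (Inc s) (Inc f)))) (?S 0)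
      (m * ((1 + (1 + 1)) + 1) + 1) (?S (\<rho> r))"
  proof (rule exec_While_le[where S = ?S])
    fix i assume "i < \<rho> r"
    let ?\<sigma>1 = "(?\<sigma> i)(r := ?\<sigma> i r - 1)"
    let ?\<sigma>2 = "?\<sigma>1(s := ?\<sigma>1 s + 1)"
    have "?\<sigma>2(f := ?\<sigma>2 f + 1) = ?\<sigma> (Suc i)"
      using assms(4-6) by (auto simp: fun_eq_iff)
    then show "exec (Seq (Dec r) (Seq (Inc s) (Inc f))) (?S i) (1 + (1 + 1)) (?S (Suc i))"
      using exec_Seq[OF exec_Dec[OF assms(1), of x h "?\<sigma> i" rest]
        exec_Seq[OF exec_Inc[OF assms(2), of x h ?\<sigma>1] exec_Inc[OF assms(3), of x h ?\<sigma>2]]] by simp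
  qed (use assms in auto)
  moreover have "?\<sigma> 0 = \<rho>" using assms(8) by (auto simp: fun_eq_iff)
  moreover have "(?\<sigma> (\<rho> r))(f := 0, r := ?\<sigma> (\<rho> r) r + ?\<sigma> (\<rho> r) f) = \<rho>(s := \<rho> s + \<rho> r)"
    using assms(4-8) by (auto simp: fun_eq_iff)
  then have "exec (Move f r) (?S (\<rho> r)) (3 * m + 1) (layout x h R (\<rho>(s := \<rho> s + \<rho> r)) rest)"
    using exec_Move[OF assms(3,1), of "?\<sigma> (\<rho> r)" m x h rest] assms by simp
  ultimately have "exec (Copy r s f) (layout x h R \<rho> rest)
      ((m * ((1 + (1 + 1)) + 1) + 1) + (3 * m + 1)) (layout x h R (\<rho>(s := \<rho> s + \<rho> r)) rest)"
    unfolding Copy_def by (metis exec_Seq)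
  then show ?thesis by (rule exec_mono) simp
qed

section \<open>Polynomially bounded expressions\<close>

text \<open>In the absence of exponentiation all values are polynomial in the input length, so they
  may be held in unary. \<open>Inp\<close> yields the symbol in a cell of the input tape, 0 beyond
  the input.\<close>

datatype exp =
    Const nat
  | Var nat
  | Add exp exp
  | Sub exp exp
  | Mul exp exp
  | Sum nat exp exp
  | Inp exp

fun eval :: "bool list \<Rightarrow> exp \<Rightarrow> (nat \<Rightarrow> nat) \<Rightarrow> nat" where
  "eval x (Const n) \<rho> = n"
| "eval x (Var v) \<rho> = \<rho> v"
| "eval x (Add a b) \<rho> = eval x a \<rho> + eval x b \<rho>"
| "eval x (Sub a b) \<rho> = eval x a \<rho> - eval x b \<rho>"
| "eval x (Mul a b) \<rho> = eval x a \<rho> * eval x b \<rho>"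
| "eval x (Sum v a b) \<rho> = (\<Sum>i<eval x a \<rho>. eval x b (\<rho>(v := i)))"
| "eval x (Inp a) \<rho> = fst (input_tape x) (eval x a \<rho>)"

fun bounded :: "nat \<Rightarrow> exp \<Rightarrow> bool" where
  "bounded V (Const n) \<longleftrightarrow> True"
| "bounded V (Var v) \<longleftrightarrow> v < V"
| "bounded V (Add a b) \<longleftrightarrow> bounded V a \<and> bounded V b"
| "bounded V (Sub a b) \<longleftrightarrow> bounded V a \<and> bounded V b"
| "bounded V (Mul a b) \<longleftrightarrow> bounded V a \<and> bounded V b"
| "bounded V (Sum v a b) \<longleftrightarrow> v < V \<and> bounded V a \<and> bounded V b"
| "bounded V (Inp a) \<longleftrightarrow> bounded V a"

lemma eval_cong: "bounded V e \<Longrightarrow> (\<And>v. v < V \<Longrightarrow> \<rho> v = \<sigma> v) \<Longrightarrow> eval x e \<rho> = eval x e \<sigma>"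
proof (induction e arbitrary: \<rho> \<sigma>)
  case (Sum v a b)
  have "eval x a \<rho> = eval x a \<sigma>" using Sum.IH(1)[of \<rho> \<sigma>] Sum.prems by simp
  moreover have "eval x b (\<rho>(v := i)) = eval x b (\<sigma>(v := i))" for i
    using Sum.prems by (intro Sum.IH(2)) auto
  ultimately show ?case by simp
next
  case (Add a b)
  show ?case using Add.IH(1)[of \<rho> \<sigma>] Add.IH(2)[of \<rho> \<sigma>] Add.prems by simp
next
  case (Sub a b)
  show ?case using Sub.IH(1)[of \<rho> \<sigma>] Sub.IH(2)[of \<rho> \<sigma>] Sub.prems by simp
next
  case (Mul a b)
  show ?case using Mul.IH(1)[of \<rho> \<sigma>] Mul.IH(2)[of \<rho> \<sigma>] Mul.prems by simp
next
  case (Inp a)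
  show ?case using Inp.IH[of \<rho> \<sigma>] Inp.prems by simp
qed simp_all

text \<open>The index of a sum stays below the bound of its range, so the body is evaluated in an
  environment bounded by \<open>m + value_bound a m\<close>.\<close>

fun value_bound :: "exp \<Rightarrow> nat \<Rightarrow> nat" where
  "value_bound (Const n) m = n"
| "value_bound (Var v) m = m"
| "value_bound (Add a b) m = value_bound a m + value_bound b m"
| "value_bound (Sub a b) m = value_bound a m"
| "value_bound (Mul a b) m = value_bound a m * value_bound b m"
| "value_bound (Sum v a b) m = value_bound a m * value_bound b (m + value_bound a m)"
| "value_bound (Inp a) m = 2"

lemma eval_le:
  "bounded V e \<Longrightarrow> (\<And>v. v < V \<Longrightarrow> \<rho> v \<le> m) \<Longrightarrow> eval x e \<rho> \<le> value_bound e m"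
proof (induction e arbitrary: \<rho> m)
  case (Add a b)
  show ?case using Add.IH(1)[of \<rho> m] Add.IH(2)[of \<rho> m] Add.prems by simp
next
  case (Sub a b)
  show ?case using Sub.IH(1)[of \<rho> m] Sub.prems by simp
next
  case (Mul a b)
  show ?case using Mul.IH(1)[of \<rho> m] Mul.IH(2)[of \<rho> m] Mul.prems by (simp add: mult_le_mono)
next
  case (Sum v a b)
  let ?n = "value_bound a m"
  have a: "eval x a \<rho> \<le> ?n" using Sum.IH(1)[of \<rho> m] Sum.prems by simp
  have "eval x b (\<rho>(v := i)) \<le> value_bound b (m + ?n)" if i: "i < eval x a \<rho>" for i
  proof (rule Sum.IH(2))
    fix u assume "u < V"
    then show "(\<rho>(v := i)) u \<le> m + ?n" using Sum.prems(2)[of u] i a by simp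
  qed (use Sum.prems in simp)
  then have "(\<Sum>i<eval x a \<rho>. eval x b (\<rho>(v := i))) \<le> (\<Sum>i<eval x a \<rho>. value_bound b (m + ?n))"
    by (intro sum_mono) auto
  also have "\<dots> \<le> ?n * value_bound b (m + ?n)" using a by simp
  finally show ?case by simp
next
  case (Inp a)
  show ?case by (simp add: input_tape_def bit_sym_def)
qed simp_all

text \<open>Most summands are left unsimplified, in the shape in which \<open>exec_Seq\<close> and
  \<open>exec_While_le\<close> produce them, so that bounds match syntactically.\<close>

fun time_bound :: "exp \<Rightarrow> nat \<Rightarrow> nat" where
  "time_bound (Const n) m = n + 1"
| "time_bound (Var v) m = 7 * m + 2"
| "time_bound (Add a b) m = time_bound a m + time_bound b m"
| "time_bound (Sub a b) m = time_bound a m +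
     (time_bound b m + ((value_bound b m * ((1 + 1) + 1) + 1) + (3 * value_bound a m + 1)))"
| "time_bound (Mul a b) m = time_bound a m + (value_bound a m * ((1 + time_bound b m) + 1) + 1)"
| "time_bound (Sum v a b) m = time_bound a m + ((3 * m + 1) +
     ((value_bound a m * ((1 + (time_bound b (m + value_bound a m) + 1)) + 1) + 1) +
     ((2 * value_bound a m + 1) + (3 * m + 1))))"
| "time_bound (Inp a) m = time_bound a m + ((value_bound a m * 4 + 1) + (4 + (value_bound a m * 3 + 1)))"

text \<open>The number of scratch registers, from \<open>f\<close> on, reserved for
  \<open>eval_prog e d f\<close>.\<close>

fun depth :: "exp \<Rightarrow> nat" where
  "depth (Const n) = 0"
| "depth (Var v) = 1"
| "depth (Add a b) = max (depth a) (depth b)"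
| "depth (Sub a b) = 2 + max (depth a) (depth b)"
| "depth (Mul a b) = 1 + max (depth a) (depth b)"
| "depth (Sum v a b) = 2 + max (depth a) (depth b)"
| "depth (Inp a) = 2 + depth a"

text \<open>The program \<open>eval_prog e d f\<close> adds the value of \<open>e\<close> to register \<open>d\<close>; the registers from
  \<open>f\<close> on are scratch space and contain 0 before and after. A sum saves the outer value of its
  index, so that indices may be reused.\<close>

fun eval_prog :: "exp \<Rightarrow> nat \<Rightarrow> nat \<Rightarrow> prog" where
  "eval_prog (Const n) d f = ((Seq (Inc d)) ^^ n) Skip"
| "eval_prog (Var v) d f = Copy v d f"
| "eval_prog (Add a b) d f = Seq (eval_prog a d f) (eval_prog b d f)"
| "eval_prog (Sub a b) d f =
     Seq (eval_prog a f (f + 2)) (Seq (eval_prog b (f + 1) (f + 2))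
       (Seq (While (nonzero (f + 1)) (Seq (Dec (f + 1)) (Dec f))) (Move f d)))"
| "eval_prog (Mul a b) d f =
     Seq (eval_prog a f (f + 1)) (While (nonzero f) (Seq (Dec f) (eval_prog b d (f + 1))))"
| "eval_prog (Sum v a b) d f =
     Seq (eval_prog a f (f + 2)) (Seq (Move v (f + 1))
       (Seq (While (nonzero f) (Seq (Dec f) (Seq (eval_prog b d (f + 2)) (Inc v))))
         (Seq (Clear v) (Move (f + 1) v))))"
| "eval_prog (Inp a) d f =
     Seq (eval_prog a f (f + 2))
       (Seq (While (nonzero f) (Seq (Dec f) (Seq (Inc (f + 1)) (Act 0 None Go_Right))))
         (Seq (Cond (\<lambda>xs. xs ! 0 = 0) Skip (Cond (\<lambda>xs. xs ! 0 = 1) (Inc d) (Seq (Inc d) (Inc d))))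
           (While (nonzero (f + 1)) (Seq (Dec (f + 1)) (Act 0 None Go_Left)))))"

text \<open>Only register \<open>d\<close> changes in the end and the input head returns to cell 0,
  so evaluations compose. Intermediate results lie at \<open>f\<close> and above, invisible to
  \<open>eval\<close> because all variables are below \<open>V\<close>.\<close>

lemma exec_eval_prog:
  assumes "bounded V e" "V \<le> d" "d < f" "f + depth e \<le> R" "\<And>r. r \<ge> f \<Longrightarrow> \<rho> r = 0"
    and "\<And>v. v < V \<Longrightarrow> \<rho> v \<le> m"
  shows "exec (eval_prog e d f) (layout x 0 R \<rho> rest) (time_bound e m)
    (layout x 0 R (\<rho>(d := \<rho> d + eval x e \<rho>)) rest)"
  using assms
proof (induction e arbitrary: d f \<rho> m)
  case (Const n)
  have "exec (((Seq (Inc d)) ^^ n) Skip) (layout x 0 R \<rho> rest) (n + 1)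
    (layout x 0 R (\<rho>(d := \<rho> d + n)) rest)" for \<rho>
  proof (induction n arbitrary: \<rho>)
    case 0
    then show ?case using exec_Skip by simp
  next
    case (Suc n)
    have "d < R" using Const.prems by simp
    have "exec (Seq (Inc d) (((Seq (Inc d)) ^^ n) Skip)) (layout x 0 R \<rho> rest) (1 + (n + 1))
        (layout x 0 R ((\<rho>(d := \<rho> d + 1))(d := (\<rho>(d := \<rho> d + 1)) d + n)) rest)"
      using exec_Seq[OF exec_Inc[OF \<open>d < R\<close>, of x 0 \<rho>] Suc.IH[of "\<rho>(d := \<rho> d + 1)"]] .
    moreover have "(\<rho>(d := \<rho> d + 1))(d := (\<rho>(d := \<rho> d + 1)) d + n) = \<rho>(d := \<rho> d + Suc n)"
      by simp
    ultimately show ?case by (simp only: funpow.simps o_apply add_Suc plus_1_eq_Suc)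
  qed
  then show ?case by (simp only: eval_prog.simps eval.simps time_bound.simps)
next
  case (Var v)
  then show ?case using exec_Copy[of v R d f \<rho> m x 0 rest] by (simp del: fun_upd_apply)
next
  case (Add a b)
  let ?\<rho>1 = "\<rho>(d := \<rho> d + eval x a \<rho>)"
  have 1: "exec (eval_prog a d f) (layout x 0 R \<rho> rest) (time_bound a m) (layout x 0 R ?\<rho>1 rest)"
    using Add.prems by (intro Add.IH(1)) auto
  have 2: "exec (eval_prog b d f) (layout x 0 R ?\<rho>1 rest) (time_bound b m)
      (layout x 0 R (?\<rho>1(d := ?\<rho>1 d + eval x b ?\<rho>1)) rest)"
    using Add.prems by (intro Add.IH(2)) auto
  have "eval x b ?\<rho>1 = eval x b \<rho>"
    using Add.prems by (intro eval_cong[of V]) auto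
  then have "?\<rho>1(d := ?\<rho>1 d + eval x b ?\<rho>1) = \<rho>(d := \<rho> d + eval x (Add a b) \<rho>)"
    by (simp add: add.assoc)
  then show ?case using exec_Seq[OF 1 2] by (simp only: eval_prog.simps time_bound.simps)
next
  case (Sub a b)
  let ?A = "eval x a \<rho>" and ?B = "eval x b \<rho>"
  let ?\<rho>1 = "\<rho>(f := ?A)"
  let ?\<rho>2 = "?\<rho>1(f + 1 := ?B)"
  have A: "?A \<le> value_bound a m" and B: "?B \<le> value_bound b m"
    using Sub.prems eval_le[of V a \<rho> m x] eval_le[of V b \<rho> m x] by auto
  have 1: "exec (eval_prog a f (f + 2)) (layout x 0 R \<rho> rest) (time_bound a m) (layout x 0 R ?\<rho>1 rest)"
  proof -
    have "exec (eval_prog a f (f + 2)) (layout x 0 R \<rho> rest) (time_bound a m)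
        (layout x 0 R (\<rho>(f := \<rho> f + ?A)) rest)"
      using Sub.prems by (intro Sub.IH(1)) auto
    then show ?thesis using Sub.prems by (simp del: fun_upd_apply)
  qed
  have B1: "eval x b ?\<rho>1 = ?B" using Sub.prems by (intro eval_cong[of V]) auto
  have 2: "exec (eval_prog b (f + 1) (f + 2)) (layout x 0 R ?\<rho>1 rest) (time_bound b m)
      (layout x 0 R ?\<rho>2 rest)"
  proof -
    have "exec (eval_prog b (f + 1) (f + 2)) (layout x 0 R ?\<rho>1 rest) (time_bound b m)
        (layout x 0 R (?\<rho>1(f + 1 := ?\<rho>1 (f + 1) + eval x b ?\<rho>1)) rest)"
      using Sub.prems by (intro Sub.IH(2)) auto
    moreover have "?\<rho>1 (f + 1) = 0" using Sub.prems by simp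
    ultimately show ?thesis using B1 by simp
  qed
  \<comment> \<open>Both counters go down together; the first one stays at 0 once exhausted, which
    is truncated subtraction.\<close>
  let ?S = "\<lambda>i. layout x 0 R (?\<rho>2(f := ?A - i, f + 1 := ?B - i)) rest"
  have 3: "exec (While (nonzero (f + 1)) (Seq (Dec (f + 1)) (Dec f))) (?S 0)
      (value_bound b m * ((1 + 1) + 1) + 1) (?S ?B)"
  proof (rule exec_While_le[where S = ?S])
    fix i assume "i < ?B"
    let ?\<sigma> = "?\<rho>2(f := ?A - i, f + 1 := ?B - i)"
    let ?\<sigma>1 = "?\<sigma>(f + 1 := ?\<sigma> (f + 1) - 1)"
    have "?\<sigma>1(f := ?\<sigma>1 f - 1) = ?\<rho>2(f := ?A - Suc i, f + 1 := ?B - Suc i)"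
      by (auto simp: fun_eq_iff)
    then show "exec (Seq (Dec (f + 1)) (Dec f)) (?S i) (1 + 1) (?S (Suc i))"
      using exec_Seq[OF exec_Dec[of "f + 1" R x 0 ?\<sigma> rest] exec_Dec[of f R x 0 ?\<sigma>1 rest]] Sub.prems
      by simp
  qed (use Sub.prems B in auto)
  let ?\<rho>3 = "?\<rho>2(f := ?A - ?B, f + 1 := 0)"
  have "?\<rho>3(f := 0, d := ?\<rho>3 d + ?\<rho>3 f) = \<rho>(d := \<rho> d + eval x (Sub a b) \<rho>)"
    using Sub.prems by (auto simp: fun_eq_iff)
  then have 4: "exec (Move f d) (layout x 0 R ?\<rho>3 rest) (3 * value_bound a m + 1)
      (layout x 0 R (\<rho>(d := \<rho> d + eval x (Sub a b) \<rho>)) rest)"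
    using exec_Move[of f R d ?\<rho>3 "value_bound a m" x 0 rest] Sub.prems A by simp
  have e: "?\<rho>2(f := ?A - 0, f + 1 := ?B - 0) = ?\<rho>2" by (auto simp: fun_eq_iff)
  show ?case
    unfolding eval_prog.simps time_bound.simps
    by (rule exec_Seq[OF 1 exec_Seq[OF 2 exec_Seq[OF 3[unfolded e diff_self_eq_0]]]],
      rule exec_mono[OF 4]) simp
next
  case (Mul a b)
  let ?A = "eval x a \<rho>" and ?B = "eval x b \<rho>"
  let ?\<rho>1 = "\<rho>(f := ?A)"
  have A: "?A \<le> value_bound a m"
    using Mul.prems eval_le[of V a \<rho> m x] by auto
  have 1: "exec (eval_prog a f (f + 1)) (layout x 0 R \<rho> rest) (time_bound a m) (layout x 0 R ?\<rho>1 rest)"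
  proof -
    have "exec (eval_prog a f (f + 1)) (layout x 0 R \<rho> rest) (time_bound a m)
        (layout x 0 R (\<rho>(f := \<rho> f + ?A)) rest)"
      using Mul.prems by (intro Mul.IH(1)) auto
    then show ?thesis using Mul.prems by (simp del: fun_upd_apply)
  qed
  let ?\<sigma> = "\<lambda>i. \<rho>(f := ?A - i, d := \<rho> d + i * ?B)"
  let ?S = "\<lambda>i. layout x 0 R (?\<sigma> i) rest"
  have 2: "exec (While (nonzero f) (Seq (Dec f) (eval_prog b d (f + 1)))) (?S 0)
      (value_bound a m * ((1 + time_bound b m) + 1) + 1) (?S ?A)"
  proof (rule exec_While_le[where S = ?S])
    fix i assume i: "i < ?A"
    let ?\<sigma>1 = "(?\<sigma> i)(f := ?\<sigma> i f - 1)"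
    have B: "eval x b ?\<sigma>1 = ?B" using Mul.prems by (intro eval_cong[of V]) auto
    have "exec (eval_prog b d (f + 1)) (layout x 0 R ?\<sigma>1 rest) (time_bound b m)
        (layout x 0 R (?\<sigma>1(d := ?\<sigma>1 d + eval x b ?\<sigma>1)) rest)"
      using Mul.prems by (intro Mul.IH(2)) auto
    moreover have "?\<sigma>1(d := ?\<sigma>1 d + eval x b ?\<sigma>1) = ?\<sigma> (Suc i)"
      unfolding B using Mul.prems by (auto simp: fun_eq_iff)
    moreover have "exec (Dec f) (?S i) 1 (layout x 0 R ?\<sigma>1 rest)"
      using exec_Dec[of f R x 0 "?\<sigma> i" rest] Mul.prems by simp
    ultimately show "exec (Seq (Dec f) (eval_prog b d (f + 1))) (?S i) (1 + time_bound b m) (?S (Suc i))"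
      by (metis exec_Seq)
  qed (use Mul.prems A in auto)
  have "?\<sigma> 0 = ?\<rho>1" "?\<sigma> ?A = \<rho>(d := \<rho> d + eval x (Mul a b) \<rho>)"
    using Mul.prems by (auto simp: fun_eq_iff)
  then show ?case using exec_Seq[OF 1] 2 by (simp only: eval_prog.simps time_bound.simps)
next
  case (Sum v a b)
  let ?A = "eval x a \<rho>"
  let ?n = "value_bound a m"
  let ?\<rho>1 = "\<rho>(f := ?A)"
  have A: "?A \<le> ?n"
    using Sum.prems eval_le[of V a \<rho> m x] by auto
  have 1: "exec (eval_prog a f (f + 2)) (layout x 0 R \<rho> rest) (time_bound a m) (layout x 0 R ?\<rho>1 rest)"
  proof -
    have "exec (eval_prog a f (f + 2)) (layout x 0 R \<rho> rest) (time_bound a m)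
        (layout x 0 R (\<rho>(f := \<rho> f + ?A)) rest)"
      using Sum.prems by (intro Sum.IH(1)) auto
    then show ?thesis using Sum.prems by (simp del: fun_upd_apply)
  qed
  \<comment> \<open>Register \<open>f + 1\<close> keeps the outer value of \<open>v\<close>,
    register \<open>f\<close> the number of iterations left; \<open>v\<close> runs upwards and
    \<open>d\<close> collects the partial sum.\<close>
  let ?\<sigma> = "\<lambda>i. \<rho>(f + 1 := \<rho> v, f := ?A - i, v := i, d := \<rho> d + (\<Sum>j<i. eval x b (\<rho>(v := j))))"
  let ?S = "\<lambda>i. layout x 0 R (?\<sigma> i) rest"
  have "?\<rho>1(v := 0, f + 1 := ?\<rho>1 (f + 1) + ?\<rho>1 v) = ?\<sigma> 0"
    using Sum.prems by (auto simp: fun_eq_iff)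
  then have 2: "exec (Move v (f + 1)) (layout x 0 R ?\<rho>1 rest) (3 * m + 1) (?S 0)"
    using exec_Move[of v R "f + 1" ?\<rho>1 m x 0 rest] Sum.prems by simp
  let ?T = "time_bound b (m + ?n)"
  have 3: "exec (While (nonzero f) (Seq (Dec f) (Seq (eval_prog b d (f + 2)) (Inc v)))) (?S 0)
      (?n * ((1 + (?T + 1)) + 1) + 1) (?S ?A)"
  proof (rule exec_While_le[where S = ?S])
    fix i assume i: "i < ?A"
    let ?\<sigma>1 = "(?\<sigma> i)(f := ?\<sigma> i f - 1)"
    have B: "eval x b ?\<sigma>1 = eval x b (\<rho>(v := i))" using Sum.prems by (intro eval_cong[of V]) auto
    let ?\<sigma>2 = "?\<sigma>1(d := ?\<sigma>1 d + eval x b ?\<sigma>1)"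
    have "exec (eval_prog b d (f + 2)) (layout x 0 R ?\<sigma>1 rest) ?T (layout x 0 R ?\<sigma>2 rest)"
      using Sum.prems i A by (intro Sum.IH(2)) (auto simp: trans_le_add1)
    moreover have "?\<sigma>2(v := ?\<sigma>2 v + 1) = ?\<sigma> (Suc i)"
      unfolding B using Sum.prems by (auto simp: fun_eq_iff)
    then have "exec (Inc v) (layout x 0 R ?\<sigma>2 rest) 1 (?S (Suc i))"
      using exec_Inc[of v R x 0 ?\<sigma>2 rest] Sum.prems by simp
    moreover have "exec (Dec f) (?S i) 1 (layout x 0 R ?\<sigma>1 rest)"
      using exec_Dec[of f R x 0 "?\<sigma> i" rest] Sum.prems by simp
    ultimately show "exec (Seq (Dec f) (Seq (eval_prog b d (f + 2)) (Inc v))) (?S i) (1 + (?T + 1)) (?S (Suc i))"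
      by (blast intro: exec_Seq)
  qed (use Sum.prems A in auto)
  let ?\<rho>3 = "(?\<sigma> ?A)(v := 0)"
  have 4: "exec (Clear v) (?S ?A) (2 * ?n + 1) (layout x 0 R ?\<rho>3 rest)"
    using exec_Clear[of v R "?\<sigma> ?A" ?n x 0 rest] Sum.prems A by simp
  have "?\<rho>3(f + 1 := 0, v := ?\<rho>3 v + ?\<rho>3 (f + 1)) = \<rho>(d := \<rho> d + eval x (Sum v a b) \<rho>)"
    using Sum.prems by (auto simp: fun_eq_iff)
  then have 5: "exec (Move (f + 1) v) (layout x 0 R ?\<rho>3 rest) (3 * m + 1)
      (layout x 0 R (\<rho>(d := \<rho> d + eval x (Sum v a b) \<rho>)) rest)"
    using exec_Move[of "f + 1" R v ?\<rho>3 m x 0 rest] Sum.prems by simp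
  show ?case
    using exec_Seq[OF 1 exec_Seq[OF 2 exec_Seq[OF 3 exec_Seq[OF 4 5]]]]
    by (simp only: eval_prog.simps time_bound.simps)
next
  case (Inp a)
  let ?A = "eval x a \<rho>"
  let ?n = "value_bound a m"
  let ?s = "fst (input_tape x) ?A"
  let ?\<rho>1 = "\<rho>(f := ?A)"
  have A: "?A \<le> ?n"
    using Inp.prems eval_le[of V a \<rho> m x] by auto
  have 1: "exec (eval_prog a f (f + 2)) (layout x 0 R \<rho> rest) (time_bound a m) (layout x 0 R ?\<rho>1 rest)"
  proof -
    have "exec (eval_prog a f (f + 2)) (layout x 0 R \<rho> rest) (time_bound a m)
        (layout x 0 R (\<rho>(f := \<rho> f + ?A)) rest)"
      using Inp.prems by (intro Inp.IH) auto
    then show ?thesis using Inp.prems by (simp del: fun_upd_apply)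
  qed
  have f: "f < R" and f1: "f + 1 < R" using Inp.prems by auto
  let ?\<sigma> = "\<lambda>i. \<rho>(f := ?A - i, f + 1 := i)"
  \<comment> \<open>Register \<open>f + 1\<close> counts the moves of the input head to the right,
    so that they can be undone.\<close>
  let ?S = "\<lambda>i. layout x i R (?\<sigma> i) rest"
  have 2: "exec (While (nonzero f) (Seq (Dec f) (Seq (Inc (f + 1)) (Act 0 None Go_Right)))) (?S 0)
      (?n * ((1 + (1 + 1)) + 1) + 1) (?S ?A)"
  proof (rule exec_While_le[where S = ?S])
    fix i assume i: "i < ?A"
    let ?\<sigma>1 = "(?\<sigma> i)(f := ?\<sigma> i f - 1)"
    have eq: "?\<sigma>1(f + 1 := ?\<sigma>1 (f + 1) + 1) = ?\<sigma> (Suc i)" by (auto simp: fun_eq_iff)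
    have "exec (Dec f) (?S i) 1 (layout x i R ?\<sigma>1 rest)"
      by (rule exec_Dec[OF f])
    moreover have "exec (Inc (f + 1)) (layout x i R ?\<sigma>1 rest) 1 (layout x i R (?\<sigma> (Suc i)) rest)"
      using exec_Inc[OF f1, of x i ?\<sigma>1 rest] unfolding eq .
    moreover have "exec (Act 0 None Go_Right) (layout x i R (?\<sigma> (Suc i)) rest) 1 (?S (Suc i))"
      using exec_input_move[of Go_Right x i R "?\<sigma> (Suc i)" rest] by simp
    ultimately show "exec (Seq (Dec f) (Seq (Inc (f + 1)) (Act 0 None Go_Right))) (?S i)
        (1 + (1 + 1)) (?S (Suc i))"
      by (blast intro: exec_Seq)
  qed (use Inp.prems A in auto)
  let ?\<rho>3 = "(?\<sigma> ?A)(d := \<rho> d + ?s)"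
  have s: "?s \<le> 2" by (auto simp: input_tape_def bit_sym_def)
  have d: "d < R" and fd: "f \<noteq> d" "f + 1 \<noteq> d" using Inp.prems by auto
  have 3: "exec (Cond (\<lambda>xs. xs ! 0 = 0) Skip (Cond (\<lambda>xs. xs ! 0 = 1) (Inc d) (Seq (Inc d) (Inc d)))) (?S ?A)
      (1 + (1 + (1 + 1))) (layout x ?A R ?\<rho>3 rest)"
  proof (intro exec_Cond)
    have read: "map read_tape (?S ?A) ! 0 = ?s" by (simp add: length_layout)
    show "exec Skip (?S ?A) (1 + (1 + 1)) (layout x ?A R ?\<rho>3 rest)"
      if "map read_tape (?S ?A) ! 0 = 0"
    proof -
      have "?\<rho>3 = ?\<sigma> ?A" using that fd unfolding read by (auto simp: fun_eq_iff)
      then show ?thesis using exec_mono[OF exec_Skip[of "?S ?A"], of "1 + (1 + 1)"] by simp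
    qed
    show "exec (Inc d) (?S ?A) (1 + 1) (layout x ?A R ?\<rho>3 rest)"
      if "map read_tape (?S ?A) ! 0 = 1"
    proof -
      have "?\<rho>3 = (?\<sigma> ?A)(d := ?\<sigma> ?A d + 1)" using that fd unfolding read by (auto simp: fun_eq_iff)
      then show ?thesis using exec_mono[OF exec_Inc[OF d, of x ?A "?\<sigma> ?A" rest], of "1 + 1"] by simp
    qed
    show "exec (Seq (Inc d) (Inc d)) (?S ?A) (1 + 1) (layout x ?A R ?\<rho>3 rest)"
      if "map read_tape (?S ?A) ! 0 \<noteq> 0" "map read_tape (?S ?A) ! 0 \<noteq> 1"
    proof -
      have "?s = 2" using that s unfolding read by linarith
      then have "?\<rho>3 = (?\<sigma> ?A)(d := ?\<sigma> ?A d + 1, d := ((?\<sigma> ?A)(d := ?\<sigma> ?A d + 1)) d + 1)"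
        using fd by (auto simp: fun_eq_iff)
      then show ?thesis
        using exec_Seq[OF exec_Inc[OF d] exec_Inc[OF d], of x ?A "?\<sigma> ?A" rest] by simp
    qed
  qed
  let ?\<tau> = "\<lambda>i. \<rho>(d := \<rho> d + ?s, f + 1 := ?A - i)"
  let ?U = "\<lambda>i. layout x (?A - i) R (?\<tau> i) rest"
  have 4: "exec (While (nonzero (f + 1)) (Seq (Dec (f + 1)) (Act 0 None Go_Left))) (?U 0)
      (?n * ((1 + 1) + 1) + 1) (?U ?A)"
  proof (rule exec_While_le[where S = ?U])
    fix i assume i: "i < ?A"
    have eq: "(?\<tau> i)(f + 1 := ?\<tau> i (f + 1) - 1) = ?\<tau> (Suc i)" by (auto simp: fun_eq_iff)
    have "exec (Dec (f + 1)) (?U i) 1 (layout x (?A - i) R (?\<tau> (Suc i)) rest)"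
      using exec_Dec[OF f1, of x "?A - i" "?\<tau> i" rest] unfolding eq .
    moreover have "exec (Act 0 None Go_Left) (layout x (?A - i) R (?\<tau> (Suc i)) rest) 1 (?U (Suc i))"
      using exec_input_move[of Go_Left x "?A - i" R "?\<tau> (Suc i)" rest] by simp
    ultimately show "exec (Seq (Dec (f + 1)) (Act 0 None Go_Left)) (?U i) (1 + 1) (?U (Suc i))"
      by (blast intro: exec_Seq)
  qed (use Inp.prems A in auto)
  have e: "?\<sigma> 0 = ?\<rho>1" "?\<rho>3 = ?\<tau> 0" "\<rho>(d := \<rho> d + ?s, f + 1 := 0) = \<rho>(d := \<rho> d + eval x (Inp a) \<rho>)"
    using Inp.prems by (auto simp: fun_eq_iff)
  have "exec (eval_prog (Inp a) d f) (layout x 0 R \<rho> rest) (time_bound a m +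
      ((?n * ((1 + (1 + 1)) + 1) + 1) + ((1 + (1 + (1 + 1))) + (?n * ((1 + 1) + 1) + 1))))
      (layout x 0 R (\<rho>(d := \<rho> d + eval x (Inp a) \<rho>)) rest)"
    unfolding eval_prog.simps
    by (rule exec_Seq[OF 1 exec_Seq[OF 2[unfolded e(1)] exec_Seq[OF 3[unfolded e(2) diff_zero]
      4[unfolded diff_zero diff_self_eq_0 e(3)]]]])
  then show ?case by (rule exec_mono) simp
qed

section \<open>Printing commands\<close>

datatype cmd =
    Print exp
  | Then cmd cmd
  | If exp cmd
  | For nat exp cmd

fun out :: "bool list \<Rightarrow> cmd \<Rightarrow> (nat \<Rightarrow> nat) \<Rightarrow> bool list" where
  "out x (Print e) \<rho> = [eval x e \<rho> \<noteq> 0]"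
| "out x (Then c d) \<rho> = out x c \<rho> @ out x d \<rho>"
| "out x (If e c) \<rho> = (if eval x e \<rho> \<noteq> 0 then out x c \<rho> else [])"
| "out x (For v e c) \<rho> = concat (map (\<lambda>i. out x c (\<rho>(v := i))) [0..<eval x e \<rho>])"

fun cmd_bounded :: "nat \<Rightarrow> cmd \<Rightarrow> bool" where
  "cmd_bounded V (Print e) \<longleftrightarrow> bounded V e"
| "cmd_bounded V (Then c d) \<longleftrightarrow> cmd_bounded V c \<and> cmd_bounded V d"
| "cmd_bounded V (If e c) \<longleftrightarrow> bounded V e \<and> cmd_bounded V c"
| "cmd_bounded V (For v e c) \<longleftrightarrow> v < V \<and> bounded V e \<and> cmd_bounded V c"

lemma out_cong:
  "cmd_bounded V c \<Longrightarrow> (\<And>v. v < V \<Longrightarrow> \<rho> v = \<sigma> v) \<Longrightarrow> out x c \<rho> = out x c \<sigma>"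
proof (induction c arbitrary: \<rho> \<sigma>)
  case (Print e)
  show ?case using eval_cong[of V e \<rho> \<sigma> x] Print.prems by simp
next
  case (Then c d)
  show ?case using Then.IH(1)[of \<rho> \<sigma>] Then.IH(2)[of \<rho> \<sigma>] Then.prems by simp
next
  case (If e c)
  show ?case using If.IH[of \<rho> \<sigma>] eval_cong[of V e \<rho> \<sigma> x] If.prems by simp
next
  case (For v e c)
  have "eval x e \<rho> = eval x e \<sigma>" using eval_cong[of V e \<rho> \<sigma> x] For.prems by simp
  moreover have "out x c (\<rho>(v := i)) = out x c (\<sigma>(v := i))" for i
    using For.prems by (intro For.IH) auto
  ultimately show ?case by simp
qed

fun cmd_depth :: "cmd \<Rightarrow> nat" where
  "cmd_depth (Print e) = 1 + depth e"
| "cmd_depth (Then c d) = max (cmd_depth c) (cmd_depth d)"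
| "cmd_depth (If e c) = 1 + max (depth e) (cmd_depth c)"
| "cmd_depth (For v e c) = 2 + max (depth e) (cmd_depth c)"

fun cmd_time :: "cmd \<Rightarrow> nat \<Rightarrow> nat" where
  "cmd_time (Print e) m = time_bound e m + ((1 + ((2 * value_bound e m + 1) + 1)) + 1)"
| "cmd_time (Then c d) m = cmd_time c m + cmd_time d m"
| "cmd_time (If e c) m = time_bound e m + (1 + ((2 * value_bound e m + 1) + cmd_time c m))"
| "cmd_time (For v e c) m = time_bound e m + ((3 * m + 1) +
     ((value_bound e m * ((1 + (cmd_time c (m + value_bound e m) + 1)) + 1) + 1) +
     ((2 * value_bound e m + 1) + (3 * m + 1))))"

definition Write :: "nat \<Rightarrow> bool \<Rightarrow> prog" where
  "Write R b = Act (Suc R) (Some (bit_sym b)) Go_Right"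

text \<open>The first tape after the \<open>R\<close> registers receives the output, whose length is added to
  register \<open>k\<close>.\<close>

fun cmd_prog :: "nat \<Rightarrow> nat \<Rightarrow> cmd \<Rightarrow> nat \<Rightarrow> prog" where
  "cmd_prog R k (Print e) f = Seq (eval_prog e f (f + 1))
     (Seq (Cond (nonzero f) (Seq (Clear f) (Write R True)) (Write R False)) (Inc k))"
| "cmd_prog R k (Then c d) f = Seq (cmd_prog R k c f) (cmd_prog R k d f)"
| "cmd_prog R k (If e c) f = Seq (eval_prog e f (f + 1))
     (Cond (nonzero f) (Seq (Clear f) (cmd_prog R k c (f + 1))) Skip)"
| "cmd_prog R k (For v e c) f = Seq (eval_prog e f (f + 2)) (Seq (Move v (f + 1))
     (Seq (While (nonzero f) (Seq (Dec f) (Seq (cmd_prog R k c (f + 2)) (Inc v))))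
       (Seq (Clear v) (Move (f + 1) v))))"

definition out_tape :: "bool list \<Rightarrow> tape" where
  "out_tape w = (fst (input_tape w), length w)"

lemma exec_Write:
  "exec (Write R b) (layout x h R \<rho> (out_tape w # rest)) 1 (layout x h R \<rho> (out_tape (w @ [b]) # rest))"
proof -
  have "(fst (input_tape w))(length w := bit_sym b) = fst (input_tape (w @ [b]))"
    by (auto simp: input_tape_def fun_eq_iff nth_append less_Suc_eq)
  then show ?thesis
    using exec_rest[of 0 "out_tape w # rest" "fst (input_tape w)" "length w" R
        "Some (bit_sym b)" Go_Right x h \<rho>]
    by (simp add: Write_def out_tape_def del: fun_upd_apply)
qed

lemma exec_cmd_prog:
  assumes "cmd_bounded V c" "V \<le> k" "k < f" "f + cmd_depth c \<le> R" "\<And>r. r \<ge> f \<Longrightarrow> \<rho> r = 0"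
    and "\<And>v. v < V \<Longrightarrow> \<rho> v \<le> m"
  shows "exec (cmd_prog R k c f) (layout x 0 R \<rho> (out_tape w # rest)) (cmd_time c m)
    (layout x 0 R (\<rho>(k := \<rho> k + length (out x c \<rho>))) (out_tape (w @ out x c \<rho>) # rest))"
  using assms
proof (induction c arbitrary: f \<rho> m w)
  case (Print e)
  let ?A = "eval x e \<rho>"
  let ?rest = "out_tape w # rest" and ?rest' = "out_tape (w @ [?A \<noteq> 0]) # rest"
  let ?\<rho>1 = "\<rho>(f := ?A)"
  have A: "?A \<le> value_bound e m"
    using Print.prems eval_le[of V e \<rho> m x] by auto
  have f: "f < R" and k: "k < R" using Print.prems by auto
  have "exec (eval_prog e f (f + 1)) (layout x 0 R \<rho> ?rest) (time_bound e m)
      (layout x 0 R (\<rho>(f := \<rho> f + ?A)) ?rest)"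
    using Print.prems by (intro exec_eval_prog[of V]) auto
  then have 1: "exec (eval_prog e f (f + 1)) (layout x 0 R \<rho> ?rest) (time_bound e m)
      (layout x 0 R ?\<rho>1 ?rest)"
    using Print.prems by (simp del: fun_upd_apply)
  have 2: "exec (Cond (nonzero f) (Seq (Clear f) (Write R True)) (Write R False)) (layout x 0 R ?\<rho>1 ?rest)
      (1 + ((2 * value_bound e m + 1) + 1)) (layout x 0 R \<rho> ?rest')"
  proof (rule exec_Cond)
    assume "nonzero f (map read_tape (layout x 0 R ?\<rho>1 ?rest))"
    then have nz: "?A \<noteq> 0" using f by simp
    have e: "?\<rho>1(f := 0) = \<rho>" using Print.prems by (auto simp: fun_eq_iff)
    have "exec (Clear f) (layout x 0 R ?\<rho>1 ?rest) (2 * value_bound e m + 1) (layout x 0 R \<rho> ?rest)"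
      using exec_Clear[OF f, of ?\<rho>1 "value_bound e m" x 0 ?rest] A unfolding e by simp
    then show "exec (Seq (Clear f) (Write R True)) (layout x 0 R ?\<rho>1 ?rest)
        ((2 * value_bound e m + 1) + 1) (layout x 0 R \<rho> ?rest')"
      using exec_Write[of R True x 0 \<rho> w rest] nz by (intro exec_Seq) auto
  next
    assume "\<not> nonzero f (map read_tape (layout x 0 R ?\<rho>1 ?rest))"
    then have z: "?A = 0" using f by simp
    then have e: "?\<rho>1 = \<rho>" using Print.prems by (auto simp: fun_eq_iff)
    show "exec (Write R False) (layout x 0 R ?\<rho>1 ?rest)
        ((2 * value_bound e m + 1) + 1) (layout x 0 R \<rho> ?rest')"
      unfolding e using exec_Write[of R False x 0 \<rho> w rest] z by (auto elim: exec_mono)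
  qed
  have 3: "exec (Inc k) (layout x 0 R \<rho> ?rest') 1 (layout x 0 R (\<rho>(k := \<rho> k + 1)) ?rest')"
    by (rule exec_Inc[OF k])
  have "length (out x (Print e) \<rho>) = 1" "out x (Print e) \<rho> = [?A \<noteq> 0]" by simp_all
  then show ?case
    using exec_Seq[OF 1 exec_Seq[OF 2 3]] by (simp only: cmd_prog.simps cmd_time.simps)
next
  case (Then c d)
  let ?\<rho>1 = "\<rho>(k := \<rho> k + length (out x c \<rho>))"
  have 1: "exec (cmd_prog R k c f) (layout x 0 R \<rho> (out_tape w # rest)) (cmd_time c m)
      (layout x 0 R ?\<rho>1 (out_tape (w @ out x c \<rho>) # rest))"
    using Then.prems by (intro Then.IH(1)) auto
  have 2: "exec (cmd_prog R k d f) (layout x 0 R ?\<rho>1 (out_tape (w @ out x c \<rho>) # rest)) (cmd_time d m)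
      (layout x 0 R (?\<rho>1(k := ?\<rho>1 k + length (out x d ?\<rho>1)))
        (out_tape ((w @ out x c \<rho>) @ out x d ?\<rho>1) # rest))"
    using Then.prems by (intro Then.IH(2)) auto
  have "out x d ?\<rho>1 = out x d \<rho>"
    using Then.prems by (intro out_cong[of V]) auto
  then have "?\<rho>1(k := ?\<rho>1 k + length (out x d ?\<rho>1)) = \<rho>(k := \<rho> k + length (out x (Then c d) \<rho>))"
    "(w @ out x c \<rho>) @ out x d ?\<rho>1 = w @ out x (Then c d) \<rho>"
    by (auto simp: fun_eq_iff)
  then show ?case using exec_Seq[OF 1 2] by (simp only: cmd_prog.simps cmd_time.simps)
next
  case (If e c)
  let ?A = "eval x e \<rho>"
  let ?rest = "out_tape w # rest"
  let ?\<rho>1 = "\<rho>(f := ?A)"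
  have A: "?A \<le> value_bound e m"
    using If.prems eval_le[of V e \<rho> m x] by auto
  have f: "f < R" using If.prems by auto
  have "exec (eval_prog e f (f + 1)) (layout x 0 R \<rho> ?rest) (time_bound e m)
      (layout x 0 R (\<rho>(f := \<rho> f + ?A)) ?rest)"
    using If.prems by (intro exec_eval_prog[of V]) auto
  then have 1: "exec (eval_prog e f (f + 1)) (layout x 0 R \<rho> ?rest) (time_bound e m)
      (layout x 0 R ?\<rho>1 ?rest)"
    using If.prems by (simp del: fun_upd_apply)
  let ?end = "layout x 0 R (\<rho>(k := \<rho> k + length (out x (If e c) \<rho>))) (out_tape (w @ out x (If e c) \<rho>) # rest)"
  have 2: "exec (Cond (nonzero f) (Seq (Clear f) (cmd_prog R k c (f + 1))) Skip) (layout x 0 R ?\<rho>1 ?rest)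
      (1 + ((2 * value_bound e m + 1) + cmd_time c m)) ?end"
  proof (rule exec_Cond)
    assume "nonzero f (map read_tape (layout x 0 R ?\<rho>1 ?rest))"
    then have nz: "?A \<noteq> 0" using f by simp
    have e: "?\<rho>1(f := 0) = \<rho>" using If.prems by (auto simp: fun_eq_iff)
    have "exec (Clear f) (layout x 0 R ?\<rho>1 ?rest) (2 * value_bound e m + 1) (layout x 0 R \<rho> ?rest)"
      using exec_Clear[OF f, of ?\<rho>1 "value_bound e m" x 0 ?rest] A unfolding e by simp
    moreover have "exec (cmd_prog R k c (f + 1)) (layout x 0 R \<rho> ?rest) (cmd_time c m)
        (layout x 0 R (\<rho>(k := \<rho> k + length (out x c \<rho>))) (out_tape (w @ out x c \<rho>) # rest))"
      using If.prems by (intro If.IH) auto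
    ultimately show "exec (Seq (Clear f) (cmd_prog R k c (f + 1))) (layout x 0 R ?\<rho>1 ?rest)
        ((2 * value_bound e m + 1) + cmd_time c m) ?end"
      using nz by (simp del: fun_upd_apply) (metis exec_Seq add_Suc)
  next
    assume "\<not> nonzero f (map read_tape (layout x 0 R ?\<rho>1 ?rest))"
    then have z: "?A = 0" using f by simp
    then have "?\<rho>1 = \<rho>" "\<rho>(k := \<rho> k + length (out x (If e c) \<rho>)) = \<rho>" "w @ out x (If e c) \<rho> = w"
      using If.prems by (auto simp: fun_eq_iff)
    then show "exec Skip (layout x 0 R ?\<rho>1 ?rest) ((2 * value_bound e m + 1) + cmd_time c m) ?end"
      using exec_mono[OF exec_Skip[of "layout x 0 R \<rho> ?rest"]] by (simp only: le_add2 trans_le_add1)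
  qed
  show ?case using exec_Seq[OF 1 2] by (simp only: cmd_prog.simps cmd_time.simps)
next
  case (For v e c)
  let ?A = "eval x e \<rho>"
  let ?n = "value_bound e m"
  let ?rest = "out_tape w # rest"
  let ?\<rho>1 = "\<rho>(f := ?A)"
  have A: "?A \<le> ?n"
    using For.prems eval_le[of V e \<rho> m x] by auto
  have "exec (eval_prog e f (f + 2)) (layout x 0 R \<rho> ?rest) (time_bound e m)
      (layout x 0 R (\<rho>(f := \<rho> f + ?A)) ?rest)"
    using For.prems by (intro exec_eval_prog[of V]) auto
  then have 1: "exec (eval_prog e f (f + 2)) (layout x 0 R \<rho> ?rest) (time_bound e m)
      (layout x 0 R ?\<rho>1 ?rest)"
    using For.prems by (simp del: fun_upd_apply)
  let ?w = "\<lambda>i. concat (map (\<lambda>j. out x c (\<rho>(v := j))) [0..<i])"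
  let ?\<sigma> = "\<lambda>i. \<rho>(f + 1 := \<rho> v, f := ?A - i, v := i, k := \<rho> k + length (?w i))"
  let ?S = "\<lambda>i. layout x 0 R (?\<sigma> i) (out_tape (w @ ?w i) # rest)"
  have "?\<rho>1(v := 0, f + 1 := ?\<rho>1 (f + 1) + ?\<rho>1 v) = ?\<sigma> 0" "?rest = out_tape (w @ ?w 0) # rest"
    using For.prems by (auto simp: fun_eq_iff)
  then have 2: "exec (Move v (f + 1)) (layout x 0 R ?\<rho>1 ?rest) (3 * m + 1) (?S 0)"
    using exec_Move[of v R "f + 1" ?\<rho>1 m x 0 ?rest] For.prems by simp
  let ?T = "cmd_time c (m + ?n)"
  have 3: "exec (While (nonzero f) (Seq (Dec f) (Seq (cmd_prog R k c (f + 2)) (Inc v)))) (?S 0)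
      (?n * ((1 + (?T + 1)) + 1) + 1) (?S ?A)"
  proof (rule exec_While_le[where S = ?S])
    fix i assume i: "i < ?A"
    let ?\<sigma>1 = "(?\<sigma> i)(f := ?\<sigma> i f - 1)"
    have B: "out x c ?\<sigma>1 = out x c (\<rho>(v := i))" using For.prems by (intro out_cong[of V]) auto
    let ?\<sigma>2 = "?\<sigma>1(k := ?\<sigma>1 k + length (out x c ?\<sigma>1))"
    let ?rest2 = "out_tape ((w @ ?w i) @ out x c ?\<sigma>1) # rest"
    have "exec (cmd_prog R k c (f + 2)) (layout x 0 R ?\<sigma>1 (out_tape (w @ ?w i) # rest)) ?T
        (layout x 0 R ?\<sigma>2 ?rest2)"
      using For.prems i A by (intro For.IH) (auto simp: trans_le_add1)
    moreover have "?\<sigma>2(v := ?\<sigma>2 v + 1) = ?\<sigma> (Suc i)" "(w @ ?w i) @ out x c ?\<sigma>1 = w @ ?w (Suc i)"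
      unfolding B using For.prems by (auto simp: fun_eq_iff)
    then have "exec (Inc v) (layout x 0 R ?\<sigma>2 ?rest2) 1 (?S (Suc i))"
      using exec_Inc[of v R x 0 ?\<sigma>2 ?rest2] For.prems by simp
    moreover have "exec (Dec f) (?S i) 1 (layout x 0 R ?\<sigma>1 (out_tape (w @ ?w i) # rest))"
      using exec_Dec[of f R x 0 "?\<sigma> i" "out_tape (w @ ?w i) # rest"] For.prems by simp
    ultimately show "exec (Seq (Dec f) (Seq (cmd_prog R k c (f + 2)) (Inc v))) (?S i)
        (1 + (?T + 1)) (?S (Suc i))"
      by (blast intro: exec_Seq)
  qed (use For.prems A in auto)
  let ?rest' = "out_tape (w @ out x (For v e c) \<rho>) # rest"
  let ?\<rho>3 = "(?\<sigma> ?A)(v := 0)"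
  have 4: "exec (Clear v) (?S ?A) (2 * ?n + 1) (layout x 0 R ?\<rho>3 ?rest')"
    using exec_Clear[of v R "?\<sigma> ?A" ?n x 0 ?rest'] For.prems A by simp
  have "?\<rho>3(f + 1 := 0, v := ?\<rho>3 v + ?\<rho>3 (f + 1)) = \<rho>(k := \<rho> k + length (out x (For v e c) \<rho>))"
    using For.prems by (auto simp: fun_eq_iff)
  then have 5: "exec (Move (f + 1) v) (layout x 0 R ?\<rho>3 ?rest') (3 * m + 1)
      (layout x 0 R (\<rho>(k := \<rho> k + length (out x (For v e c) \<rho>))) ?rest')"
    using exec_Move[of "f + 1" R v ?\<rho>3 m x 0 ?rest'] For.prems by simp
  show ?case
    using exec_Seq[OF 1 exec_Seq[OF 2 exec_Seq[OF 3 exec_Seq[OF 4 5]]]]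
    by (simp only: cmd_prog.simps cmd_time.simps)
qed

section \<open>Polynomial growth\<close>

text \<open>Since the base \<open>m + 2\<close> is at least 2, larger exponents absorb constants and
  sums, and closure under composition holds even for functions that are not monotone.\<close>

definition poly_growth :: "(nat \<Rightarrow> nat) \<Rightarrow> bool" where
  "poly_growth g \<longleftrightarrow> (\<exists>k. \<forall>m. g m \<le> (m + 2) ^ k)"

lemma poly_growth_mono: "poly_growth g \<Longrightarrow> (\<And>m. f m \<le> g m) \<Longrightarrow> poly_growth f"
  unfolding poly_growth_def by (meson order_trans)

lemma poly_growth_const [simp, intro]: "poly_growth (\<lambda>m. c)"
proof -
  have "c \<le> (m + 2) ^ c" for m
    using power_mono[of 2 "m + 2" c] less_exp[of c] by simp
  then show ?thesis unfolding poly_growth_def by blast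
qed

lemma poly_growth_id [simp, intro]: "poly_growth (\<lambda>m. m)"
  unfolding poly_growth_def by (intro exI[of _ 1]) auto

lemma poly_growth_mult [intro]:
  assumes "poly_growth f" "poly_growth g"
  shows "poly_growth (\<lambda>m. f m * g m)"
proof -
  obtain a b where "\<And>m. f m \<le> (m + 2) ^ a" "\<And>m. g m \<le> (m + 2) ^ b"
    using assms unfolding poly_growth_def by blast
  then have "f m * g m \<le> (m + 2) ^ (a + b)" for m
    unfolding power_add by (rule mult_le_mono)
  then show ?thesis unfolding poly_growth_def by blast
qed

lemma poly_growth_add [intro]:
  assumes "poly_growth f" "poly_growth g"
  shows "poly_growth (\<lambda>m. f m + g m)"
proof (rule poly_growth_mono)
  \<comment> \<open>A sum is dominated by this product, which reduces addition to
    multiplication.\<close>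
  show "poly_growth (\<lambda>m. (f m + 1) * (g m + 1))"
  proof (rule poly_growth_mult)
    have "poly_growth (\<lambda>m. f m + 1)" if f: "poly_growth f" for f
    proof -
      obtain a where a: "\<And>m. f m \<le> (m + 2) ^ a"
        using f unfolding poly_growth_def by blast
      have "f m + 1 \<le> (m + 2) ^ Suc a" for m
      proof -
        have "f m + 1 \<le> (m + 2) ^ a + (m + 2) ^ a"
          using a[of m] one_le_power[of "m + 2" a] by linarith
        also have "\<dots> \<le> (m + 2) ^ Suc a" by simp
        finally show ?thesis .
      qed
      then show ?thesis unfolding poly_growth_def by blast
    qed
    then show "poly_growth (\<lambda>m. f m + 1)" "poly_growth (\<lambda>m. g m + 1)" using assms by blast+
  qed
qed simp

lemma poly_growth_compose [intro]:
  assumes "poly_growth f" "poly_growth g"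
  shows "poly_growth (\<lambda>m. f (g m))"
proof -
  obtain a where a: "\<And>m. f m \<le> (m + 2) ^ a"
    using assms unfolding poly_growth_def by blast
  have "poly_growth (\<lambda>m. g m + 2)" by (rule poly_growth_add[OF assms(2) poly_growth_const])
  then obtain b where "\<And>m. g m + 2 \<le> (m + 2) ^ b"
    unfolding poly_growth_def by blast
  then have "f (g m) \<le> (m + 2) ^ (b * a)" for m
    using a[of "g m"] power_mono[of "g m + 2" "(m + 2) ^ b" a] by (simp add: power_mult order_trans)
  then show ?thesis unfolding poly_growth_def by blast
qed

lemma poly_growth_poly: "poly_growth (poly p)" for p :: "nat poly"
  by (induction p) (auto intro!: poly_growth_add poly_growth_mult)

lemma poly_growth_le_poly:
  assumes "poly_growth g"
  obtains p :: "nat poly" where "\<And>m. g m \<le> poly p m"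
proof -
  obtain k where "\<And>m. g m \<le> (m + 2) ^ k" using assms unfolding poly_growth_def by blast
  then have "\<And>m. g m \<le> poly ([:2, 1:] ^ k) m" by (simp add: add.commute)
  then show ?thesis by (rule that)
qed

lemma poly_growth_value_bound: "poly_growth (value_bound e)"
proof (induction e)
  case (Sum v a b)
  show ?case unfolding value_bound.simps
    by (intro poly_growth_mult Sum.IH poly_growth_compose[OF Sum.IH(2)] poly_growth_add poly_growth_id)
qed (auto intro!: poly_growth_add poly_growth_mult elim: poly_growth_mono)

lemma poly_growth_time_bound: "poly_growth (time_bound e)"
proof (induction e)
  case (Sum v a b)
  show ?case unfolding time_bound.simps
    by (intro poly_growth_mult poly_growth_add Sum.IH poly_growth_value_bound poly_growth_const
      poly_growth_compose[OF Sum.IH(2)] poly_growth_id)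
qed (simp_all only: time_bound.simps,
  (intro poly_growth_add poly_growth_mult poly_growth_value_bound poly_growth_const poly_growth_id; assumption)+)

lemma poly_growth_cmd_time: "poly_growth (cmd_time c)"
proof (induction c)
  case (For v e c)
  show ?case unfolding cmd_time.simps
    by (intro poly_growth_mult poly_growth_add poly_growth_time_bound poly_growth_value_bound
      poly_growth_const poly_growth_compose[OF For.IH] poly_growth_id)
qed (simp_all only: cmd_time.simps,
  (intro poly_growth_add poly_growth_mult poly_growth_value_bound poly_growth_time_bound
    poly_growth_const poly_growth_id; assumption)+)

section \<open>Reading the answer from the labels\<close>

section \<open>Comparing the labels\<close>

lemma bits_inj: "bits a = bits b \<Longrightarrow> a = b"
proof (induction a arbitrary: b rule: bits.induct)
  case (1 a)
  show ?case
  proof (cases "a = 0")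
    case True
    then show ?thesis using 1(2) by (simp add: bits.simps split: if_splits)
  next
    case False
    then have b: "b \<noteq> 0" using 1(2)
      by (auto simp: bits.simps[of a] bits.simps[of b] split: if_splits)
    then have "odd a = odd b" "bits (a div 2) = bits (b div 2)"
      using 1(2) False by (simp_all add: bits.simps[of a] bits.simps[of b])
    then have "a div 2 = b div 2" "odd a = odd b" using 1(1)[OF False] by auto
    then show ?thesis by (metis mult_div_mod_eq odd_iff_mod_2_eq_one not_mod_2_eq_1_eq_0)
  qed
qed

lemma digits_append_eq:
  "(concat (map (\<lambda>b. [True, b]) bs) @ [False]) @ p = (concat (map (\<lambda>b. [True, b]) cs) @ [False]) @ q \<Longrightarrow>
     bs = cs \<and> p = q"
proof (induction bs arbitrary: cs)
  case Nil
  then show ?case by (cases cs) auto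
next
  case (Cons b bs)
  then show ?case by (cases cs) auto
qed

lemma enc_nat_append_eq: "enc_nat a @ p = enc_nat b @ q \<Longrightarrow> a = b \<and> p = q"
  unfolding enc_nat_def using digits_append_eq bits_inj by blast

text \<open>Both sides start with a code. By unique decoding the first label of \<open>ls\<close> is
  \<open>l\<close>, and cancelling it leaves the same equation for the tail.\<close>

lemma labels_prefix:
  assumes "enc_nat l @ concat (map enc_nat ls) = concat (map enc_nat ls) @ w"
  shows "\<forall>l'\<in>set ls. l' = l"
  using assms
proof (induction ls)
  case (Cons l' ls)
  then have "enc_nat l @ concat (map enc_nat (l' # ls)) = enc_nat l' @ (concat (map enc_nat ls) @ w)"
    by simp
  then have "l = l'" "concat (map enc_nat (l' # ls)) = concat (map enc_nat ls) @ w"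
    using enc_nat_append_eq by blast+
  then show ?case using Cons.IH by simp
qed simp

text \<open>All labels agree iff the length of the first code is a period of the string. A machine
  can thus compare the string with a shifted copy of itself and never has to decode a label.\<close>

lemma labels_equal_iff:
  assumes "y = concat (map enc_nat (l # ls))"
  shows "(\<forall>j. length (enc_nat l) + j < length y \<longrightarrow> y ! (length (enc_nat l) + j) = y ! j) \<longleftrightarrow>
    (\<forall>l'\<in>set ls. l' = l)"
proof
  let ?u = "enc_nat l" and ?z = "concat (map enc_nat ls)"
  assume shift: "\<forall>j. length ?u + j < length y \<longrightarrow> y ! (length ?u + j) = y ! j"
  have "take (length ?z) y = ?z"
  proof (rule nth_equalityI)
    show "length (take (length ?z) y) = length ?z" using assms by simp
    fix j assume "j < length (take (length ?z) y)"
    then have "j < length ?z" by simp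
    then show "take (length ?z) y ! j = ?z ! j"
      using shift[rule_format, of j] assms by (simp add: nth_append)
  qed
  then have "y = ?z @ drop (length ?z) y" by (metis append_take_drop_id)
  then show "\<forall>l'\<in>set ls. l' = l" using labels_prefix[of l ls "drop (length ?z) y"] assms by simp
next
  assume eq: "\<forall>l'\<in>set ls. l' = l"
  let ?u = "enc_nat l" and ?z = "concat (map enc_nat ls)"
  have "?u @ ?z = ?z @ ?u" using eq by (induction ls) auto
  then have y: "y = ?z @ ?u" "y = ?u @ ?z" using assms by auto
  show "\<forall>j. length ?u + j < length y \<longrightarrow> y ! (length ?u + j) = y ! j"
  proof (intro allI impI)
    fix j assume "length ?u + j < length y"
    then have j: "j < length ?z" using y by simp
    have "y ! (length ?u + j) = ?z ! j" by (subst y(2)) simp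
    also have "\<dots> = y ! j" using j by (subst y(1)) (simp add: nth_append)
    finally show "y ! (length ?u + j) = y ! j" .
  qed
qed

lemma digits_nth:
  "i < length bs \<Longrightarrow> (concat (map (\<lambda>b. [True, b]) bs) @ False # p) ! (2 * i)"
proof (induction bs arbitrary: i)
  case (Cons b bs)
  then show ?case by (cases i) auto
qed simp

lemma length_digits: "length (concat (map (\<lambda>b. [True, b]) bs)) = 2 * length bs"
  by (induction bs) auto

lemma length_enc_nat: "length (enc_nat l) = 2 * length (bits l) + 1"
  by (simp add: enc_nat_def length_digits)

text \<open>Even positions hold the continuation bits, so the first \<open>False\<close> among them
  ends the first code.\<close>

lemma enc_nat_scan:
  "i < length (bits l) \<Longrightarrow> (enc_nat l @ p) ! (2 * i)" "\<not> (enc_nat l @ p) ! (2 * length (bits l))"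
  using digits_nth[of i "bits l" p] by (simp_all add: enc_nat_def nth_append length_digits)

section \<open>Invariants of runs\<close>

definition wf_config :: "tm \<Rightarrow> config \<Rightarrow> bool" where
  "wf_config M c \<longleftrightarrow> fst c < tm_states M \<and> length (snd c) = tm_tapes M \<and>
     (\<forall>(t, h)\<in>set (snd c). \<forall>i. t i < tm_syms M)"

lemma wf_config_reads:
  assumes "wf_config M c"
  shows "length (map read_tape (snd c)) = tm_tapes M" "set (map read_tape (snd c)) \<subseteq> {..<tm_syms M}"
  using assms by (auto simp: wf_config_def)

lemma wf_config_init: "wf_tm M \<Longrightarrow> wf_config M (init M x)"
  by (auto simp: wf_config_def wf_tm_def init_def input_tape_def bit_sym_def)

lemma wf_tm_action:
  assumes "wf_tm M" "q < tm_states M" "length xs = tm_tapes M" "set xs \<subseteq> {..<tm_syms M}"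
    and "(q', as) \<in> tm_delta M q xs"
  shows "q' < tm_states M" "length as = tm_tapes M" "fst ` set as \<subseteq> {..<tm_syms M}"
proof -
  have "\<forall>(q', as) \<in> tm_delta M q xs.
      q' < tm_states M \<and> length as = tm_tapes M \<and> fst ` set as \<subseteq> {..<tm_syms M}"
    using assms(1-4) unfolding wf_tm_def by blast
  then show "q' < tm_states M" "length as = tm_tapes M" "fst ` set as \<subseteq> {..<tm_syms M}"
    using assms(5) by blast+
qed

lemma wf_config_action:
  assumes "wf_tm M" "wf_config M c" "(q', as) \<in> tm_delta M (fst c) (map read_tape (snd c))"
  shows "q' < tm_states M" "length as = tm_tapes M" "fst ` set as \<subseteq> {..<tm_syms M}"
  using wf_tm_action[OF assms(1) _ wf_config_reads[OF assms(2)] assms(3)] assms(2)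
  by (simp_all add: wf_config_def)

lemma wf_config_step:
  assumes "wf_tm M" "wf_config M c" "step M c c'"
  shows "wf_config M c'"
proof -
  obtain q' as where a: "(q', as) \<in> tm_delta M (fst c) (map read_tape (snd c))"
    and c': "c' = (q', map2 act as (snd c))"
    using assms(3) unfolding step_def by blast
  note w = wf_config_action[OF assms(1,2) a]
  have len: "length (snd c) = tm_tapes M" using assms(2) by (simp add: wf_config_def)
  have "t i < tm_syms M" if th: "(t, h) \<in> set (map2 act as (snd c))" for t h i
  proof -
    obtain s m u k where su: "((s, m), (u, k)) \<in> set (zip as (snd c))" "(t, h) = act (s, m) (u, k)"
      using th by auto
    then have "(s, m) \<in> set as" "(u, k) \<in> set (snd c)" by (auto dest: set_zip_leftD set_zip_rightD)
    then have "s < tm_syms M" "u i < tm_syms M" using w(3) assms(2) by (force simp: wf_config_def)+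
    then show ?thesis using su(2) by simp
  qed
  then have "\<forall>(t, h)\<in>set (map2 act as (snd c)). \<forall>i. t i < tm_syms M" by blast
  then show ?thesis using w(1,2) len by (simp add: wf_config_def c')
qed

lemma wf_config_steps:
  assumes "wf_tm M" "wf_config M c" "(step M ^^ t) c c'"
  shows "wf_config M c'"
  using assms(3) by (induction t arbitrary: c') (auto intro: assms(2) wf_config_step[OF assms(1)])

lemma support_step:
  assumes "step M c c'" "\<And>t h. (t, h) \<in> set (snd c) \<Longrightarrow> h \<le> s \<and> (\<forall>i\<ge>l + s. t i = 0)"
    and "(t, h) \<in> set (snd c')"
  shows "h \<le> Suc s \<and> (\<forall>i\<ge>l + Suc s. t i = 0)"
proof -
  obtain q' as where c': "c' = (q', map2 act as (snd c))"
    using assms(1) unfolding step_def by blast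
  then obtain b m u k where su: "((b, m), (u, k)) \<in> set (zip as (snd c))" "(t, h) = act (b, m) (u, k)"
    using assms(3) by auto
  then have "(u, k) \<in> set (snd c)" by (auto dest: set_zip_rightD)
  then have "k \<le> s" "\<forall>i\<ge>l + s. u i = 0" using assms(2) by auto
  then show ?thesis using su(2) by (cases m) auto
qed

text \<open>A step moves each head by at most one cell and writes only under it. This bounds the
  output length and the distance of a rewind by the running time.\<close>

lemma support_steps:
  assumes "(step M ^^ s) (init M x) c" "(t, h) \<in> set (snd c)"
  shows "h \<le> s \<and> (\<forall>i\<ge>length x + s. t i = 0)"
  using assms
proof (induction s arbitrary: c t h)
  case 0
  then show ?case by (auto simp: init_def input_tape_def)
next
  case (Suc s)
  then obtain d where d: "(step M ^^ s) (init M x) d" "step M d c" by auto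
  show ?case
    by (rule support_step[OF d(2) Suc.IH[OF d(1)] Suc.prems(2)])
qed

section \<open>One machine: generator, approximation algorithm and comparison\<close>

section \<open>The deciding program\<close>

abbreviation blank :: tape where
  "blank \<equiv> input_tape []"

lemma out_tape_Nil: "out_tape [] = blank"
  by (simp add: out_tape_def input_tape_def)

fun mark_prog :: "nat \<Rightarrow> prog" where
  "mark_prog 0 = Skip"
| "mark_prog (Suc r) = Seq (mark_prog r) (Act (Suc r) (Some 1) Stay)"

lemma exec_mark_prog:
  assumes "r \<le> R"
  shows "exec (mark_prog r) (input_tape x # replicate R blank @ rest) (r + 1)
    (input_tape x # map (\<lambda>r. (\<lambda>i. if i = 0 then 1 else 0, 0)) [0..<r] @ replicate (R - r) blank @ rest)"
  using assms
proof (induction r)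
  case 0
  then show ?case using exec_Skip by simp
next
  case (Suc r)
  let ?m = "\<lambda>r. (\<lambda>i. if i = 0 then 1 else 0, 0) :: tape"
  let ?ts = "input_tape x # map ?m [0..<r] @ replicate (R - r) blank @ rest"
  have rep: "replicate (R - r) blank = blank # replicate (R - Suc r) blank"
    using Suc.prems by (metis Suc_diff_Suc Suc_le_lessD replicate_Suc)
  have nth: "?ts ! Suc r = blank" using rep by (simp add: nth_append)
  have upd: "?ts[Suc r := act (1, Stay) blank] =
      input_tape x # map ?m [0..<Suc r] @ replicate (R - Suc r) blank @ rest"
    unfolding rep by (simp add: list_update_append input_tape_def fun_eq_iff)
  have "exec (Act (Suc r) (Some 1) Stay) ?ts 1 (?ts[Suc r := act (1, Stay) blank])"
    using exec_Act[of "Suc r" ?ts "Some 1" Stay] nth Suc.prems by simp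
  then have "exec (mark_prog (Suc r)) (input_tape x # replicate R blank @ rest) ((r + 1) + 1)
      (input_tape x # map ?m [0..<Suc r] @ replicate (R - Suc r) blank @ rest)"
    unfolding upd mark_prog.simps using Suc.IH Suc.prems by (intro exec_Seq) auto
  then show ?case by (rule exec_mono) simp
qed

text \<open>Register 0 receives the input length, which expressions see as variable 0;
  \<open>f\<close> remembers how far to go back.\<close>

definition load_prog :: "nat \<Rightarrow> prog" where
  "load_prog f = Seq (While (\<lambda>xs. xs ! 0 \<noteq> 0) (Seq (Act 0 None Go_Right) (Seq (Inc 0) (Inc f))))
     (While (nonzero f) (Seq (Dec f) (Act 0 None Go_Left)))"

definition input_env :: "bool list \<Rightarrow> nat \<Rightarrow> nat" where
  "input_env x = (\<lambda>v. 0)(0 := length x)"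

lemma exec_load_prog:
  assumes "0 < f" "f < R"
  shows "exec (load_prog f) (layout x 0 R (\<lambda>v. 0) rest) ((length x * 4 + 1) + (length x * 3 + 1))
    (layout x 0 R (input_env x) rest)"
proof -
  let ?n = "length x"
  let ?\<sigma> = "\<lambda>i. (\<lambda>v. 0)(0 := i, f := i)"
  let ?S = "\<lambda>i. layout x i R (?\<sigma> i) rest"
  have 1: "exec (While (\<lambda>xs. xs ! 0 \<noteq> 0) (Seq (Act 0 None Go_Right) (Seq (Inc 0) (Inc f)))) (?S 0)
      (?n * ((1 + (1 + 1)) + 1) + 1) (?S ?n)"
  proof (rule exec_While_le[where S = ?S])
    fix i assume i: "i < ?n"
    show "map read_tape (?S i) ! 0 \<noteq> 0"
      using i by (simp add: length_layout input_tape_def bit_sym_def)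
    let ?\<sigma>1 = "(?\<sigma> i)(0 := ?\<sigma> i 0 + 1)"
    have eq: "?\<sigma>1(f := ?\<sigma>1 f + 1) = ?\<sigma> (Suc i)" using assms by (auto simp: fun_eq_iff)
    have "exec (Act 0 None Go_Right) (?S i) 1 (layout x (Suc i) R (?\<sigma> i) rest)"
      using exec_input_move[of Go_Right x i R "?\<sigma> i" rest] by simp
    moreover have "exec (Inc 0) (layout x (Suc i) R (?\<sigma> i) rest) 1 (layout x (Suc i) R ?\<sigma>1 rest)"
      using assms by (intro exec_Inc) simp
    moreover have "exec (Inc f) (layout x (Suc i) R ?\<sigma>1 rest) 1 (?S (Suc i))"
      using exec_Inc[OF assms(2), of x "Suc i" ?\<sigma>1 rest] unfolding eq .
    ultimately show "exec (Seq (Act 0 None Go_Right) (Seq (Inc 0) (Inc f))) (?S i)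
        (1 + (1 + 1)) (?S (Suc i))"
      by (blast intro: exec_Seq)
  next
    show "\<not> map read_tape (?S ?n) ! 0 \<noteq> 0" by (simp add: length_layout input_tape_def)
  qed simp
  let ?\<tau> = "\<lambda>i. (\<lambda>v. 0)(0 := ?n, f := ?n - i)"
  let ?U = "\<lambda>i. layout x (?n - i) R (?\<tau> i) rest"
  have 2: "exec (While (nonzero f) (Seq (Dec f) (Act 0 None Go_Left))) (?U 0)
      (?n * ((1 + 1) + 1) + 1) (?U ?n)"
  proof (rule exec_While_le[where S = ?U])
    fix i assume i: "i < ?n"
    have eq: "(?\<tau> i)(f := ?\<tau> i f - 1) = ?\<tau> (Suc i)" by (auto simp: fun_eq_iff)
    have "exec (Dec f) (?U i) 1 (layout x (?n - i) R (?\<tau> (Suc i)) rest)"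
      using exec_Dec[OF assms(2), of x "?n - i" "?\<tau> i" rest] unfolding eq .
    moreover have "exec (Act 0 None Go_Left) (layout x (?n - i) R (?\<tau> (Suc i)) rest) 1 (?U (Suc i))"
      using exec_input_move[of Go_Left x "?n - i" R "?\<tau> (Suc i)" rest] by simp
    ultimately show "exec (Seq (Dec f) (Act 0 None Go_Left)) (?U i) (1 + 1) (?U (Suc i))"
      by (blast intro: exec_Seq)
  qed (use assms in auto)
  have e: "?\<sigma> 0 = (\<lambda>v. 0)" "(\<lambda>v. 0)(0 := ?n, f := 0) = input_env x"
    using assms by (auto simp: fun_eq_iff input_env_def)
  have "exec (load_prog f) (layout x 0 R (\<lambda>v. 0) rest)
      ((?n * ((1 + (1 + 1)) + 1) + 1) + (?n * ((1 + 1) + 1) + 1)) (layout x 0 R (input_env x) rest)"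
    unfolding load_prog_def
    using exec_Seq[OF 1[unfolded e] 2[unfolded diff_zero e diff_self_eq_0]] .
  then show ?thesis by (rule exec_mono) simp
qed

text \<open>A tape that is not a register has no mark in cell 0. Its head goes back by a counter
  that is at least its position; surplus left moves stay on cell 0.\<close>

definition rewind_prog :: "nat \<Rightarrow> nat \<Rightarrow> prog" where
  "rewind_prog k j = While (nonzero k) (Seq (Dec k) (Act (Suc j) None Go_Left))"

lemma exec_rewind_prog:
  assumes "k < R" "i < length rest" "rest ! i = (t, h)" "h \<le> \<rho> k" "\<rho> k \<le> m"
  shows "exec (rewind_prog k (R + i)) (layout x 0 R \<rho> rest) (m * 3 + 1)
    (layout x 0 R (\<rho>(k := 0)) (rest[i := (t, 0)]))"
proof -
  let ?\<sigma> = "\<lambda>n. \<rho>(k := \<rho> k - n)"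
  let ?r = "\<lambda>n. rest[i := (t, h - n)]"
  let ?S = "\<lambda>n. layout x 0 R (?\<sigma> n) (?r n)"
  have 1: "exec (rewind_prog k (R + i)) (?S 0) (m * ((1 + 1) + 1) + 1) (?S (\<rho> k))"
    unfolding rewind_prog_def
  proof (rule exec_While_le[where S = ?S])
    fix n assume n: "n < \<rho> k"
    have eq: "(?\<sigma> n)(k := ?\<sigma> n k - 1) = ?\<sigma> (Suc n)" by (auto simp: fun_eq_iff)
    have "exec (Dec k) (?S n) 1 (layout x 0 R (?\<sigma> (Suc n)) (?r n))"
      using exec_Dec[OF assms(1), of x 0 "?\<sigma> n" "?r n"] unfolding eq .
    moreover have "exec (Act (Suc (R + i)) None Go_Left) (layout x 0 R (?\<sigma> (Suc n)) (?r n)) 1 (?S (Suc n))"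
      using exec_rest[of i "?r n" t "h - n" R None Go_Left x 0 "?\<sigma> (Suc n)"] assms(2) by simp
    ultimately show "exec (Seq (Dec k) (Act (Suc (R + i)) None Go_Left)) (?S n) (1 + 1) (?S (Suc n))"
      by (rule exec_Seq)
  qed (use assms in auto)
  have "?\<sigma> 0 = \<rho>" "?r 0 = rest" "?\<sigma> (\<rho> k) = \<rho>(k := 0)" "?r (\<rho> k) = rest[i := (t, 0)]"
    using assms list_update_id[of rest i] by auto
  with 1 have "exec (rewind_prog k (R + i)) (layout x 0 R \<rho> rest) (m * ((1 + 1) + 1) + 1)
      (layout x 0 R (\<rho>(k := 0)) (rest[i := (t, 0)]))"
    by (simp only:)
  then show ?thesis by (rule exec_mono) simp
qed

text \<open>Register \<open>k\<close> counts the simulated steps; as heads move by at most one cell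
  per step, this count later suffices for \<open>rewind_prog\<close>. For a deterministic machine,
  \<open>SOME\<close> returns the only action.\<close>

definition simulated_delta :: "tm \<Rightarrow> nat \<Rightarrow> nat \<Rightarrow> nat \<Rightarrow> nat list \<Rightarrow> action option" where
  "simulated_delta M R k q xs =
     (let D = tm_delta M q (take (tm_tapes M) (drop (Suc R) xs)) in
      if D = {} then None
      else let (q', as) = SOME a. a \<in> D in
        Some (q', (stay (take (Suc R) xs))[Suc k := (xs ! Suc k, Go_Right)] @ as @
          stay (drop (Suc R + tm_tapes M) xs)))"

definition simulate_prog :: "tm \<Rightarrow> nat \<Rightarrow> nat \<Rightarrow> prog" where
  "simulate_prog M R k = Run (tm_states M) (simulated_delta M R k)"

lemma layout_append: "layout x h R \<rho> (ts @ us) = layout x h R \<rho> [] @ ts @ us"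
  by (simp add: layout_def)

lemma simulated_delta_layout:
  assumes "length ts = tm_tapes M"
  shows "simulated_delta M R k q (map read_tape (layout x 0 R \<rho> (ts @ us))) =
     (let D = tm_delta M q (map read_tape ts) in
      if D = {} then None
      else let (q', as) = SOME a. a \<in> D in
        Some (q', (stay (map read_tape (layout x 0 R \<rho> [])))[Suc k :=
            (map read_tape (layout x 0 R \<rho> (ts @ us)) ! Suc k, Go_Right)] @ as @
          stay (map read_tape us)))"
proof -
  have l: "length (layout x 0 R \<rho> []) = Suc R" by (simp add: length_layout)
  show ?thesis
    unfolding simulated_delta_def layout_append[of x 0 R \<rho> ts us] using assms l
    by (simp add: Let_def)
qed

lemma map2_act_Go_Right:
  assumes "k < R"
  shows "map2 act ((stay (map read_tape (layout x 0 R \<rho> [])))[Suc k :=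
      (map read_tape (layout x 0 R \<rho> (ts @ us)) ! Suc k, Go_Right)]) (layout x 0 R \<rho> []) =
    layout x 0 R (\<rho>(k := \<rho> k + 1)) []"
proof (rule nth_equalityI)
  fix i
  assume i: "i < length (map2 act ((stay (map read_tape (layout x 0 R \<rho> [])))[Suc k :=
      (map read_tape (layout x 0 R \<rho> (ts @ us)) ! Suc k, Go_Right)]) (layout x 0 R \<rho> []))"
  then have "i < Suc R" by (simp add: length_layout stay_def)
  then show "map2 act ((stay (map read_tape (layout x 0 R \<rho> [])))[Suc k :=
      (map read_tape (layout x 0 R \<rho> (ts @ us)) ! Suc k, Go_Right)]) (layout x 0 R \<rho> []) ! i =
    layout x 0 R (\<rho>(k := \<rho> k + 1)) [] ! i"
    using assms by (cases i) (auto simp: length_layout stay_def nth_list_update fun_eq_iff)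
qed (simp add: length_layout stay_def)

lemma exec_simulate_prog:
  assumes M: "wf_tm M" and t: "(step M ^^ t) (init M y) c" "halted M c" and k: "k < R" and \<rho>: "\<rho> k = 0"
    and det: "deterministic M"
  shows "exec (simulate_prog M R k) (layout x 0 R \<rho> (snd (init M y) @ us)) (t + 1)
    (layout x 0 R (\<rho>(k := t)) (snd c @ us))"
proof -
  let ?d = "simulated_delta M R k"
  let ?R = "\<lambda>c c'. fst c < tm_states M \<and> (\<exists>q' as. ?d (fst c) (map read_tape (snd c)) = Some (q', as) \<and>
      c' = (q', map2 act as (snd c)))"
  have "(?R ^^ s) (0, layout x 0 R \<rho> (snd (init M y) @ us))
      (fst c, layout x 0 R (\<rho>(k := s)) (snd c @ us))" if "(step M ^^ s) (init M y) c" for s c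
    using that
  proof (induction s arbitrary: c)
    case 0
    have "\<rho>(k := 0) = \<rho>" using \<rho> by (auto simp: fun_eq_iff)
    then show ?case using 0 by (auto simp: init_def)
  next
    case (Suc s)
    then obtain b where b: "(step M ^^ s) (init M y) b" "step M b c" by auto
    have w: "wf_config M b" using wf_config_steps[OF M wf_config_init[OF M] b(1)] .
    have len: "length (snd b) = tm_tapes M" and q: "fst b < tm_states M"
      using w by (auto simp: wf_config_def)
    obtain q' as where a: "(q', as) \<in> tm_delta M (fst b) (map read_tape (snd b))"
      and c: "c = (q', map2 act as (snd b))"
      using b(2) unfolding step_def by blast
    have "(SOME a. a \<in> tm_delta M (fst b) (map read_tape (snd b))) = (q', as)"
      using a det unfolding deterministic_def by (intro some_equality) auto
    then have d: "?d (fst b) (map read_tape (layout x 0 R (\<rho>(k := s)) (snd b @ us))) =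
        Some (q', (stay (map read_tape (layout x 0 R (\<rho>(k := s)) [])))[Suc k :=
            (map read_tape (layout x 0 R (\<rho>(k := s)) (snd b @ us)) ! Suc k, Go_Right)] @ as @
          stay (map read_tape us))"
      using a unfolding simulated_delta_layout[OF len] by (auto simp: Let_def)
    have la: "length as = length (snd b)" using wf_config_action[OF M w a] len by simp
    define X where "X = (stay (map read_tape (layout x 0 R (\<rho>(k := s)) [])))[Suc k :=
            (map read_tape (layout x 0 R (\<rho>(k := s)) (snd b @ us)) ! Suc k, Go_Right)]"
    have X: "length X = length (layout x 0 R (\<rho>(k := s)) [])"
      by (simp add: X_def stay_def)
    have "(\<rho>(k := s))(k := (\<rho>(k := s)) k + 1) = \<rho>(k := Suc s)" by simp
    then have "map2 act X (layout x 0 R (\<rho>(k := s)) []) = layout x 0 R (\<rho>(k := Suc s)) []"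
      using map2_act_Go_Right[OF k, of x "\<rho>(k := s)" "snd b" us] unfolding X_def by (simp only:)
    then have "map2 act (X @ as @ stay (map read_tape us)) (layout x 0 R (\<rho>(k := s)) (snd b @ us)) =
        layout x 0 R (\<rho>(k := Suc s)) (snd c @ us)"
      unfolding layout_append[of x 0 R "\<rho>(k := s)" "snd b" us]
        layout_append[of x 0 R "\<rho>(k := Suc s)" "snd c" us]
      using X la by (simp add: c)
    then have "?R (fst b, layout x 0 R (\<rho>(k := s)) (snd b @ us)) (fst c, layout x 0 R (\<rho>(k := Suc s)) (snd c @ us))"
      using q d c by (auto simp: X_def)
    with Suc.IH[OF b(1)] show ?case by (rule relpowp_Suc_I)
  qed
  from this[OF t(1)]
  have run: "(?R ^^ t) (0, layout x 0 R \<rho> (snd (init M y) @ us)) (fst c, layout x 0 R (\<rho>(k := t)) (snd c @ us))" .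
  have w: "wf_config M c" using wf_config_steps[OF M wf_config_init[OF M] t(1)] .
  then have q: "fst c < tm_states M" and len: "length (snd c) = tm_tapes M" by (auto simp: wf_config_def)
  have "tm_delta M (fst c) (map read_tape (snd c)) = {}"
    using t(2) unfolding halted_def step_def by fast
  then have "?d (fst c) (map read_tape (layout x 0 R (\<rho>(k := t)) (snd c @ us))) = None"
    by (simp add: simulated_delta_layout[OF len])
  from exec_Run[OF run q this] show ?thesis by (simp add: simulate_prog_def)
qed

definition copy_prog :: "nat \<Rightarrow> nat \<Rightarrow> nat \<Rightarrow> prog" where
  "copy_prog k j j' = While (\<lambda>xs. xs ! Suc j \<noteq> 0)
     (Seq (Cond (\<lambda>xs. xs ! Suc j = 1) (Act (Suc j') (Some 1) Go_Right) (Act (Suc j') (Some 2) Go_Right))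
       (Seq (Act (Suc j) None Go_Right) (Inc k)))"

definition rewind2_prog :: "nat \<Rightarrow> nat \<Rightarrow> nat \<Rightarrow> prog" where
  "rewind2_prog k j j' = While (nonzero k)
     (Seq (Dec k) (Seq (Act (Suc j) None Go_Left) (Act (Suc j') None Go_Left)))"

text \<open>Symbol 2 is a continuation bit \<open>True\<close>, followed by one digit; the last move
  passes the closing \<open>False\<close>.\<close>

definition skip_prog :: "nat \<Rightarrow> prog" where
  "skip_prog j = Seq (While (\<lambda>xs. xs ! Suc j = 2) (Seq (Act (Suc j) None Go_Right) (Act (Suc j) None Go_Right)))
     (Act (Suc j) None Go_Right)"

definition mismatch_prog :: "nat \<Rightarrow> nat \<Rightarrow> nat \<Rightarrow> prog" where
  "mismatch_prog f j j' = While (\<lambda>xs. xs ! Suc j \<noteq> 0)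
     (Seq (Cond (\<lambda>xs. xs ! Suc j \<noteq> xs ! Suc j') (Inc f) Skip)
       (Seq (Act (Suc j) None Go_Right) (Act (Suc j') None Go_Right)))"

text \<open>Tests the periodicity of \<open>labels_equal_iff\<close>: one head starts behind the
  first code, the other at the beginning of a copy, and \<open>f\<close> counts the
  mismatches.\<close>

definition compare_prog :: "nat \<Rightarrow> nat \<Rightarrow> nat \<Rightarrow> nat \<Rightarrow> prog" where
  "compare_prog k f j j' = Seq (copy_prog k j j') (Seq (rewind2_prog k j j')
     (Seq (skip_prog j) (mismatch_prog f j j')))"

text \<open>The output tape \<open>g\<close> is known only up to the blank that ends the output, so
  no loop may look beyond it.\<close>

locale label_tapes =
  fixes R i i' :: nat and rest :: "tape list" and g :: "nat \<Rightarrow> nat" and y :: "bool list"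
    and l :: nat and ls :: "nat list" and x :: "bool list"
  assumes i: "i < length rest" and i': "i' < length rest" and ii': "i \<noteq> i'"
    and g: "\<And>n. n < length y \<Longrightarrow> g n = bit_sym (y ! n)" and g_end: "g (length y) = 0"
    and y: "y = concat (map enc_nat (l # ls))"
begin

definition tapes :: "(nat \<Rightarrow> nat) \<Rightarrow> nat \<Rightarrow> bool list \<Rightarrow> nat \<Rightarrow> tape list" where
  "tapes \<rho> h w h' = layout x 0 R \<rho> (rest[i := (g, h), i' := (fst (input_tape w), h')])"

lemma move1: "exec (Act (Suc (R + i)) None d) (tapes \<rho> h w h') 1 (tapes \<rho> (move_head d h) w h')"
  using exec_rest[of i "rest[i := (g, h), i' := (fst (input_tape w), h')]" g h R None d x 0 \<rho>] i i' ii'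
  by (simp add: tapes_def list_update_swap[of i i'])

lemma move2: "exec (Act (Suc (R + i')) None d) (tapes \<rho> h w h') 1 (tapes \<rho> h w (move_head d h'))"
  using exec_rest[of i' "rest[i := (g, h), i' := (fst (input_tape w), h')]" "fst (input_tape w)" h' R None d x 0 \<rho>]
    i i' ii'
  by (simp add: tapes_def)

lemma write2:
  "exec (Act (Suc (R + i')) (Some (bit_sym b)) Go_Right) (tapes \<rho> h w (length w)) 1
    (tapes \<rho> h (w @ [b]) (Suc (length w)))"
proof -
  have "(fst (input_tape w))(length w := bit_sym b) = fst (input_tape (w @ [b]))"
    by (auto simp: input_tape_def fun_eq_iff nth_append less_Suc_eq)
  then show ?thesis
    using exec_rest[of i' "rest[i := (g, h), i' := (fst (input_tape w), length w)]" "fst (input_tape w)"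
        "length w" R "Some (bit_sym b)" Go_Right x 0 \<rho>] i i' ii'
    by (simp add: tapes_def del: fun_upd_apply)
qed

lemma inc: "r < R \<Longrightarrow> exec (Inc r) (tapes \<rho> h w h') 1 (tapes (\<rho>(r := \<rho> r + 1)) h w h')"
  unfolding tapes_def by (rule exec_Inc)

lemma dec: "r < R \<Longrightarrow> exec (Dec r) (tapes \<rho> h w h') 1 (tapes (\<rho>(r := \<rho> r - 1)) h w h')"
  unfolding tapes_def by (rule exec_Dec)

lemma read1: "map read_tape (tapes \<rho> h w h') ! Suc (R + i) = g h"
  using i i' ii' by (simp add: tapes_def length_layout)

lemma read2: "map read_tape (tapes \<rho> h w h') ! Suc (R + i') = fst (input_tape w) h'"
  using i i' ii' by (simp add: tapes_def length_layout)

lemma nonzero_tapes: "r < R \<Longrightarrow> nonzero r (map read_tape (tapes \<rho> h w h')) \<longleftrightarrow> \<rho> r \<noteq> 0"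
  unfolding tapes_def by (rule nonzero_layout)

lemma exec_copy:
  assumes k: "k < R" and \<rho>: "\<rho> k = 0"
  shows "exec (copy_prog k (R + i) (R + i')) (tapes \<rho> 0 [] 0) (length y * (((1 + 1) + (1 + 1)) + 1) + 1)
    (tapes (\<rho>(k := length y)) (length y) y (length y))"
proof -
  let ?S = "\<lambda>n. tapes (\<rho>(k := n)) n (take n y) n"
  have "exec (copy_prog k (R + i) (R + i')) (?S 0) (length y * (((1 + 1) + (1 + 1)) + 1) + 1) (?S (length y))"
    unfolding copy_prog_def
  proof (rule exec_While_le[where S = ?S])
    fix n assume n: "n < length y"
    show "map read_tape (?S n) ! Suc (R + i) \<noteq> 0"
      unfolding read1 using g[OF n] by (simp add: bit_sym_def)
    let ?b = "y ! n"
    have len: "length (take n y) = n" and w: "take n y @ [?b] = take (Suc n) y"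
      using n by (simp_all add: take_Suc_conv_app_nth)
    have "exec (Act (Suc (R + i')) (Some (bit_sym ?b)) Go_Right) (?S n) 1
        (tapes (\<rho>(k := n)) n (take (Suc n) y) (Suc n))"
      using write2[of ?b "\<rho>(k := n)" n "take n y"] unfolding w len .
    then have "exec (Cond (\<lambda>xs. xs ! Suc (R + i) = 1) (Act (Suc (R + i')) (Some 1) Go_Right)
        (Act (Suc (R + i')) (Some 2) Go_Right)) (?S n) (1 + 1) (tapes (\<rho>(k := n)) n (take (Suc n) y) (Suc n))"
      using g[OF n] by (intro exec_Cond) (simp_all only: read1, cases ?b, simp_all add: bit_sym_def split: if_splits)
    moreover have "exec (Act (Suc (R + i)) None Go_Right) (tapes (\<rho>(k := n)) n (take (Suc n) y) (Suc n)) 1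
        (tapes (\<rho>(k := n)) (Suc n) (take (Suc n) y) (Suc n))"
      using move1[of Go_Right "\<rho>(k := n)" n] by simp
    moreover have "exec (Inc k) (tapes (\<rho>(k := n)) (Suc n) (take (Suc n) y) (Suc n)) 1 (?S (Suc n))"
      using inc[OF k, of "\<rho>(k := n)"] by simp
    ultimately show "exec (Seq (Cond (\<lambda>xs. xs ! Suc (R + i) = 1) (Act (Suc (R + i')) (Some 1) Go_Right)
        (Act (Suc (R + i')) (Some 2) Go_Right)) (Seq (Act (Suc (R + i)) None Go_Right) (Inc k)))
        (?S n) ((1 + 1) + (1 + 1)) (?S (Suc n))"
      by (blast intro: exec_Seq)
  next
    show "\<not> map read_tape (?S (length y)) ! Suc (R + i) \<noteq> 0" unfolding read1 by (simp add: g_end)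
  qed simp
  moreover have "\<rho>(k := 0) = \<rho>" using \<rho> by (auto simp: fun_eq_iff)
  ultimately show ?thesis by (simp only: take_0 take_all order_refl)
qed

lemma exec_rewind2:
  assumes k: "k < R"
  shows "exec (rewind2_prog k (R + i) (R + i')) (tapes (\<rho>(k := n)) n w n)
    (n * ((1 + (1 + 1)) + 1) + 1) (tapes (\<rho>(k := 0)) 0 w 0)"
proof -
  let ?S = "\<lambda>m. tapes (\<rho>(k := n - m)) (n - m) w (n - m)"
  have "exec (rewind2_prog k (R + i) (R + i')) (?S 0) (n * ((1 + (1 + 1)) + 1) + 1) (?S n)"
    unfolding rewind2_prog_def
  proof (rule exec_While_le[where S = ?S])
    fix m assume m: "m < n"
    have "exec (Dec k) (?S m) 1 (tapes (\<rho>(k := n - Suc m)) (n - m) w (n - m))"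
      using dec[OF k, of "\<rho>(k := n - m)"] by simp
    moreover have "exec (Act (Suc (R + i)) None Go_Left) (tapes (\<rho>(k := n - Suc m)) (n - m) w (n - m)) 1
        (tapes (\<rho>(k := n - Suc m)) (n - Suc m) w (n - m))"
      using move1[of Go_Left "\<rho>(k := n - Suc m)" "n - m"] by simp
    moreover have "exec (Act (Suc (R + i')) None Go_Left) (tapes (\<rho>(k := n - Suc m)) (n - Suc m) w (n - m)) 1
        (?S (Suc m))"
      using move2[of Go_Left "\<rho>(k := n - Suc m)" "n - Suc m" w "n - m"] by simp
    ultimately show "exec (Seq (Dec k) (Seq (Act (Suc (R + i)) None Go_Left) (Act (Suc (R + i')) None Go_Left)))
        (?S m) (1 + (1 + 1)) (?S (Suc m))"
      by (blast intro: exec_Seq)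
  qed (use k in \<open>auto simp: nonzero_tapes\<close>)
  then show ?thesis by (simp only: diff_zero diff_self_eq_0)
qed

abbreviation "s \<equiv> length (enc_nat l)"

lemma s_le: "s \<le> length y"
  by (simp add: y)

lemma exec_skip:
  "exec (skip_prog (R + i)) (tapes \<rho> 0 w 0) ((length y * ((1 + 1) + 1) + 1) + 1) (tapes \<rho> s w 0)"
proof -
  let ?n = "length (bits l)"
  let ?S = "\<lambda>n. tapes \<rho> (2 * n) w 0"
  have n: "2 * ?n < length y" using s_le by (simp add: length_enc_nat)
  have y': "y = enc_nat l @ concat (map enc_nat ls)" by (simp add: y)
  have "exec (While (\<lambda>xs. xs ! Suc (R + i) = 2) (Seq (Act (Suc (R + i)) None Go_Right) (Act (Suc (R + i)) None Go_Right)))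
      (?S 0) (length y * ((1 + 1) + 1) + 1) (?S ?n)"
  proof (rule exec_While_le[where S = ?S])
    fix m assume m: "m < ?n"
    show "map read_tape (?S m) ! Suc (R + i) = 2"
      unfolding read1 using m n g[of "2 * m"] enc_nat_scan(1)[OF m, of "concat (map enc_nat ls)"] y'
      by (simp add: bit_sym_def)
    show "exec (Seq (Act (Suc (R + i)) None Go_Right) (Act (Suc (R + i)) None Go_Right)) (?S m) (1 + 1) (?S (Suc m))"
      using exec_Seq[OF move1[of Go_Right \<rho> "2 * m" w 0, unfolded move_head.simps]
        move1[of Go_Right \<rho> "2 * m + 1" w 0]] by simp
  next
    show "\<not> map read_tape (?S ?n) ! Suc (R + i) = 2"
      unfolding read1 using n g[of "2 * ?n"] enc_nat_scan(2)[of l "concat (map enc_nat ls)"] y'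
      by (simp add: bit_sym_def)
  qed (use n in simp)
  then show ?thesis
    unfolding skip_prog_def using exec_Seq[OF _ move1[of Go_Right \<rho> "2 * ?n" w 0]]
    by (simp add: length_enc_nat)
qed

definition mismatches :: "nat \<Rightarrow> nat" where
  "mismatches n = card {j. j < n \<and> y ! (s + j) \<noteq> y ! j}"

lemma mismatches_Suc: "mismatches (Suc n) = mismatches n + of_bool (y ! (s + n) \<noteq> y ! n)"
proof -
  have "{j. j < Suc n \<and> y ! (s + j) \<noteq> y ! j} =
      {j. j < n \<and> y ! (s + j) \<noteq> y ! j} \<union> (if y ! (s + n) \<noteq> y ! n then {n} else {})"
    by (auto simp: less_Suc_eq)
  then show ?thesis by (simp add: mismatches_def card_insert_if)
qed

lemma exec_mismatch:
  assumes f: "f < R" and \<rho>: "\<rho> f = 0"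
  shows "exec (mismatch_prog f (R + i) (R + i')) (tapes \<rho> s y 0) (length y * (((1 + 1) + (1 + 1)) + 1) + 1)
    (tapes (\<rho>(f := mismatches (length y - s))) (length y) y (length y - s))"
proof -
  let ?S = "\<lambda>n. tapes (\<rho>(f := mismatches n)) (s + n) y n"
  let ?n = "length y - s"
  have "exec (mismatch_prog f (R + i) (R + i')) (?S 0) (length y * (((1 + 1) + (1 + 1)) + 1) + 1) (?S ?n)"
    unfolding mismatch_prog_def
  proof (rule exec_While_le[where S = ?S])
    fix n assume "n < ?n"
    then have n: "s + n < length y" "n < length y" by simp_all
    show "map read_tape (?S n) ! Suc (R + i) \<noteq> 0"
      unfolding read1 using g[OF n(1)] by (simp add: bit_sym_def)
    let ?\<rho> = "\<rho>(f := mismatches (Suc n))"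
    have r: "g (s + n) \<noteq> fst (input_tape y) n \<longleftrightarrow> y ! (s + n) \<noteq> y ! n"
      using g[OF n(1)] n(2) by (auto simp: input_tape_def bit_sym_def)
    have "exec (Cond (\<lambda>xs. xs ! Suc (R + i) \<noteq> xs ! Suc (R + i')) (Inc f) Skip) (?S n) (1 + 1)
        (tapes ?\<rho> (s + n) y n)"
    proof (rule exec_Cond; unfold read1 read2 r)
      assume "y ! (s + n) \<noteq> y ! n"
      then show "exec (Inc f) (?S n) 1 (tapes ?\<rho> (s + n) y n)"
        using inc[OF f, of "\<rho>(f := mismatches n)"] by (simp add: mismatches_Suc)
    next
      assume "\<not> y ! (s + n) \<noteq> y ! n"
      then show "exec Skip (?S n) 1 (tapes ?\<rho> (s + n) y n)"
        using exec_Skip by (simp add: mismatches_Suc)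
    qed
    moreover have "exec (Act (Suc (R + i)) None Go_Right) (tapes ?\<rho> (s + n) y n) 1 (tapes ?\<rho> (s + Suc n) y n)"
      using move1[of Go_Right ?\<rho> "s + n"] by simp
    moreover have "exec (Act (Suc (R + i')) None Go_Right) (tapes ?\<rho> (s + Suc n) y n) 1 (?S (Suc n))"
      using move2[of Go_Right ?\<rho> "s + Suc n" y n] by simp
    ultimately show "exec (Seq (Cond (\<lambda>xs. xs ! Suc (R + i) \<noteq> xs ! Suc (R + i')) (Inc f) Skip)
        (Seq (Act (Suc (R + i)) None Go_Right) (Act (Suc (R + i')) None Go_Right)))
        (?S n) ((1 + 1) + (1 + 1)) (?S (Suc n))"
      by (blast intro: exec_Seq)
  next
    show "\<not> map read_tape (?S ?n) ! Suc (R + i) \<noteq> 0" unfolding read1 using s_le by (simp add: g_end)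
  qed simp
  moreover have "\<rho>(f := mismatches 0) = \<rho>" using \<rho> by (auto simp: fun_eq_iff mismatches_def)
  ultimately show ?thesis using s_le by (simp only: add_0_right le_add_diff_inverse)
qed

lemma mismatches_zero_iff: "mismatches (length y - s) \<noteq> 0 \<longleftrightarrow> (\<exists>l'\<in>set ls. l' \<noteq> l)"
proof -
  have "mismatches (length y - s) = 0 \<longleftrightarrow> (\<forall>j. s + j < length y \<longrightarrow> y ! (s + j) = y ! j)"
    unfolding mismatches_def by (subst card_0_eq) auto
  then show ?thesis using labels_equal_iff[OF y] by auto
qed

lemma exec_compare:
  assumes "k < R" "f < R" "k \<noteq> f" "\<rho> k = 0" "\<rho> f = 0"
  shows "\<exists>us. exec (compare_prog k f (R + i) (R + i')) (tapes \<rho> 0 [] 0) (20 * length y + 20) us \<and>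
    (nonzero f (map read_tape us) \<longleftrightarrow> (\<exists>l'\<in>set ls. l' \<noteq> l))"
proof -
  have e: "\<rho>(k := 0) = \<rho>" using assms by (auto simp: fun_eq_iff)
  have "exec (compare_prog k f (R + i) (R + i')) (tapes \<rho> 0 [] 0)
      ((length y * (((1 + 1) + (1 + 1)) + 1) + 1) + ((length y * ((1 + (1 + 1)) + 1) + 1) +
        (((length y * ((1 + 1) + 1) + 1) + 1) + (length y * (((1 + 1) + (1 + 1)) + 1) + 1))))
      (tapes (\<rho>(f := mismatches (length y - s))) (length y) y (length y - s))"
    unfolding compare_prog_def
    by (rule exec_Seq[OF exec_copy[of k \<rho>, OF assms(1,4)] exec_Seq[OF exec_rewind2[OF assms(1), of \<rho>, unfolded e]
      exec_Seq[OF exec_skip exec_mismatch[of f \<rho>, OF assms(2,5)]]]])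
  then have "exec (compare_prog k f (R + i) (R + i')) (tapes \<rho> 0 [] 0) (20 * length y + 20)
      (tapes (\<rho>(f := mismatches (length y - s))) (length y) y (length y - s))"
    by (rule exec_mono) simp
  then show ?thesis using assms(2) mismatches_zero_iff by (auto simp: nonzero_tapes)
qed

end

lemma wf_prog_Move [simp]: "wf_prog K S (Move r s) \<longleftrightarrow> Suc r < K \<and> Suc s < K"
  by (auto simp: Move_def)

lemma wf_prog_Clear [simp]: "wf_prog K S (Clear r) \<longleftrightarrow> Suc r < K"
  by (auto simp: Clear_def)

lemma wf_prog_Copy [simp]: "wf_prog K S (Copy r s f) \<longleftrightarrow> Suc r < K \<and> Suc s < K \<and> Suc f < K"
  by (auto simp: Copy_def)

lemma wf_prog_Const: "Suc d < K \<Longrightarrow> wf_prog K S (((Seq (Inc d)) ^^ n) Skip)"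
  by (induction n) auto

lemma wf_eval_prog:
  "bounded V e \<Longrightarrow> V \<le> d \<Longrightarrow> d < f \<Longrightarrow> f + depth e < K \<Longrightarrow> wf_prog K S (eval_prog e d f)"
  by (induction e arbitrary: d f) (auto simp: wf_prog_Const)

lemma wf_cmd_prog:
  "cmd_bounded V c \<Longrightarrow> V \<le> k \<Longrightarrow> k < f \<Longrightarrow> f + cmd_depth c \<le> R \<Longrightarrow> R + 1 < K \<Longrightarrow> S \<ge> 3 \<Longrightarrow>
    wf_prog K S (cmd_prog R k c f)"
  by (induction c arbitrary: f) (auto simp: Write_def bit_sym_def intro!: wf_eval_prog[of V])

lemma wf_mark_prog: "r < K \<Longrightarrow> S \<ge> 3 \<Longrightarrow> wf_prog K S (mark_prog r)"
  by (induction r) auto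

lemma wf_simulate_prog:
  assumes "wf_tm M" "k < R" "K = Suc R + tm_tapes M + n"
  shows "wf_prog K (tm_syms M) (simulate_prog M R k)"
  unfolding simulate_prog_def wf_prog.simps
proof (intro allI impI)
  fix q xs q' as
  assume q: "q < tm_states M"
    and a: "length xs = K \<and> set xs \<subseteq> {..<tm_syms M} \<and> simulated_delta M R k q xs = Some (q', as)"
  define D where "D = tm_delta M q (take (tm_tapes M) (drop (Suc R) xs))"
  define h where "h = (stay (take (Suc R) xs))[Suc k := (xs ! Suc k, Go_Right)]"
  define e where "e = stay (drop (Suc R + tm_tapes M) xs)"
  have "D \<noteq> {}" using a by (auto simp: simulated_delta_def D_def Let_def)
  then have "(SOME a. a \<in> D) \<in> D" by (simp add: some_in_eq)
  moreover obtain as' where as': "(SOME a. a \<in> D) = (q', as')" "as = h @ as' @ e"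
    using a \<open>D \<noteq> {}\<close> by (auto simp: simulated_delta_def D_def[symmetric] h_def e_def Let_def split: prod.splits)
  ultimately have "(q', as') \<in> D" by simp
  have xs: "length (take (tm_tapes M) (drop (Suc R) xs)) = tm_tapes M"
    "set (take (tm_tapes M) (drop (Suc R) xs)) \<subseteq> {..<tm_syms M}"
    using a assms(3) set_take_subset[of "tm_tapes M" "drop (Suc R) xs"] set_drop_subset[of "Suc R" xs]
    by auto
  have d: "(q', as') \<in> tm_delta M q (take (tm_tapes M) (drop (Suc R) xs))"
    using \<open>(q', as') \<in> D\<close> by (simp add: D_def)
  note m = wf_tm_action[OF assms(1) q xs d]
  have "proper_move (Suc R) (tm_syms M) (stay (take (Suc R) xs))"
    using a assms(3) set_take_subset[of "Suc R" xs] by (intro proper_stay) auto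
  moreover have "xs ! Suc k < tm_syms M"
  proof -
    have "xs ! Suc k \<in> set xs" using a assms(2,3) by (intro nth_mem) simp
    then show ?thesis using a by blast
  qed
  moreover have "fst ` set h \<subseteq> insert (xs ! Suc k) (fst ` set (stay (take (Suc R) xs)))"
    unfolding h_def using image_mono[OF set_update_subset_insert[of "stay (take (Suc R) xs)" "Suc k"
        "(xs ! Suc k, Go_Right)"], of fst] by simp
  ultimately have h: "fst ` set h \<subseteq> {..<tm_syms M}"
    unfolding proper_move_def by (meson insert_subset lessThan_iff order_trans)
  have lh: "length h = Suc R" using a assms(3) by (simp add: h_def stay_def)
  have "proper_move n (tm_syms M) e"
    unfolding e_def using a assms(3) set_drop_subset[of "Suc R + tm_tapes M" xs]
    by (intro proper_stay) auto
  then have e: "length e = n" "fst ` set e \<subseteq> {..<tm_syms M}" by (simp_all add: proper_move_def)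
  have "fst ` set as \<subseteq> {..<tm_syms M}" unfolding as' using m(3) h e(2) by (simp add: image_Un)
  moreover have "length as = K" unfolding as' using m(2) lh e(1) assms(3) by simp
  ultimately show "q' < tm_states M \<and> length as = K \<and> fst ` set as \<subseteq> {..<tm_syms M}"
    using m(1) by blast
qed

text \<open>Every printed bit costs at least one unit of \<open>cmd_time\<close>, so the time bound
  also bounds the string handed to the approximation algorithm.\<close>

lemma length_out_le:
  "cmd_bounded V c \<Longrightarrow> (\<And>v. v < V \<Longrightarrow> \<rho> v \<le> m) \<Longrightarrow> length (out x c \<rho>) \<le> cmd_time c m"
proof (induction c arbitrary: \<rho> m)
  case (Print e)
  show ?case by simp
next
  case (Then c d)
  show ?case using Then.IH(1)[of \<rho> m] Then.IH(2)[of \<rho> m] Then.prems by simp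
next
  case (If e c)
  show ?case using If.IH[of \<rho> m] If.prems by simp
next
  case (For v e c)
  let ?n = "value_bound e m"
  have a: "eval x e \<rho> \<le> ?n" using eval_le[of V e \<rho> m x] For.prems by simp
  have "length (out x c (\<rho>(v := i))) \<le> cmd_time c (m + ?n)" if i: "i < eval x e \<rho>" for i
  proof (rule For.IH)
    fix u assume "u < V"
    then show "(\<rho>(v := i)) u \<le> m + ?n" using For.prems(2)[of u] i a by simp
  qed (use For.prems in simp)
  then have "(\<Sum>i<eval x e \<rho>. length (out x c (\<rho>(v := i)))) \<le> (\<Sum>i<eval x e \<rho>. cmd_time c (m + ?n))"
    by (intro sum_mono) auto
  also have "\<dots> \<le> ?n * cmd_time c (m + ?n)" using a by simp
  also have "\<dots> \<le> cmd_time (For v e c) m" by (simp add: algebra_simps)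
  finally show ?case
    by (simp add: length_concat comp_def interv_sum_list_conv_sum_set_nat lessThan_atLeast0 del: cmd_time.simps)
qed

text \<open>The tapes are the input, \<open>R\<close> registers, the tapes of \<open>M\<close> and
  one spare tape. The generator prints directly onto the first tape of \<open>M\<close>; the spare
  tape takes the copy for the comparison. Register \<open>V\<close> serves in turn as length, step
  and rewind counter.\<close>

definition decision_prog :: "tm \<Rightarrow> cmd \<Rightarrow> nat \<Rightarrow> nat \<Rightarrow> prog" where
  "decision_prog M gen V R =
     Seq (mark_prog R) (Seq (load_prog (V + 1)) (Seq (cmd_prog R V gen (V + 1))
       (Seq (rewind_prog V (R + 0)) (Seq (simulate_prog M R V) (Seq (rewind_prog V (R + (tm_tapes M - 1)))
         (compare_prog V (V + 1) (R + (tm_tapes M - 1)) (R + tm_tapes M)))))))"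

text \<open>\<open>M\<close> is fast only on \<open>X\<close>, but the resulting machine must be
  fast on every input; hence the generator has to produce a member of \<open>X\<close> from every
  \<open>x\<close>.\<close>

theorem class_P_via_labels:
  assumes M: "wf_tm M" "deterministic M" "poly_time_on M X"
    and gen: "cmd_bounded V gen" "V \<ge> 1"
    and X: "\<And>x. out x gen (input_env x) \<in> X"
    and labels: "\<And>x. \<exists>l ls. computes M (out x gen (input_env x)) (concat (map enc_nat (l # ls))) \<and>
      (x \<in> L \<longleftrightarrow> (\<exists>l'\<in>set ls. l' \<noteq> l))"
  shows "L \<in> class_P"
proof -
  \<comment> \<open>Registers below \<open>V\<close> are the variables, \<open>V\<close> is the
    counter, and those from \<open>V + 1\<close> on are scratch space.\<close>
  define R where "R = V + 2 + cmd_depth gen"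
  let ?kM = "tm_tapes M" and ?k = V and ?f = "V + 1"
  define K where "K = Suc R + ?kM + 1"
  have kM: "?kM \<ge> 1" and syms: "tm_syms M \<ge> 3" using M(1) by (auto simp: wf_tm_def)
  have k: "?k < R" and f: "?f < R" by (simp_all add: R_def)
  let ?P = "decision_prog M gen V R"
  have wf: "wf_prog K (tm_syms M) ?P"
    using wf_simulate_prog[OF M(1) k, of K 1] wf_mark_prog[of R K "tm_syms M"] kM syms k
      wf_cmd_prog[OF gen(1), of V "V + 1" R K "tm_syms M"]
    by (simp add: decision_prog_def load_prog_def rewind_prog_def compare_prog_def copy_prog_def
        rewind2_prog_def skip_prog_def mismatch_prog_def K_def R_def)
  obtain p where p: "\<And>y t c. y \<in> X \<Longrightarrow> (step M ^^ t) (init M y) c \<Longrightarrow> t \<le> poly p (length y)"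
    using M(3) unfolding poly_time_on_def by blast
  obtain a where a: "\<And>m. poly p m \<le> (m + 2) ^ a"
    using poly_growth_poly[of p] unfolding poly_growth_def by blast
  define Y where "Y = cmd_time gen"
  define T where "T = (\<lambda>N. (Y N + 2) ^ a)"
  define total where "total = (\<lambda>N. (R + 1) + (((N * 4 + 1) + (N * 3 + 1)) + (Y N + ((Y N * 3 + 1) +
      ((T N + 1) + ((T N * 3 + 1) + (20 * (Y N + T N) + 20)))))))"
  have "poly_growth Y" unfolding Y_def by (rule poly_growth_cmd_time)
  moreover have "poly_growth (\<lambda>m. (m + 2) ^ a)" unfolding poly_growth_def by blast
  then have "poly_growth T" unfolding T_def using poly_growth_compose \<open>poly_growth Y\<close> by blast
  ultimately have "poly_growth total"
    unfolding total_def by (intro poly_growth_add poly_growth_mult poly_growth_const poly_growth_id) auto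
  then obtain r where r: "\<And>N. total N \<le> poly r N" by (rule poly_growth_le_poly) blast
  have "\<exists>ts. exec ?P (snd (init (tm_of K (tm_syms M) ?P (nonzero ?f)) x)) (poly r (length x)) ts \<and>
      (nonzero ?f (map read_tape ts) \<longleftrightarrow> x \<in> L)" for x
  proof -
    let ?N = "length x"
    define y where "y = out x gen (input_env x)"
    obtain l ls where comp: "computes M y (concat (map enc_nat (l # ls)))"
      and L: "x \<in> L \<longleftrightarrow> (\<exists>l'\<in>set ls. l' \<noteq> l)"
      using labels[of x] unfolding y_def by blast
    define z where "z = concat (map enc_nat (l # ls))"
    obtain t c where c: "(step M ^^ t) (init M y) c" "halted M c" "output_is c z"
      using comp unfolding computes_def z_def by (meson rtranclp_imp_relpowp)
    have env: "input_env x v \<le> ?N" for v by (simp add: input_env_def)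
    have yY: "length y \<le> Y ?N"
      unfolding y_def Y_def by (rule length_out_le[OF gen(1) env])
    have "t \<le> poly p (length y)" using p[OF _ c(1)] X[of x] y_def by simp
    also have "\<dots> \<le> (length y + 2) ^ a" by (rule a)
    also have "\<dots> \<le> T ?N" unfolding T_def using yY by (intro power_mono) auto
    finally have tT: "t \<le> T ?N" .
    have len: "length (snd c) = ?kM"
      using wf_config_steps[OF M(1) wf_config_init[OF M(1)] c(1)] by (simp add: wf_config_def)
    obtain g h where gh: "last (snd c) = (g, h)" by fastforce
    have last: "snd c ! (?kM - 1) = (g, h)"
      using gh len kM by (metis last_conv_nth length_0_conv not_one_le_zero)
    have "(g, h) \<in> set (snd c)" using gh len kM last_in_set[of "snd c"] by fastforce
    then have ht: "h \<le> t" and supp: "\<forall>i\<ge>length y + t. g i = 0"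
      using support_steps[OF c(1)] by blast+
    have g: "\<And>n. n < length z \<Longrightarrow> g n = bit_sym (z ! n)" and g_end: "g (length z) = 0"
      using c(3) gh by (auto simp: output_is_def)
    \<comment> \<open>After \<open>t\<close> steps all cells from \<open>length y + t\<close> on are
      blank, but the cells of the output are not.\<close>
    have "length z \<le> length y + t"
    proof (rule ccontr)
      assume "\<not> length z \<le> length y + t"
      then show False using g[of "length y + t"] supp by (auto simp: bit_sym_def split: if_splits)
    qed
    then have zY: "length z \<le> Y ?N + T ?N" using yY tT by simp
    let ?e = "input_env x"
    have e0: "?e V = 0" "?e (V + 1) = 0" using gen(2) by (auto simp: input_env_def)
    have eV: "?e(V := 0) = ?e" using e0 by (auto simp: fun_eq_iff)
    define blanks where "blanks = replicate (?kM - 1) blank @ [blank]"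
    have "replicate (K - 1) blank = replicate R blank @ blank # blanks"
    proof -
      have "K - 1 = R + (1 + ((?kM - 1) + 1))" using kM by (simp add: K_def)
      then show ?thesis unfolding blanks_def by (simp only: replicate_add) simp
    qed
    then have init: "snd (init (tm_of K (tm_syms M) ?P (nonzero ?f)) x) =
        input_tape x # replicate R blank @ blank # blanks"
      by (simp add: init_def tm_of_def)
    have 1: "exec (mark_prog R) (input_tape x # replicate R blank @ blank # blanks) (R + 1)
        (layout x 0 R (\<lambda>v. 0) (out_tape [] # blanks))"
      using exec_mark_prog[of R R x "blank # blanks"]
      by (simp add: layout_def out_tape_Nil) (simp add: input_tape_def)
    have 2: "exec (load_prog ?f) (layout x 0 R (\<lambda>v. 0) (out_tape [] # blanks)) ((?N * 4 + 1) + (?N * 3 + 1))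
        (layout x 0 R ?e (out_tape [] # blanks))"
      by (rule exec_load_prog) (use f in auto)
    let ?e1 = "?e(V := length y)"
    have 3: "exec (cmd_prog R V gen ?f) (layout x 0 R ?e (out_tape [] # blanks)) (Y ?N)
        (layout x 0 R ?e1 (out_tape y # blanks))"
    proof -
      have "exec (cmd_prog R V gen ?f) (layout x 0 R ?e (out_tape [] # blanks)) (cmd_time gen ?N)
          (layout x 0 R (?e(V := ?e V + length (out x gen ?e))) (out_tape ([] @ out x gen ?e) # blanks))"
        by (rule exec_cmd_prog[OF gen(1)]) (use env in \<open>auto simp: R_def input_env_def\<close>)
      then show ?thesis using e0(1) unfolding y_def Y_def by simp
    qed
    have 4: "exec (rewind_prog V (R + 0)) (layout x 0 R ?e1 (out_tape y # blanks)) (Y ?N * 3 + 1)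
        (layout x 0 R ?e (input_tape y # blanks))"
      using exec_rewind_prog[OF k, of 0 "out_tape y # blanks" "fst (input_tape y)" "length y" ?e1 "Y ?N" x] yY eV
      by (simp add: out_tape_def del: fun_upd_apply) (simp add: input_tape_def)
    have iM: "input_tape y # blanks = snd (init M y) @ [blank]"
      by (simp add: init_def blanks_def)
    let ?e2 = "?e(V := t)"
    have "exec (simulate_prog M R V) (layout x 0 R ?e (input_tape y # blanks)) (t + 1)
        (layout x 0 R ?e2 (snd c @ [blank]))"
      unfolding iM by (rule exec_simulate_prog[where \<rho> = ?e and k = V, OF M(1) c(1,2) k e0(1) M(2)])
    then have 5: "exec (simulate_prog M R V) (layout x 0 R ?e (input_tape y # blanks)) (T ?N + 1)
        (layout x 0 R ?e2 (snd c @ [blank]))"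
      by (rule exec_mono) (use tT in simp)
    let ?r = "(snd c @ [blank])[?kM - 1 := (g, 0)]"
    have 6: "exec (rewind_prog V (R + (?kM - 1))) (layout x 0 R ?e2 (snd c @ [blank])) (T ?N * 3 + 1)
        (layout x 0 R ?e ?r)"
    proof -
      have "exec (rewind_prog V (R + (?kM - 1))) (layout x 0 R ?e2 (snd c @ [blank])) (T ?N * 3 + 1)
          (layout x 0 R (?e2(V := 0)) ?r)"
        by (rule exec_rewind_prog[where t = g and h = h])
          (use k last len kM ht tT in \<open>simp_all add: nth_append\<close>)
      moreover have "?e2(V := 0) = ?e" using eV by simp
      ultimately show ?thesis by (simp only:)
    qed
    interpret label_tapes R "?kM - 1" ?kM "snd c @ [blank]" g z l ls x
      using len kM g g_end by unfold_locales (auto simp: z_def)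
    have "tapes ?e 0 [] 0 = layout x 0 R ?e ?r"
      unfolding tapes_def using len kM by (simp add: list_update_append) (simp add: input_tape_def)
    then obtain us where us: "exec (compare_prog V ?f (R + (?kM - 1)) (R + ?kM)) (layout x 0 R ?e ?r)
        (20 * length z + 20) us" "nonzero ?f (map read_tape us) \<longleftrightarrow> x \<in> L"
      using exec_compare[of V ?f ?e] k f e0 L by auto
    from us(1) have 7: "exec (compare_prog V ?f (R + (?kM - 1)) (R + ?kM)) (layout x 0 R ?e ?r)
        (20 * (Y ?N + T ?N) + 20) us"
      by (rule exec_mono) (use zY in simp)
    have "exec ?P (input_tape x # replicate R blank @ blank # blanks) (total ?N) us"
      unfolding decision_prog_def total_def
      by (rule exec_Seq[OF 1 exec_Seq[OF 2 exec_Seq[OF 3 exec_Seq[OF 4 exec_Seq[OF 5 exec_Seq[OF 6 7]]]]]])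
    then show ?thesis unfolding init using us(2) exec_mono[OF _ r] by blast
  qed
  then show ?thesis by (intro class_P_intro[OF _ syms wf]) (auto simp: K_def)
qed

section \<open>Accepting runs as cliques\<close>

section \<open>Binary constraints as a clique problem\<close>

text \<open>An item is a variable with a value. Compatible items have different variables, so a
  conflict-free set of size \<open>card U\<close> gives each variable exactly one value. A number
  that encodes no item conflicts with every other number.\<close>

lemma clique_iff_assignment:
  fixes pack :: "'u \<times> 'v \<Rightarrow> nat" and C :: "'u \<times> 'v \<Rightarrow> 'u \<times> 'v \<Rightarrow> bool"
  assumes U: "finite U" "card U \<ge> 2" and inj: "inj_on pack (U \<times> D)" and range: "pack ` (U \<times> D) \<subseteq> {..<N}"
    and C: "\<And>u v u' v'. C (u, v) (u', v') \<Longrightarrow> u \<noteq> u'"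
    and conf: "\<And>i i'. conf i i' \<longleftrightarrow> i \<noteq> i' \<and>
      \<not> (\<exists>p\<in>U \<times> D. \<exists>p'\<in>U \<times> D. i = pack p \<and> i' = pack p' \<and> C p p')"
  shows "(\<exists>I\<subseteq>{..<N}. card I = card U \<and> (\<forall>i\<in>I. \<forall>i'\<in>I. \<not> conf i i')) \<longleftrightarrow>
    (\<exists>\<phi>. (\<forall>u\<in>U. \<phi> u \<in> D) \<and> (\<forall>u\<in>U. \<forall>u'\<in>U. u \<noteq> u' \<longrightarrow> C (u, \<phi> u) (u', \<phi> u')))"
    (is "?lhs \<longleftrightarrow> ?rhs")
proof
  assume ?lhs
  then obtain I where I: "I \<subseteq> {..<N}" "card I = card U" and free: "\<And>i i'. i \<in> I \<Longrightarrow> i' \<in> I \<Longrightarrow> \<not> conf i i'"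
    by blast
  have fI: "finite I" using I(1) finite_subset by blast
  have ex: "\<exists>p\<in>U \<times> D. \<exists>p'\<in>U \<times> D. i = pack p \<and> i' = pack p' \<and> C p p'"
    if "i \<in> I" "i' \<in> I" "i \<noteq> i'" for i i'
    using free[OF that(1,2)] that(3) conf by blast
  have "\<exists>p\<in>U \<times> D. i = pack p" if i: "i \<in> I" for i
  proof -
    \<comment> \<open>Here \<open>card U \<ge> 2\<close> enters: a second member exists, and the
      absence of a conflict with it shows that \<open>i\<close> is a code.\<close>
    have "I \<noteq> {i}" using I(2) U(2) by auto
    then obtain i' where "i' \<in> I" "i \<noteq> i'" using i by blast
    then show ?thesis using ex i by blast
  qed
  then obtain dec where dec: "\<And>i. i \<in> I \<Longrightarrow> dec i \<in> U \<times> D \<and> i = pack (dec i)" by metis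
  have comp: "C (dec i) (dec i')" if i: "i \<in> I" "i' \<in> I" "i \<noteq> i'" for i i'
  proof -
    obtain p p' where p: "p \<in> U \<times> D" "p' \<in> U \<times> D" "i = pack p" "i' = pack p'" "C p p'"
      using ex[OF i] by blast
    have "p = dec i" "p' = dec i'"
      using inj_onD[OF inj] dec[OF i(1)] dec[OF i(2)] p by metis+
    then show ?thesis using p by simp
  qed
  have inj_u: "inj_on (\<lambda>i. fst (dec i)) I"
  proof (rule inj_onI, rule ccontr)
    fix i i' assume "i \<in> I" "i' \<in> I" "fst (dec i) = fst (dec i')" "i \<noteq> i'"
    then show False using C[of "fst (dec i)" "snd (dec i)" "fst (dec i')" "snd (dec i')"] comp by simp
  qed
  have "(\<lambda>i. fst (dec i)) ` I \<subseteq> U" using dec by (auto simp: mem_Times_iff)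
  then have surj: "(\<lambda>i. fst (dec i)) ` I = U"
    using U(1) I(2) card_image[OF inj_u] card_subset_eq by metis
  define \<psi> where "\<psi> u = inv_into I (\<lambda>i. fst (dec i)) u" for u
  have \<psi>: "\<psi> u \<in> I" "fst (dec (\<psi> u)) = u" if "u \<in> U" for u
    using that surj unfolding \<psi>_def by (metis inv_into_into, metis f_inv_into_f)
  show ?rhs
  proof (intro exI[of _ "\<lambda>u. snd (dec (\<psi> u))"] conjI ballI impI)
    fix u assume u: "u \<in> U"
    show "snd (dec (\<psi> u)) \<in> D" using dec[OF \<psi>(1)[OF u]] by (auto simp: mem_Times_iff)
    fix u' assume u': "u' \<in> U" "u \<noteq> u'"
    then have "\<psi> u \<noteq> \<psi> u'" using \<psi>(2)[OF u] \<psi>(2)[OF u'(1)] by metis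
    then have "C (dec (\<psi> u)) (dec (\<psi> u'))" using comp \<psi>(1) u u' by blast
    then show "C (u, snd (dec (\<psi> u))) (u', snd (dec (\<psi> u')))"
      using \<psi>(2)[OF u] \<psi>(2)[OF u'(1)] by (metis prod.collapse)
  qed
next
  assume ?rhs
  then obtain \<phi> where \<phi>: "\<And>u. u \<in> U \<Longrightarrow> \<phi> u \<in> D"
    "\<And>u u'. u \<in> U \<Longrightarrow> u' \<in> U \<Longrightarrow> u \<noteq> u' \<Longrightarrow> C (u, \<phi> u) (u', \<phi> u')" by blast
  have "inj_on (\<lambda>u. pack (u, \<phi> u)) U"
  proof (rule inj_onI)
    fix u u' assume u: "u \<in> U" "u' \<in> U" "pack (u, \<phi> u) = pack (u', \<phi> u')"
    then have "(u, \<phi> u) = (u', \<phi> u')" using \<phi>(1) by (intro inj_onD[OF inj]) auto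
    then show "u = u'" by simp
  qed
  then have "card ((\<lambda>u. pack (u, \<phi> u)) ` U) = card U" by (rule card_image)
  moreover have "(\<lambda>u. pack (u, \<phi> u)) ` U \<subseteq> {..<N}" using range \<phi>(1) by auto
  moreover have "\<not> conf (pack (u, \<phi> u)) (pack (u', \<phi> u'))" if "u \<in> U" "u' \<in> U" for u u'
    using \<phi> that unfolding conf by (cases "u = u'") blast+
  ultimately show ?lhs by blast
qed

lemma digit_unique: "y < b \<Longrightarrow> y' < b \<Longrightarrow> x * b + y = x' * b + y' \<longleftrightarrow> x = x' \<and> y = y'" for b :: nat
  by (metis add.commute div_mult_self3 div_less add_0 mod_mult_self3 mod_less less_nat_zero_code
      mod_mult_self2 div_mult_self2)

lemma digit_less: "x < a \<Longrightarrow> y < b \<Longrightarrow> x * b + y < a * b" for b :: nat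
proof -
  assume "x < a" "y < b"
  then have "x * b + y < (x + 1) * b" by simp
  also have "\<dots> \<le> a * b" using \<open>x < a\<close> by (intro mult_le_mono1) simp
  finally show ?thesis .
qed

section \<open>Accepting runs as constraints\<close>

text \<open>Halting in state 1 is turned into a padding transition, so that accepting runs can be
  prolonged to any length.\<close>

type_synonym transition = "nat \<times> nat list \<times> nat \<times> (nat \<times> move) list \<times> bool"

definition transitions :: "tm \<Rightarrow> transition set" where
  "transitions M =
     {(q, xs, q', as, False) | q xs q' as. q < tm_states M \<and> length xs = tm_tapes M \<and>
        set xs \<subseteq> {..<tm_syms M} \<and> (q', as) \<in> tm_delta M q xs} \<union>
     {(1, xs, 1, stay xs, True) | xs. length xs = tm_tapes M \<and> set xs \<subseteq> {..<tm_syms M} \<and>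
        tm_delta M 1 xs = {}}"

lemma finite_lists_below: "finite {xs. length xs = n \<and> set xs \<subseteq> {..<s :: nat}}"
  using finite_lists_length_eq[of "{..<s}" n] by (simp add: conj_commute)

text \<open>\<open>tm_delta\<close> is arbitrary on illegal readings, but only legal ones are
  collected, and there \<open>wf_tm\<close> restricts the actions. Finiteness allows the transitions
  to be listed and wired into expressions as constant tables.\<close>

lemma finite_transitions:
  assumes "wf_tm M"
  shows "finite (transitions M)"
proof (rule finite_subset)
  let ?X = "{xs. length xs = tm_tapes M \<and> set xs \<subseteq> {..<tm_syms M}}"
  let ?A = "{as. set as \<subseteq> {..<tm_syms M} \<times> {Go_Left, Go_Right, Stay} \<and> length as = tm_tapes M}"
  let ?Q = "{..<tm_states M}"
  have moves: "m \<in> {Go_Left, Go_Right, Stay}" for m by (cases m) auto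
  have A: "as \<in> ?A" if "length as = tm_tapes M" "fst ` set as \<subseteq> {..<tm_syms M}" for as
    using that moves by (auto simp: image_subset_iff)
  show "transitions M \<subseteq> (?Q \<times> ?X \<times> ?Q \<times> ?A \<times> UNIV)"
  proof
    fix tr assume "tr \<in> transitions M"
    then consider (step) q xs q' as where "tr = (q, xs, q', as, False)" "q < tm_states M"
        "length xs = tm_tapes M" "set xs \<subseteq> {..<tm_syms M}" "(q', as) \<in> tm_delta M q xs"
      | (pad) xs where "tr = (1, xs, 1, stay xs, True)" "length xs = tm_tapes M" "set xs \<subseteq> {..<tm_syms M}"
      unfolding transitions_def by blast
    then show "tr \<in> ?Q \<times> ?X \<times> ?Q \<times> ?A \<times> UNIV"
    proof cases
      case step
      note w = wf_tm_action[OF assms step(2-5)]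
      show ?thesis using step w(1) A[OF w(2,3)] by simp
    next
      case pad
      then have "proper_move (tm_tapes M) (tm_syms M) (stay xs)" by (intro proper_stay)
      then have "stay xs \<in> ?A" by (intro A) (auto simp: proper_move_def)
      moreover have "1 < tm_states M" using assms by (auto simp: wf_tm_def)
      ultimately show ?thesis using pad by simp
    qed
  qed
  show "finite (?Q \<times> ?X \<times> ?Q \<times> ?A \<times> (UNIV :: bool set))"
    by (intro finite_cartesian_product finite_lists_below finite_lists_length_eq) auto
qed

definition fires :: "transition \<Rightarrow> config \<Rightarrow> config \<Rightarrow> bool" where
  "fires tr c c' \<longleftrightarrow> (case tr of (q, xs, q', as, b) \<Rightarrow>
     fst c = q \<and> map read_tape (snd c) = xs \<and> c' = (q', map2 act as (snd c)))"

definition padding :: "transition \<Rightarrow> bool" where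
  "padding tr = snd (snd (snd (snd tr)))"

text \<open>An accepting run of fewer than \<open>T\<close> steps is filled up by padding, which
  repeats its last configuration. Conversely, the first padding transition marks an accepting halted
  configuration, and everything before it consists of steps of \<open>M\<close>.\<close>

lemma accepts_iff_run:
  assumes M: "wf_tm M" and T: "\<And>t c. (step M ^^ t) (init M x) c \<Longrightarrow> t < T"
  shows "accepts M x \<longleftrightarrow> (\<exists>tr cs. cs 0 = init M x \<and>
    (\<forall>t<T. tr t \<in> transitions M \<and> fires (tr t) (cs t) (cs (Suc t))) \<and> padding (tr (T - 1)))"
    (is "_ \<longleftrightarrow> (\<exists>tr cs. ?run tr cs)")
proof
  assume "accepts M x"
  then obtain s c where s: "(step M ^^ s) (init M x) c" and c: "halted M c" "fst c = 1"
    unfolding accepts_def by (meson rtranclp_imp_relpowp)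
  obtain f where f: "f 0 = init M x" "f s = c" "\<And>i. i < s \<Longrightarrow> step M (f i) (f (Suc i))"
    using s unfolding relpowp_fun_conv by blast
  have wf: "wf_config M (f i)" if "i \<le> s" for i
    using that by (induction i) (auto simp: f(1) wf_config_init[OF M] intro: wf_config_step[OF M _ f(3)])
  have "\<exists>tr\<in>transitions M. fires tr (f i) (f (Suc i))" if i: "i < s" for i
  proof -
    obtain q' as where a: "(q', as) \<in> tm_delta M (fst (f i)) (map read_tape (snd (f i)))"
      and f': "f (Suc i) = (q', map2 act as (snd (f i)))"
      using f(3)[OF i] unfolding step_def by blast
    have w: "wf_config M (f i)" using wf i by simp
    have "(fst (f i), map read_tape (snd (f i)), q', as, False) \<in> transitions M"
      using a w wf_config_reads[OF w] unfolding transitions_def wf_config_def by auto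
    then show ?thesis using f' by (auto simp: fires_def intro!: bexI)
  qed
  then obtain tr where tr: "\<And>i. i < s \<Longrightarrow> tr i \<in> transitions M \<and> fires (tr i) (f i) (f (Suc i))" by metis
  let ?pad = "(1, map read_tape (snd c), 1, stay (map read_tape (snd c)), True)"
  have wc: "wf_config M c" using wf[of s] f(2) by simp
  have "tm_delta M 1 (map read_tape (snd c)) = {}"
    using c unfolding halted_def step_def by fastforce
  then have pad: "?pad \<in> transitions M"
    using wf_config_reads[OF wc] unfolding transitions_def by auto
  have pad_fires: "fires ?pad c c" using c(2) by (simp add: fires_def prod_eq_iff)
  let ?tr = "\<lambda>i. if i < s then tr i else ?pad" and ?cs = "\<lambda>i. if i < s then f i else c"
  have "fires (?tr t) (?cs t) (?cs (Suc t))" for t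
  proof (cases "t < s")
    case True
    then have "?cs (Suc t) = f (Suc t)" using f(2) by (cases "Suc t = s") auto
    then show ?thesis using True tr by simp
  qed (use pad_fires in simp)
  moreover have "?cs 0 = init M x" using f(1,2) by (cases s) auto
  moreover have "padding (?tr (T - 1))" using T[OF s] by (auto simp: padding_def)
  ultimately have "?run ?tr ?cs" using tr pad by simp
  then show "\<exists>tr cs. ?run tr cs" by (intro exI[of _ ?tr] exI[of _ ?cs])
next
  have T0: "T > 0" using T[of 0 "init M x"] by simp
  assume "\<exists>tr cs. ?run tr cs"
  then obtain tr cs where run: "?run tr cs" by blast
  define s where "s = (LEAST t. padding (tr t))"
  have s: "padding (tr s)" "s \<le> T - 1" using run unfolding s_def by (auto intro: LeastI Least_le)
  have "s < T" using s(2) T0 by simp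
  have "(step M ^^ t) (init M x) (cs t)" if "t \<le> s" for t
    using that
  proof (induction t)
    case 0
    then show ?case using run by simp
  next
    case (Suc t)
    then have t: "t < s" "t < T" using \<open>s < T\<close> by auto
    then have "\<not> padding (tr t)" using not_less_Least s_def by blast
    moreover have "tr t \<in> transitions M" "fires (tr t) (cs t) (cs (Suc t))" using run t by auto
    ultimately have "step M (cs t) (cs (Suc t))"
      by (auto simp: transitions_def fires_def padding_def step_def)
    moreover have "(step M ^^ t) (init M x) (cs t)" using Suc by simp
    ultimately show ?case by (rule relpowp_Suc_I[rotated])
  qed
  then have "(step M)\<^sup>*\<^sup>* (init M x) (cs s)" by (meson order_refl relpowp_imp_rtranclp)
  moreover have "tr s \<in> transitions M" "fires (tr s) (cs s) (cs (Suc s))" using run \<open>s < T\<close> by auto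
  then have "halted M (cs s)" "fst (cs s) = 1"
    using s(1) by (auto simp: transitions_def fires_def padding_def halted_def step_def)
  ultimately show "accepts M x" unfolding accepts_def by blast
qed

definition tr_src :: "transition \<Rightarrow> nat" where "tr_src tr = fst tr"
definition tr_read :: "transition \<Rightarrow> nat \<Rightarrow> nat" where "tr_read tr j = fst (snd tr) ! j"
definition tr_dst :: "transition \<Rightarrow> nat" where "tr_dst tr = fst (snd (snd tr))"
definition tr_write :: "transition \<Rightarrow> nat \<Rightarrow> nat" where
  "tr_write tr j = fst (fst (snd (snd (snd tr))) ! j)"
text \<open>With this coding a head at \<open>h\<close> moves to \<open>h + tr_move tr j - 1\<close>, also on cell 0.\<close>
definition tr_move :: "transition \<Rightarrow> nat \<Rightarrow> nat" where
  "tr_move tr j = (case snd (fst (snd (snd (snd tr))) ! j) of Go_Left \<Rightarrow> 0 | Stay \<Rightarrow> 1 | Go_Right \<Rightarrow> 2)"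

lemma transition_lengths:
  assumes "wf_tm M" "tr \<in> transitions M"
  shows "length (fst (snd tr)) = tm_tapes M" "length (fst (snd (snd (snd tr)))) = tm_tapes M"
proof -
  show "length (fst (snd tr)) = tm_tapes M" using assms(2) by (auto simp: transitions_def)
  show "length (fst (snd (snd (snd tr)))) = tm_tapes M"
    using assms(2) wf_tm_action(2)[OF assms(1)] by (auto simp: transitions_def stay_def)
qed

lemma fires_iff:
  assumes "wf_tm M" "tr \<in> transitions M" "length (snd c) = tm_tapes M"
  shows "fires tr c c' \<longleftrightarrow> fst c = tr_src tr \<and> fst c' = tr_dst tr \<and> length (snd c') = tm_tapes M \<and>
    (\<forall>j<tm_tapes M. case snd c ! j of (t, h) \<Rightarrow> t h = tr_read tr j \<and>
       snd c' ! j = (t(h := tr_write tr j), h + tr_move tr j - 1))"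
proof -
  obtain q xs q' as b where tr: "tr = (q, xs, q', as, b)" by (cases tr)
  note len = transition_lengths[OF assms(1,2)]
  have "map read_tape (snd c) = xs \<longleftrightarrow>
      (\<forall>j<tm_tapes M. case snd c ! j of (t, h) \<Rightarrow> t h = tr_read tr j)"
  proof -
    have "read_tape u = (case u of (t, h) \<Rightarrow> t h)" for u by (cases u) simp
    then show ?thesis
      using len assms(3) unfolding tr by (auto simp: list_eq_iff_nth_eq tr_read_def split: prod.splits)
  qed
  moreover have "snd c' = map2 act as (snd c) \<longleftrightarrow> length (snd c') = tm_tapes M \<and>
      (\<forall>j<tm_tapes M. case snd c ! j of (t, h) \<Rightarrow> snd c' ! j = (t(h := tr_write tr j), h + tr_move tr j - 1))"
  proof -
    have act: "act (as ! j) u = (case u of (t, h) \<Rightarrow> (t(h := tr_write tr j), h + tr_move tr j - 1))" for j u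
      unfolding tr tr_write_def tr_move_def by (cases u; cases "as ! j"; cases "snd (as ! j)") auto
    have "length as = tm_tapes M" using len(2) by (simp add: tr)
    then have "snd c' = map2 act as (snd c) \<longleftrightarrow> length (snd c') = tm_tapes M \<and>
        (\<forall>j<tm_tapes M. snd c' ! j = act (as ! j) (snd c ! j))"
      using assms(3) by (auto simp: list_eq_iff_nth_eq)
    then show ?thesis by (simp add: act case_prod_beta)
  qed
  ultimately show ?thesis
    unfolding tr by (auto simp: fires_def tr_src_def tr_dst_def prod_eq_iff split: prod.splits)
qed

text \<open>The tape before step \<open>t\<close>, computed from the histories of head positions
  \<open>h\<close> and written symbols \<open>w\<close> instead of a configuration.\<close>

fun content :: "(nat \<Rightarrow> nat) \<Rightarrow> (nat \<Rightarrow> nat) \<Rightarrow> (nat \<Rightarrow> nat) \<Rightarrow> nat \<Rightarrow> nat \<Rightarrow> nat" where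
  "content g h w 0 = g"
| "content g h w (Suc t) = (content g h w t)(h t := w t)"

lemma content_unvisited: "(\<And>t'. t' < t \<Longrightarrow> h t' \<noteq> p) \<Longrightarrow> content g h w t p = g p"
  by (induction t) auto

lemma content_visited:
  "l < t \<Longrightarrow> h l = p \<Longrightarrow> (\<And>t'. l < t' \<Longrightarrow> t' < t \<Longrightarrow> h t' \<noteq> p) \<Longrightarrow> content g h w t p = w l"
proof (induction t)
  case (Suc t)
  show ?case
  proof (cases "l = t")
    case False
    then have "l < t" using Suc.prems(1) by simp
    then have "content g h w t p = w l" using Suc by simp
    moreover have "h t \<noteq> p" using Suc.prems(3)[of t] \<open>l < t\<close> by simp
    ultimately show ?thesis by simp
  qed (use Suc.prems in simp)
qed simp

text \<open>The witness \<open>l\<close> is the last visit to the current cell, or \<open>t\<close>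
  itself if there was none. Given \<open>l\<close>, each condition involves at most two times, which
  is what a conflict between two items can express.\<close>

lemma content_eq_iff:
  "content g h w t (h t) = r \<longleftrightarrow> (\<exists>l\<le>t. (l < t \<longrightarrow> h l = h t \<and> w l = r) \<and> (t \<le> l \<longrightarrow> g (h t) = r) \<and>
     (\<forall>t'<t. l < t' \<or> t \<le> l \<longrightarrow> h t' \<noteq> h t))"
    (is "_ \<longleftrightarrow> (\<exists>l\<le>t. ?ok l)")
proof
  assume r: "content g h w t (h t) = r"
  show "\<exists>l\<le>t. ?ok l"
  proof (cases "\<exists>t'<t. h t' = h t")
    case False
    then have "content g h w t (h t) = g (h t)" by (intro content_unvisited) auto
    then show ?thesis using False r by (intro exI[of _ t]) auto
  next
    case True
    define l where "l = Max {t'. t' < t \<and> h t' = h t}"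
    have fin: "finite {t'. t' < t \<and> h t' = h t}" by simp
    have l: "l < t" "h l = h t" using Max_in[OF fin] True unfolding l_def by blast+
    have max: "h t' \<noteq> h t" if "l < t'" "t' < t" for t'
    proof
      assume "h t' = h t"
      then have "t' \<le> l" using Max_ge[OF fin, of t'] that unfolding l_def by simp
      then show False using that by simp
    qed
    have "content g h w t (h t) = w l" using content_visited[of l t h "h t" g w] l max by blast
    then show ?thesis using l max r by (intro exI[of _ l]) auto
  qed
next
  assume "\<exists>l\<le>t. ?ok l"
  then obtain l where l: "?ok l" by blast
  show "content g h w t (h t) = r"
  proof (cases "l < t")
    case True
    then show ?thesis using content_visited[of l t h "h t" g w] l by auto
  next
    case False
    then show ?thesis using content_unvisited[of t h "h t" g w] l by auto
  qed
qed

definition initial_content :: "bool list \<Rightarrow> nat \<Rightarrow> nat \<Rightarrow> nat" where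
  "initial_content x j h = (if j = 0 then fst (input_tape x) h else 0)"

lemma init_tape: "wf_tm M \<Longrightarrow> j < tm_tapes M \<Longrightarrow> snd (init M x) ! j = (initial_content x j, 0)"
  by (cases j) (auto simp: init_def initial_content_def input_tape_def fun_eq_iff)

definition is_trace :: "tm \<Rightarrow> bool list \<Rightarrow> nat \<Rightarrow> (nat \<Rightarrow> transition) \<Rightarrow> (nat \<Rightarrow> nat \<Rightarrow> nat) \<Rightarrow> bool" where
  "is_trace M x T tr h \<longleftrightarrow>
     (\<forall>t<T. tr t \<in> transitions M) \<and> padding (tr (T - 1)) \<and> tr_src (tr 0) = 0 \<and>
     (\<forall>t. Suc t < T \<longrightarrow> tr_src (tr (Suc t)) = tr_dst (tr t)) \<and>
     (\<forall>j<tm_tapes M. h j 0 = 0 \<and> (\<forall>t. Suc t < T \<longrightarrow> h j (Suc t) = h j t + tr_move (tr t) j - 1) \<and>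
        (\<forall>t<T. content (initial_content x j) (h j) (\<lambda>t. tr_write (tr t) j) t (h j t) = tr_read (tr t) j))"

lemma run_iff_trace:
  assumes M: "wf_tm M" and T: "T > 0"
  shows "(\<exists>tr cs. cs 0 = init M x \<and>
      (\<forall>t<T. tr t \<in> transitions M \<and> fires (tr t) (cs t) (cs (Suc t))) \<and> padding (tr (T - 1))) \<longleftrightarrow>
    (\<exists>tr h. is_trace M x T tr h)"
proof
  let ?k = "tm_tapes M"
  assume "\<exists>tr cs. cs 0 = init M x \<and>
      (\<forall>t<T. tr t \<in> transitions M \<and> fires (tr t) (cs t) (cs (Suc t))) \<and> padding (tr (T - 1))"
  then obtain tr cs where run: "cs 0 = init M x" "\<And>t. t < T \<Longrightarrow> tr t \<in> transitions M"
    "\<And>t. t < T \<Longrightarrow> fires (tr t) (cs t) (cs (Suc t))" "padding (tr (T - 1))" by blast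
  have k: "?k \<ge> 1" using M by (simp add: wf_tm_def)
  have len: "length (snd (cs t)) = ?k" if "t \<le> T" for t
    using that
  proof (induction t)
    case 0
    then show ?case using run(1) wf_config_init[OF M] by (simp add: wf_config_def)
  next
    case (Suc t)
    then show ?case using fires_iff[OF M run(2), of t "cs t" "cs (Suc t)"] run(3)[of t] by simp
  qed
  have st: "fst (cs t) = tr_src (tr t)" "fst (cs (Suc t)) = tr_dst (tr t)"
    "\<forall>j<tm_tapes M. case snd (cs t) ! j of (u, h) \<Rightarrow> u h = tr_read (tr t) j \<and>
       snd (cs (Suc t)) ! j = (u(h := tr_write (tr t) j), h + tr_move (tr t) j - 1)" if "t < T" for t
    using fires_iff[OF M run(2)[OF that], of "cs t" "cs (Suc t)"] run(3)[OF that] len[of t] that by simp_all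
  define h where "h j t = snd (snd (cs t) ! j)" for j t
  have c: "snd (cs t) ! j = (content (initial_content x j) (h j) (\<lambda>t. tr_write (tr t) j) t, h j t)"
    if "t \<le> T" "j < ?k" for t j
    using that
  proof (induction t)
    case 0
    then show ?case using init_tape[OF M] run(1) by (simp add: h_def)
  next
    case (Suc t)
    then have IH: "snd (cs t) ! j =
        (content (initial_content x j) (h j) (\<lambda>t. tr_write (tr t) j) t, h j t)" by simp
    have "t < T" using Suc.prems by simp
    from st(3)[OF this, rule_format, OF \<open>j < ?k\<close>]
    have "fst (snd (cs (Suc t)) ! j) = content (initial_content x j) (h j) (\<lambda>t. tr_write (tr t) j) (Suc t)"
      unfolding IH by simp
    then show ?case unfolding h_def by (metis prod.collapse)
  qed
  have "is_trace M x T tr h"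
    unfolding is_trace_def
  proof (intro conjI allI impI)
    show "tr_src (tr 0) = 0" using st(1)[of 0] run(1) T by (simp add: init_def)
    show "tr_src (tr (Suc t)) = tr_dst (tr t)" if "Suc t < T" for t
      using st(1)[of "Suc t"] st(2)[of t] that by simp
    fix j assume j: "j < ?k"
    show "h j 0 = 0" using init_tape[OF M j] run(1) by (simp add: h_def)
    show "h j (Suc t) = h j t + tr_move (tr t) j - 1" if "Suc t < T" for t
      using st(3)[of t, rule_format, OF _ j] that by (cases "snd (cs t) ! j") (simp add: h_def)
    show "content (initial_content x j) (h j) (\<lambda>t. tr_write (tr t) j) t (h j t) = tr_read (tr t) j"
      if "t < T" for t
      using st(3)[OF that] c[of t j] that j by auto
  qed (use run in auto)
  then show "\<exists>tr h. is_trace M x T tr h" by blast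
next
  let ?k = "tm_tapes M"
  assume "\<exists>tr h. is_trace M x T tr h"
  then obtain tr h where trace: "is_trace M x T tr h" by blast
  \<comment> \<open>A trace fixes the heads only at times below \<open>T\<close>; \<open>hd\<close>
    also supplies their positions after the last transition.\<close>
  define hd where "hd j t = (if t = 0 then 0 else h j (t - 1) + tr_move (tr (t - 1)) j - 1)" for j t
  define cs where "cs t = (if t = 0 then 0 else tr_dst (tr (t - 1)),
    map (\<lambda>j. (content (initial_content x j) (h j) (\<lambda>t. tr_write (tr t) j) t, hd j t)) [0..<?k])" for t
  have hd: "hd j t = h j t" if "t < T" "j < ?k" for j t
    using trace that by (cases t) (auto simp: hd_def is_trace_def)
  have "cs 0 = init M x"
  proof (rule prod_eqI)
    show "snd (cs 0) = snd (init M x)"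
      using wf_config_init[OF M, of x] init_tape[OF M, of _ x]
      by (intro nth_equalityI) (auto simp: cs_def hd_def wf_config_def)
  qed (simp add: cs_def init_def)
  moreover have "fires (tr t) (cs t) (cs (Suc t))" if t: "t < T" for t
  proof -
    have tr: "tr t \<in> transitions M" using trace t by (simp add: is_trace_def)
    have "fst (cs t) = tr_src (tr t)"
      using trace t by (cases t) (auto simp: cs_def is_trace_def)
    moreover have "fst (cs (Suc t)) = tr_dst (tr t)" by (simp add: cs_def)
    moreover have "case snd (cs t) ! j of (u, h) \<Rightarrow> u h = tr_read (tr t) j \<and>
       snd (cs (Suc t)) ! j = (u(h := tr_write (tr t) j), h + tr_move (tr t) j - 1)" if j: "j < ?k" for j
      using trace t j hd[OF t j] by (auto simp: cs_def is_trace_def hd_def[of j "Suc t"])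
    ultimately show ?thesis
      using fires_iff[OF M tr, of "cs t" "cs (Suc t)"] by (simp add: cs_def)
  qed
  ultimately show "\<exists>tr cs. cs 0 = init M x \<and>
      (\<forall>t<T. tr t \<in> transitions M \<and> fires (tr t) (cs t) (cs (Suc t))) \<and> padding (tr (T - 1))"
    using trace unfolding is_trace_def by blast
qed

text \<open>A node \<open>(t, j)\<close> stands for tape \<open>j\<close> at time \<open>t\<close>. Its value consists of the index of the
  transition taken, the head position, and the time of the last visit to the cell under the head
  (or some time \<open>\<ge> t\<close> if there was none). Remembering the last visit makes the consistency of
  the tape contents a binary constraint.\<close>

type_synonym node = "nat \<times> nat"
type_synonym node_value = "nat \<times> nat \<times> nat"

definition local_ok :: "transition list \<Rightarrow> bool list \<Rightarrow> nat \<Rightarrow> node \<times> node_value \<Rightarrow> bool" where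
  "local_ok trs x T = (\<lambda>((t, j), (a, h, l)).
     (t = 0 \<longrightarrow> tr_src (trs ! a) = 0 \<and> h = 0) \<and>
     (Suc t = T \<longrightarrow> padding (trs ! a)) \<and>
     (t \<le> l \<longrightarrow> initial_content x j h = tr_read (trs ! a) j))"

text \<open>Apart from equal times, only the case that the first node is the earlier one is
  constrained; \<open>compatible\<close> therefore uses it in both directions.\<close>

definition forward_ok :: "transition list \<Rightarrow> node \<times> node_value \<Rightarrow> node \<times> node_value \<Rightarrow> bool" where
  "forward_ok trs = (\<lambda>((t, j), (a, h, l)) ((t', j'), (a', h', l')).
     (t = t' \<longrightarrow> a = a') \<and>
     (Suc t = t' \<longrightarrow> tr_src (trs ! a') = tr_dst (trs ! a) \<and>
        (j = j' \<longrightarrow> h' = h + tr_move (trs ! a) j - 1)) \<and>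
     (j = j' \<and> t < t' \<longrightarrow> (l' = t \<longrightarrow> h = h' \<and> tr_write (trs ! a) j = tr_read (trs ! a') j) \<and>
        (l' < t \<or> t' \<le> l' \<longrightarrow> h \<noteq> h')))"

text \<open>Conditions on a single node are attached to pairs too, since a conflict always relates
  two items.\<close>

definition compatible :: "transition list \<Rightarrow> bool list \<Rightarrow> nat \<Rightarrow>
    node \<times> node_value \<Rightarrow> node \<times> node_value \<Rightarrow> bool" where
  "compatible trs x T p p' \<longleftrightarrow> fst p \<noteq> fst p' \<and> local_ok trs x T p \<and> local_ok trs x T p' \<and>
     forward_ok trs p p' \<and> forward_ok trs p' p"

lemma trace_iff_assignment:
  assumes M: "wf_tm M" and T: "T \<ge> 2" and trs: "set trs = transitions M"
  shows "(\<exists>tr h. is_trace M x T tr h) \<longleftrightarrow>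
    (\<exists>\<phi>. (\<forall>u\<in>{..<T} \<times> {..<tm_tapes M}. \<phi> u \<in> {..<length trs} \<times> {..<T} \<times> {..<T}) \<and>
      (\<forall>u\<in>{..<T} \<times> {..<tm_tapes M}. \<forall>u'\<in>{..<T} \<times> {..<tm_tapes M}. u \<noteq> u' \<longrightarrow>
        compatible trs x T (u, \<phi> u) (u', \<phi> u')))"
proof
  let ?k = "tm_tapes M"
  assume "\<exists>tr h. is_trace M x T tr h"
  then obtain tr h where trace: "is_trace M x T tr h" by blast
  have "\<exists>a<length trs. trs ! a = tr t" if "t < T" for t
    using that trace trs by (auto simp: is_trace_def in_set_conv_nth[symmetric])
  then obtain a where a: "\<And>t. t < T \<Longrightarrow> a t < length trs \<and> trs ! (a t) = tr t" by metis
  have "\<exists>l\<le>t. (l < t \<longrightarrow> h j l = h j t \<and> tr_write (tr l) j = tr_read (tr t) j) \<and>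
      (t \<le> l \<longrightarrow> initial_content x j (h j t) = tr_read (tr t) j) \<and>
      (\<forall>t'<t. l < t' \<or> t \<le> l \<longrightarrow> h j t' \<noteq> h j t)" if "t < T" "j < ?k" for t j
    using trace that unfolding is_trace_def by (subst content_eq_iff[symmetric]) blast
  then obtain l where l: "\<And>t j. t < T \<Longrightarrow> j < ?k \<Longrightarrow> l t j \<le> t \<and>
      (l t j < t \<longrightarrow> h j (l t j) = h j t \<and> tr_write (tr (l t j)) j = tr_read (tr t) j) \<and>
      (t \<le> l t j \<longrightarrow> initial_content x j (h j t) = tr_read (tr t) j) \<and>
      (\<forall>t'<t. l t j < t' \<or> t \<le> l t j \<longrightarrow> h j t' \<noteq> h j t)" by metis
  have move: "tr_move r j \<le> 2" for r j by (auto simp: tr_move_def split: move.splits)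
  \<comment> \<open>A head moves by at most one cell per step, so its positions fit into the value
    range below \<open>T\<close>.\<close>
  have h: "h j t \<le> t" if "t < T" "j < ?k" for j t
    using that(1)
  proof (induction t)
    case 0
    then show ?case using trace that by (simp add: is_trace_def)
  next
    case (Suc t)
    then have "h j (Suc t) = h j t + tr_move (tr t) j - 1" using trace that by (simp add: is_trace_def)
    then show ?case using Suc move[of "tr t" j] by simp
  qed
  define \<phi> where "\<phi> u = (a (fst u), h (snd u) (fst u), l (fst u) (snd u))" for u
  have range: "\<phi> (t, j) \<in> {..<length trs} \<times> {..<T} \<times> {..<T}" if "t < T" "j < ?k" for t j
    using a[of t] h[of t j] l[of t j] that by (auto simp: \<phi>_def)
  have local: "local_ok trs x T ((t, j), \<phi> (t, j))" if "t < T" "j < ?k" for t j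
    using trace a[of t] l[of t j] that unfolding local_ok_def \<phi>_def is_trace_def by auto
  have forward: "forward_ok trs ((t, j), \<phi> (t, j)) ((t', j'), \<phi> (t', j'))"
    if "t < T" "j < ?k" "t' < T" "j' < ?k" for t j t' j'
  proof -
    have 1: "tr_src (trs ! a t') = tr_dst (trs ! a t)" if "Suc t = t'"
      using trace a[of t] a[of t'] \<open>t < T\<close> \<open>t' < T\<close> that by (auto simp: is_trace_def)
    have 2: "h j t' = h j t + tr_move (trs ! a t) j - 1" if "Suc t = t'"
      using trace a[of t] \<open>t < T\<close> \<open>t' < T\<close> \<open>j < ?k\<close> that by (auto simp: is_trace_def)
    note l' = l[OF \<open>t' < T\<close> \<open>j < ?k\<close>]
    have 3: "h j t = h j t' \<and> tr_write (trs ! a t) j = tr_read (trs ! a t') j" if "t < t'" "l t' j = t"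
      using l' a[of t] a[of t'] \<open>t < T\<close> \<open>t' < T\<close> that by auto
    have 4: "h j t \<noteq> h j t'" if "t < t'" "l t' j < t \<or> t' \<le> l t' j"
      using l' that by blast
    show ?thesis
    proof (cases "j' = j")
      case True
      show ?thesis unfolding True forward_ok_def \<phi>_def using 1 2 3 4 by simp
    next
      case False
      then show ?thesis unfolding forward_ok_def \<phi>_def using 1 by simp
    qed
  qed
  show "\<exists>\<phi>. (\<forall>u\<in>{..<T} \<times> {..<?k}. \<phi> u \<in> {..<length trs} \<times> {..<T} \<times> {..<T}) \<and>
      (\<forall>u\<in>{..<T} \<times> {..<?k}. \<forall>u'\<in>{..<T} \<times> {..<?k}. u \<noteq> u' \<longrightarrow>
        compatible trs x T (u, \<phi> u) (u', \<phi> u'))"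
  proof (intro exI[of _ \<phi>] conjI ballI impI)
    show "\<phi> u \<in> {..<length trs} \<times> {..<T} \<times> {..<T}" if "u \<in> {..<T} \<times> {..<?k}" for u
      using range[of "fst u" "snd u"] that by (cases u) simp
    fix u u' assume "u \<in> {..<T} \<times> {..<?k}" "u' \<in> {..<T} \<times> {..<?k}" and ne: "u \<noteq> u'"
    then obtain t j t' j' where "u = (t, j)" "t < T" "j < ?k" and "u' = (t', j')" "t' < T" "j' < ?k"
      by (cases u; cases u') simp
    then show "compatible trs x T (u, \<phi> u) (u', \<phi> u')"
      using local forward ne by (simp add: compatible_def)
  qed
next
  let ?k = "tm_tapes M"
  let ?U = "{..<T} \<times> {..<?k}"
  assume "\<exists>\<phi>. (\<forall>u\<in>?U. \<phi> u \<in> {..<length trs} \<times> {..<T} \<times> {..<T}) \<and>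
      (\<forall>u\<in>?U. \<forall>u'\<in>?U. u \<noteq> u' \<longrightarrow> compatible trs x T (u, \<phi> u) (u', \<phi> u'))"
  then obtain \<phi> where *: "\<forall>u\<in>?U. \<phi> u \<in> {..<length trs} \<times> {..<T} \<times> {..<T}"
    "\<forall>u\<in>?U. \<forall>u'\<in>?U. u \<noteq> u' \<longrightarrow> compatible trs x T (u, \<phi> u) (u', \<phi> u')"
    by (elim exE conjE)
  have range: "\<phi> u \<in> {..<length trs} \<times> {..<T} \<times> {..<T}" if "u \<in> ?U" for u
    using * that by blast
  have comp: "compatible trs x T (u, \<phi> u) (u', \<phi> u')" if "u \<in> ?U" "u' \<in> ?U" "u \<noteq> u'" for u u'
    using *(2) that by blast
  have k: "?k \<ge> 1" using M by (simp add: wf_tm_def)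
  define a where "a t = fst (\<phi> (t, 0))" for t
  define h where "h j t = fst (snd (\<phi> (t, j)))" for j t
  define l where "l j t = snd (snd (\<phi> (t, j)))" for j t
  \<comment> \<open>Nodes of the same time carry the same transition index, so that of tape 0 stands
    for all.\<close>
  have eq: "\<phi> (t, j) = (a t, h j t, l j t)" if "t < T" "j < ?k" for t j
  proof (cases "j = 0")
    case False
    then have "compatible trs x T ((t, j), \<phi> (t, j)) ((t, 0), \<phi> (t, 0))"
      using that k by (intro comp) auto
    then show ?thesis
      by (auto simp: compatible_def forward_ok_def a_def h_def l_def split: prod.splits)
  qed (simp add: a_def h_def l_def)
  have local: "local_ok trs x T ((t, j), (a t, h j t, l j t))" if "t < T" "j < ?k" for t j
  proof -
    \<comment> \<open>\<open>local_ok\<close> can only be extracted from a compatible pair; a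
      partner at another time exists because \<open>T \<ge> 2\<close>.\<close>
    define t' :: nat where "t' = (if t = 0 then 1 else 0)"
    have "t' < T" "t' \<noteq> t" using T by (auto simp: t'_def)
    then have "compatible trs x T ((t, j), \<phi> (t, j)) ((t', j), \<phi> (t', j))"
      using that by (intro comp) auto
    then show ?thesis using eq[OF that] by (simp add: compatible_def)
  qed
  have forward: "forward_ok trs ((t, j), (a t, h j t, l j t)) ((t', j'), (a t', h j' t', l j' t'))"
    if "t < T" "j < ?k" "t' < T" "j' < ?k" "(t, j) \<noteq> (t', j')" for t j t' j'
  proof -
    have "compatible trs x T ((t, j), \<phi> (t, j)) ((t', j'), \<phi> (t', j'))"
      using that by (intro comp) simp_all
    then show ?thesis
      unfolding eq[OF \<open>t < T\<close> \<open>j < ?k\<close>] eq[OF \<open>t' < T\<close> \<open>j' < ?k\<close>] compatible_def by (elim conjE)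
  qed
  let ?tr = "\<lambda>t. trs ! a t"
  have in_tr: "?tr t \<in> transitions M" if t: "t < T" for t
  proof -
    have "fst (\<phi> (t, 0)) < length trs" using range[of "(t, 0)"] t k by (cases "\<phi> (t, 0)") simp
    then have "?tr t \<in> set trs" unfolding a_def by (rule nth_mem)
    then show ?thesis unfolding trs .
  qed
  have pad: "padding (?tr (T - 1))" using local[of "T - 1" 0] T k by (simp add: local_ok_def)
  have src0: "tr_src (?tr 0) = 0" using local[of 0 0] T k by (simp add: local_ok_def)
  have src: "tr_src (?tr (Suc t)) = tr_dst (?tr t)" if "Suc t < T" for t
    using forward[of t 0 "Suc t" 0] that k by (simp add: forward_ok_def)
  have h0: "h j 0 = 0" if "j < ?k" for j using local[of 0 j] that T by (simp add: local_ok_def)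
  have hSuc: "h j (Suc t) = h j t + tr_move (?tr t) j - 1" if "Suc t < T" "j < ?k" for t j
    using forward[of t j "Suc t" j] that by (simp add: forward_ok_def)
  have read: "content (initial_content x j) (h j) (\<lambda>t. tr_write (?tr t) j) t (h j t) = tr_read (?tr t) j"
    if t: "t < T" and j: "j < ?k" for t j
  proof -
    have 1: "h j t' = h j t \<and> tr_write (?tr t') j = tr_read (?tr t) j" if "t' < t" "l j t = t'" for t'
      using forward[of t' j t j] that t j by (simp add: forward_ok_def)
    have 2: "h j t' \<noteq> h j t" if "t' < t" "l j t < t' \<or> t \<le> l j t" for t'
      using forward[of t' j t j] that t j by (auto simp: forward_ok_def)
    have 3: "initial_content x j (h j t) = tr_read (?tr t) j" if "t \<le> l j t"
      using local[OF t j] that by (simp add: local_ok_def)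
    show ?thesis
      unfolding content_eq_iff
    \<comment> \<open>For an unvisited cell the recorded time may exceed \<open>t\<close>; the
      minimum brings it into the range of \<open>content_eq_iff\<close>.\<close>
    proof (intro exI[of _ "min (l j t) t"] conjI impI allI)
      assume "min (l j t) t < t"
      then have "l j t < t" "min (l j t) t = l j t" by simp_all
      then show "h j (min (l j t) t) = h j t" "tr_write (?tr (min (l j t) t)) j = tr_read (?tr t) j"
        using 1 by simp_all
    next
      show "initial_content x j (h j t) = tr_read (?tr t) j" if "t \<le> min (l j t) t"
        using 3 that by simp
      show "h j t' \<noteq> h j t" if "t' < t" "min (l j t) t < t' \<or> t \<le> min (l j t) t" for t'
        using 2[of t'] that by (auto simp: min_def split: if_splits)
    qed simp
  qed
  have "is_trace M x T ?tr h"
    unfolding is_trace_def using in_tr pad src0 src h0 hSuc read by (intro conjI allI impI)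
  then show "\<exists>tr h. is_trace M x T tr h" by blast
qed

section \<open>Logic, tables and binary printing in the expression language\<close>

section \<open>Formulas as expressions\<close>

text \<open>Nonzero values count as true, so \<open>Mul\<close> is conjunction, \<open>Add\<close>
  disjunction and \<open>Sum\<close> bounded existential quantification.\<close>

definition "NOT a = Sub (Const 1) a"
definition "IMP a b = Add (NOT a) b"
definition "LE a b = NOT (Sub a b)"
definition "EQ a b = NOT (Add (Sub a b) (Sub b a))"
definition "IF c a b = Add (Mul (NOT (NOT c)) a) (Mul (NOT c) b)"

lemma eval_NOT [simp]: "eval x (NOT a) \<rho> = of_bool (eval x a \<rho> = 0)"
  by (simp add: NOT_def)

lemma eval_IMP [simp]: "eval x (IMP a b) \<rho> = 0 \<longleftrightarrow> eval x a \<rho> \<noteq> 0 \<and> eval x b \<rho> = 0"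
  by (simp add: IMP_def)

lemma eval_LE [simp]: "eval x (LE a b) \<rho> = of_bool (eval x a \<rho> \<le> eval x b \<rho>)"
  by (simp add: LE_def)

lemma eval_EQ [simp]: "eval x (EQ a b) \<rho> = of_bool (eval x a \<rho> = eval x b \<rho>)"
  by (auto simp: EQ_def)

lemma eval_IF [simp]: "eval x (IF c a b) \<rho> = (if eval x c \<rho> \<noteq> 0 then eval x a \<rho> else eval x b \<rho>)"
  by (simp add: IF_def)

lemma eval_Sum_eq_0: "eval x (Sum v a b) \<rho> = 0 \<longleftrightarrow> (\<forall>i<eval x a \<rho>. eval x b (\<rho>(v := i)) = 0)"
  by auto

lemma bounded_formula [simp]:
  "bounded V (NOT a) \<longleftrightarrow> bounded V a"
  "bounded V (IMP a b) \<longleftrightarrow> bounded V a \<and> bounded V b"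
  "bounded V (LE a b) \<longleftrightarrow> bounded V a \<and> bounded V b"
  "bounded V (EQ a b) \<longleftrightarrow> bounded V a \<and> bounded V b"
  "bounded V (IF c a b) \<longleftrightarrow> bounded V c \<and> bounded V a \<and> bounded V b"
  by (auto simp: NOT_def IMP_def LE_def EQ_def IF_def)

lemma bounded_mono: "bounded V e \<Longrightarrow> V \<le> V' \<Longrightarrow> bounded V' e"
  by (induction e) auto

text \<open>A finite function as a sum of point indicators; in this form the transitions of a fixed
  machine enter expressions.\<close>

fun table :: "(nat \<Rightarrow> nat) \<Rightarrow> nat \<Rightarrow> exp \<Rightarrow> exp" where
  "table f 0 e = Const 0"
| "table f (Suc n) e = Add (table f n e) (Mul (Const (f n)) (EQ e (Const n)))"

lemma eval_table: "eval x (table f n e) \<rho> = (if eval x e \<rho> < n then f (eval x e \<rho>) else 0)"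
  by (induction n) (auto simp: less_Suc_eq)

lemma bounded_table [simp]: "bounded V e \<Longrightarrow> bounded V (table f n e)"
  by (induction n) auto

definition table2 :: "(nat \<Rightarrow> nat \<Rightarrow> nat) \<Rightarrow> nat \<Rightarrow> nat \<Rightarrow> exp \<Rightarrow> exp \<Rightarrow> exp" where
  "table2 f n k a j = table (\<lambda>i. f (i div k) (i mod k)) (n * k) (Add (Mul a (Const k)) j)"

lemma eval_table2:
  "eval x a \<rho> < n \<Longrightarrow> eval x j \<rho> < k \<Longrightarrow> eval x (table2 f n k a j) \<rho> = f (eval x a \<rho>) (eval x j \<rho>)"
  using digit_less[of "eval x a \<rho>" n "eval x j \<rho>" k] by (simp add: table2_def eval_table)

lemma bounded_table2 [simp]: "bounded V a \<Longrightarrow> bounded V j \<Longrightarrow> bounded V (table2 f n k a j)"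
  by (simp add: table2_def)

text \<open>Horner's scheme.\<close>

lemma poly_exp: "\<exists>e. bounded 1 e \<and> (\<forall>x \<rho>. eval x e \<rho> = poly p (\<rho> 0))" for p :: "nat poly"
proof (induction p)
  case 0
  show ?case by (intro exI[of _ "Const 0"]) simp
next
  case (pCons a p)
  then obtain e where "bounded 1 e" "\<forall>x \<rho>. eval x e \<rho> = poly p (\<rho> 0)" by blast
  then show ?case by (intro exI[of _ "Add (Const a) (Mul (Var 0) e)"]) simp
qed

section \<open>Printing numbers\<close>

definition pow2 :: "nat \<Rightarrow> bool" where
  "pow2 y \<longleftrightarrow> (\<exists>k. y = 2 ^ k)"

text \<open>Describes powers of 2 by products and parity alone, because expressions have neither
  division nor exponentiation.\<close>

lemma pow2_iff:
  assumes "y > 0"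
  shows "pow2 y \<longleftrightarrow> (\<forall>d q. d * q = y \<longrightarrow> d = 1 \<or> even d)"
proof
  assume "pow2 y"
  then obtain k where k: "y = 2 ^ k" by (auto simp: pow2_def)
  show "\<forall>d q. d * q = y \<longrightarrow> d = 1 \<or> even d"
  proof (intro allI impI)
    fix d q assume "d * q = y"
    then have "d dvd 2 ^ k" using k by (metis dvd_triv_left)
    moreover have "coprime d (2 ^ k)" if "odd d" using that by simp
    ultimately show "d = 1 \<or> even d" by (metis coprime_absorb_left nat_dvd_1_iff_1)
  qed
next
  assume "\<forall>d q. d * q = y \<longrightarrow> d = 1 \<or> even d"
  with assms show "pow2 y"
  proof (induction y rule: less_induct)
    case (less y)
    show ?case
    proof (cases "y = 1")
      case True
      then show ?thesis by (auto simp: pow2_def intro: exI[of _ 0])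
    next
      case False
      then have "even y" using less.prems(2) by (metis mult.right_neutral)
      then obtain z where z: "y = 2 * z" by blast
      have "\<forall>d q. d * q = z \<longrightarrow> d = 1 \<or> even d"
        using less.prems(2) z by (metis mult.left_commute)
      then have "pow2 z" using less.IH[of z] less.prems(1) z by simp
      then obtain k where "z = 2 ^ k" by (auto simp: pow2_def)
      then show ?thesis unfolding pow2_def z by (intro exI[of _ "Suc k"]) simp
    qed
  qed
qed

text \<open>The powers of 2 up to \<open>w\<close> are 1 and the doubles of those up to
  \<open>w div 2\<close>, which matches the recursion of \<open>bits\<close>.\<close>

lemma filter_pow2:
  assumes "w > 0"
  shows "filter pow2 [1..<Suc w] = 1 # map ((*) 2) (filter pow2 [1..<Suc (w div 2)])"
proof (rule sorted_distinct_set_unique)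
  show "set (filter pow2 [1..<Suc w]) = set (1 # map ((*) 2) (filter pow2 [1..<Suc (w div 2)]))"
  proof (intro set_eqI iffI)
    fix y assume "y \<in> set (filter pow2 [1..<Suc w])"
    then obtain k where k: "y = 2 ^ k" "1 \<le> y" "y \<le> w" by (auto simp: pow2_def)
    show "y \<in> set (1 # map ((*) 2) (filter pow2 [1..<Suc (w div 2)]))"
    proof (cases k)
      case (Suc n)
      then have "(2::nat) ^ n \<le> w div 2" using k by simp
      moreover have "(1::nat) \<le> 2 ^ n" by simp
      ultimately have "1 \<le> w div 2" by (rule order_trans[rotated])
      with \<open>2 ^ n \<le> w div 2\<close> have "2 ^ n \<in> set (filter pow2 [1..<Suc (w div 2)])"
        by (auto simp: pow2_def simp del: upt_Suc)
      then show ?thesis using k(1) Suc by (auto simp del: upt_Suc)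
    qed (use k in simp)
  next
    fix y assume y: "y \<in> set (1 # map ((*) 2) (filter pow2 [1..<Suc (w div 2)]))"
    have "pow2 1" by (auto simp: pow2_def intro: exI[of _ 0])
    moreover have "pow2 (2 * z)" if "pow2 z" for z
      using that by (auto simp: pow2_def intro: exI[of _ "Suc _"] simp flip: power_Suc)
    ultimately show "y \<in> set (filter pow2 [1..<Suc w])" using y assms by (auto simp del: upt_Suc)
  qed
  have "sorted (map ((*) 2) xs)" if "sorted xs" for xs :: "nat list"
    using that by (simp add: sorted_map sorted_wrt_mono_rel)
  then show "sorted (1 # map ((*) 2) (filter pow2 [1..<Suc (w div 2)]))"
    by (auto simp: sorted_wrt_filter simp del: upt_Suc)
  show "distinct (1 # map ((*) 2) (filter pow2 [1..<Suc (w div 2)]))"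
    by (auto simp: distinct_map inj_on_def simp del: upt_Suc)
qed (auto simp: sorted_wrt_filter simp del: upt_Suc)

lemma bits_pow2: "bits w = map (\<lambda>y. odd (w div y)) (filter pow2 [1..<Suc w])"
proof (induction w rule: bits.induct)
  case (1 w)
  show ?case
  proof (cases "w = 0")
    case False
    have "bits w = odd w # map (\<lambda>y. odd (w div 2 div y)) (filter pow2 [1..<Suc (w div 2)])"
      using 1 False by (subst bits.simps) simp
    then show ?thesis using False filter_pow2[of w] by (simp add: div_mult2_eq comp_def)
  qed (simp add: bits.simps)
qed

text \<open>Turns the recursion on halves into a loop over all \<open>y < w\<close>, affordable
  because the printed numbers are polynomial in value.\<close>

lemma enc_nat_pow2:
  "enc_nat w = concat (map (\<lambda>y. if pow2 (y + 1) then [True, odd (w div (y + 1))] else []) [0..<w]) @ [False]"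
proof -
  have "concat (map (\<lambda>b. [True, b]) (map g (filter P ys))) =
      concat (map (\<lambda>y. if P y then [True, g y] else []) ys)" for g P and ys :: "nat list"
    by (induction ys) auto
  then have "enc_nat w = concat (map (\<lambda>y. if pow2 y then [True, odd (w div y)] else []) [1..<Suc w]) @ [False]"
    by (simp only: enc_nat_def bits_pow2)
  moreover have "[1..<Suc w] = map (\<lambda>y. y + 1) [0..<w]" by (simp add: map_Suc_upt)
  ultimately show ?thesis by (simp only: map_map comp_def)
qed

text \<open>Variables 14 to 17 are reserved for printing; \<open>e\<close> may be evaluated under arbitrary values
  of these.\<close>

definition POW2 :: "exp \<Rightarrow> exp" where
  "POW2 y = NOT (Sum 15 (Add y (Const 1)) (Sum 16 (Add y (Const 1))
     (Mul (EQ (Mul (Var 15) (Var 16)) y) (Mul (NOT (EQ (Var 15) (Const 1)))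
       (NOT (Sum 17 (Add (Var 15) (Const 1)) (EQ (Mul (Const 2) (Var 17)) (Var 15))))))))"

lemma eval_POW2:
  assumes "\<And>a b. eval x y (\<rho>(15 := a, 16 := b)) = Y" "\<And>a. eval x y (\<rho>(15 := a)) = Y" "eval x y \<rho> = Y" "Y > 0"
  shows "eval x (POW2 y) \<rho> \<noteq> 0 \<longleftrightarrow> pow2 Y"
proof -
  have "(\<forall>i<Suc d. 2 * i \<noteq> d) \<longleftrightarrow> odd d" for d :: nat
  proof
    assume "\<forall>i<Suc d. 2 * i \<noteq> d"
    then show "odd d" by (metis dvd_mult_div_cancel div_le_dividend le_imp_less_Suc)
  qed auto
  then have "eval x (POW2 y) \<rho> \<noteq> 0 \<longleftrightarrow> (\<forall>d<Suc Y. \<forall>q<Suc Y. d * q = Y \<longrightarrow> d = 1 \<or> even d)"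
    using assms(1-3) by (auto simp: POW2_def eval_Sum_eq_0 simp del: eval.simps(6))
  also have "\<dots> \<longleftrightarrow> (\<forall>d q. d * q = Y \<longrightarrow> d = 1 \<or> even d)"
  proof -
    have "d < Suc Y \<and> q < Suc Y" if "d * q = Y" for d q
      using that assms(4) by (metis dvd_imp_le dvd_triv_left dvd_triv_right le_imp_less_Suc)
    then show ?thesis by blast
  qed
  finally show ?thesis using pow2_iff[OF assms(4)] by simp
qed

definition ODD_DIV :: "exp \<Rightarrow> exp \<Rightarrow> exp" where
  "ODD_DIV e y = Sum 15 e (Sum 16 y
     (EQ e (Add (Mul (Add (Mul (Const 2) (Var 15)) (Const 1)) y) (Var 16))))"

text \<open>Replaces division by a search for the quotient \<open>2 * q + 1\<close> and the
  remainder; the bound \<open>q < w\<close> makes the search a bounded sum.\<close>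

lemma odd_div_iff:
  fixes w y :: nat
  assumes "y > 0"
  shows "odd (w div y) \<longleftrightarrow> (\<exists>q<w. \<exists>r<y. w = (2 * q + 1) * y + r)"
proof
  assume "odd (w div y)"
  then obtain q where q: "w div y = 2 * q + 1" by (elim oddE)
  then have w: "w = (2 * q + 1) * y + w mod y" by (metis div_mult_mod_eq)
  have "q < (2 * q + 1) * y" using assms by (cases y) auto
  then have "q < w" using w by linarith
  then show "\<exists>q<w. \<exists>r<y. w = (2 * q + 1) * y + r" using w assms mod_less_divisor by blast
next
  assume "\<exists>q<w. \<exists>r<y. w = (2 * q + 1) * y + r"
  then obtain q r where "r < y" "w = (2 * q + 1) * y + r" by blast
  then have "w div y = 2 * q + 1" by (metis add.commute div_mult_self3 div_less add_0 assms less_numeral_extra(3))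
  then show "odd (w div y)" by simp
qed

lemma eval_ODD_DIV:
  assumes "\<And>a b. eval x y (\<rho>(15 := a, 16 := b)) = Y" "\<And>a. eval x y (\<rho>(15 := a)) = Y" "Y > 0"
    and "\<And>a b. eval x e (\<rho>(15 := a, 16 := b)) = w" "eval x e \<rho> = w"
  shows "eval x (ODD_DIV e y) \<rho> \<noteq> 0 \<longleftrightarrow> odd (w div Y)"
  using assms by (simp add: ODD_DIV_def eval_Sum_eq_0 odd_div_iff del: eval.simps(6))

definition print_nat :: "exp \<Rightarrow> cmd" where
  "print_nat e = Then
     (For 14 e (If (POW2 (Add (Var 14) (Const 1)))
       (Then (Print (Const 1)) (Print (ODD_DIV e (Add (Var 14) (Const 1)))))))
     (Print (Const 0))"

lemma out_print_nat:
  assumes "eval x e \<rho> = w" "\<And>a. eval x e (\<rho>(14 := a)) = w"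
    "\<And>a b c. eval x e (\<rho>(14 := a, 15 := b, 16 := c)) = w"
  shows "out x (print_nat e) \<rho> = enc_nat w"
proof -
  have "out x (If (POW2 (Add (Var 14) (Const 1)))
       (Then (Print (Const 1)) (Print (ODD_DIV e (Add (Var 14) (Const 1)))))) (\<rho>(14 := y)) =
     (if pow2 (y + 1) then [True, odd (w div (y + 1))] else [])" for y
    using assms eval_POW2[of x "Add (Var 14) (Const 1)" "\<rho>(14 := y)" "y + 1"]
      eval_ODD_DIV[of x "Add (Var 14) (Const 1)" "\<rho>(14 := y)" "y + 1" e w]
    by simp
  then show ?thesis
    unfolding print_nat_def out.simps(2,4) assms(1) enc_nat_pow2 by simp
qed

lemma bounded_print_nat: "bounded V e \<Longrightarrow> V \<ge> 18 \<Longrightarrow> cmd_bounded V (print_nat e)"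
  by (simp add: print_nat_def POW2_def ODD_DIV_def)

section \<open>From an input string to its network and back to acceptance\<close>

section \<open>The reduction\<close>

lemma of_bool_mult_eq: "of_bool P * of_bool Q = (of_bool (P \<and> Q) :: nat)"
  by simp

locale ntm_reduction =
  fixes M :: tm and trs :: "transition list" and p :: "nat poly" and T_exp :: exp
  assumes wf: "wf_tm M" and trs: "set trs = transitions M"
    and T_bounded: "bounded 1 T_exp" and T_eval: "\<And>x \<rho>. eval x T_exp \<rho> = poly p (\<rho> 0) + 2"
begin

abbreviation "k \<equiv> tm_tapes M"
abbreviation "len \<equiv> length trs"

text \<open>The increment makes \<open>T x\<close> larger than every running time and at least 2, as
  \<open>trace_iff_assignment\<close> requires.\<close>

definition T :: "bool list \<Rightarrow> nat" where "T x = poly p (length x) + 2"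

text \<open>A mixed-radix numeral with the digits \<open>t\<close>, \<open>j\<close>,
  \<open>a\<close>, \<open>h\<close>, \<open>l\<close>; the radix \<open>s\<close> is the time
  bound.\<close>

definition pack :: "nat \<Rightarrow> node \<times> node_value \<Rightarrow> nat" where
  "pack s = (\<lambda>((t, j), (a, h, l)). (((t * k + j) * len + a) * s + h) * s + l)"

text \<open>The increment keeps this positive even if there are no transitions.\<close>

definition items :: "bool list \<Rightarrow> nat" where
  "items x = T x * k * len * T x * T x + 1"

definition nodes :: "bool list \<Rightarrow> node set" where
  "nodes x = {..<T x} \<times> {..<k}"

definition vals :: "bool list \<Rightarrow> node_value set" where
  "vals x = {..<len} \<times> {..<T x} \<times> {..<T x}"

text \<open>The digits are searched for rather than decoded: expressions lack division but have
  bounded sums. A number that is no code, such as the extra one in \<open>items\<close>, conflicts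
  with all others.\<close>

definition conflict :: "bool list \<Rightarrow> nat \<Rightarrow> nat \<Rightarrow> bool" where
  "conflict x i i' \<longleftrightarrow> i \<noteq> i' \<and>
     \<not> (\<exists>q\<in>nodes x \<times> vals x. \<exists>q'\<in>nodes x \<times> vals x.
         i = pack (T x) q \<and> i' = pack (T x) q' \<and> compatible trs x (T x) q q')"

lemma conflict_sym: "conflict x i i' \<Longrightarrow> conflict x i' i"
  unfolding conflict_def compatible_def by metis

lemma pack_inj: "inj_on (pack (T x)) (nodes x \<times> vals x)"
  by (auto simp: inj_on_def pack_def nodes_def vals_def digit_unique)

lemma pack_range: "pack (T x) ` (nodes x \<times> vals x) \<subseteq> {..<items x}"
  by (auto simp: pack_def nodes_def vals_def items_def less_Suc_eq intro!: digit_less)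

lemma k_pos: "k \<ge> 1"
  using wf by (simp add: wf_tm_def)

lemma card_nodes: "card (nodes x) = T x * k"
  by (simp add: nodes_def card_cartesian_product)

lemma card_nodes_ge: "card (nodes x) \<ge> 2"
  unfolding card_nodes using mult_le_mono[of 2 "T x" 1 k] k_pos by (simp add: T_def)

lemma accepts_iff_clique:
  assumes "\<And>t c. (step M ^^ t) (init M x) c \<Longrightarrow> t < T x"
  shows "accepts M x \<longleftrightarrow>
    (\<exists>I\<subseteq>{..<items x}. card I = T x * k \<and> (\<forall>i\<in>I. \<forall>i'\<in>I. \<not> conflict x i i'))"
proof -
  have T2: "T x \<ge> 2" by (simp add: T_def)
  have "accepts M x \<longleftrightarrow> (\<exists>tr cs. cs 0 = init M x \<and>
      (\<forall>t<T x. tr t \<in> transitions M \<and> fires (tr t) (cs t) (cs (Suc t))) \<and> padding (tr (T x - 1)))"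
    by (rule accepts_iff_run[OF wf assms])
  also have "\<dots> \<longleftrightarrow> (\<exists>tr h. is_trace M x (T x) tr h)"
    by (rule run_iff_trace[OF wf]) (simp add: T_def)
  also have "\<dots> \<longleftrightarrow> (\<exists>\<phi>. (\<forall>u\<in>nodes x. \<phi> u \<in> vals x) \<and>
      (\<forall>u\<in>nodes x. \<forall>u'\<in>nodes x. u \<noteq> u' \<longrightarrow> compatible trs x (T x) (u, \<phi> u) (u', \<phi> u')))"
    unfolding nodes_def vals_def by (rule trace_iff_assignment[OF wf T2 trs])
  also have "\<dots> \<longleftrightarrow> (\<exists>I\<subseteq>{..<items x}. card I = card (nodes x) \<and> (\<forall>i\<in>I. \<forall>i'\<in>I. \<not> conflict x i i'))"
    by (rule clique_iff_assignment[OF _ card_nodes_ge pack_inj pack_range, symmetric])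
      (auto simp: nodes_def conflict_def compatible_def)
  finally show ?thesis unfolding card_nodes .
qed

abbreviation "src \<equiv> table (\<lambda>a. tr_src (trs ! a)) len"
abbreviation "dst \<equiv> table (\<lambda>a. tr_dst (trs ! a)) len"
abbreviation "pad \<equiv> table (\<lambda>a. of_bool (padding (trs ! a))) len"
abbreviation "rd \<equiv> table2 (\<lambda>a. tr_read (trs ! a)) len k"
abbreviation "wr \<equiv> table2 (\<lambda>a. tr_write (trs ! a)) len k"
abbreviation "mv \<equiv> table2 (\<lambda>a. tr_move (trs ! a)) len k"
abbreviation "zero \<equiv> Const 0"
abbreviation "one \<equiv> Const 1"

definition local_exp :: "exp \<Rightarrow> exp \<Rightarrow> exp \<Rightarrow> exp \<Rightarrow> exp \<Rightarrow> exp" where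
  "local_exp t j a h l =
     Mul (IMP (EQ t zero) (Mul (EQ (src a) zero) (EQ h zero)))
     (Mul (IMP (EQ (Add t one) T_exp) (pad a))
       (IMP (LE t l) (EQ (IF (EQ j zero) (Inp h) zero) (rd a j))))"

definition forward_exp ::
    "exp \<Rightarrow> exp \<Rightarrow> exp \<Rightarrow> exp \<Rightarrow> exp \<Rightarrow> exp \<Rightarrow> exp \<Rightarrow> exp \<Rightarrow> exp \<Rightarrow> exp \<Rightarrow> exp" where
  "forward_exp t j a h l t' j' a' h' l' =
     Mul (IMP (EQ t t') (EQ a a'))
     (Mul (IMP (EQ (Add t one) t') (Mul (EQ (src a') (dst a))
         (IMP (EQ j j') (EQ h' (Sub (Add h (mv a j)) one)))))
       (IMP (Mul (EQ j j') (LE (Add t one) t'))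
         (Mul (IMP (EQ l' t) (Mul (EQ h h') (EQ (wr a j) (rd a' j))))
           (IMP (Add (LE (Add l' one) t) (LE t' l')) (NOT (EQ h h'))))))"

lemma eval_local_exp:
  assumes "\<rho> 0 = length x" "eval x a \<rho> < len" "eval x j \<rho> < k"
  shows "eval x (local_exp t j a h l) \<rho> \<noteq> 0 \<longleftrightarrow>
    local_ok trs x (T x) ((eval x t \<rho>, eval x j \<rho>), (eval x a \<rho>, eval x h \<rho>, eval x l \<rho>))"
  using assms
  by (auto simp: local_exp_def local_ok_def eval_table eval_table2 T_eval T_def initial_content_def)

lemma eval_forward_exp:
  assumes "eval x a \<rho> < len" "eval x j \<rho> < k" "eval x a' \<rho> < len"
  shows "eval x (forward_exp t j a h l t' j' a' h' l') \<rho> \<noteq> 0 \<longleftrightarrow>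
    forward_ok trs ((eval x t \<rho>, eval x j \<rho>), (eval x a \<rho>, eval x h \<rho>, eval x l \<rho>))
      ((eval x t' \<rho>, eval x j' \<rho>), (eval x a' \<rho>, eval x h' \<rho>, eval x l' \<rho>))"
  using assms by (simp add: forward_exp_def forward_ok_def eval_table eval_table2 Suc_le_eq) blast

definition compatible_exp ::
    "exp \<Rightarrow> exp \<Rightarrow> exp \<Rightarrow> exp \<Rightarrow> exp \<Rightarrow> exp \<Rightarrow> exp \<Rightarrow> exp \<Rightarrow> exp \<Rightarrow> exp \<Rightarrow> exp" where
  "compatible_exp t j a h l t' j' a' h' l' =
     Mul (Add (NOT (EQ t t')) (NOT (EQ j j')))
     (Mul (Mul (local_exp t j a h l) (local_exp t' j' a' h' l'))
       (Mul (forward_exp t j a h l t' j' a' h' l') (forward_exp t' j' a' h' l' t j a h l)))"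

lemma eval_compatible_exp:
  assumes "\<rho> 0 = length x" "eval x a \<rho> < len" "eval x j \<rho> < k" "eval x a' \<rho> < len" "eval x j' \<rho> < k"
  shows "eval x (compatible_exp t j a h l t' j' a' h' l') \<rho> \<noteq> 0 \<longleftrightarrow>
    compatible trs x (T x) ((eval x t \<rho>, eval x j \<rho>), (eval x a \<rho>, eval x h \<rho>, eval x l \<rho>))
      ((eval x t' \<rho>, eval x j' \<rho>), (eval x a' \<rho>, eval x h' \<rho>, eval x l' \<rho>))"
  unfolding compatible_exp_def compatible_def
  using eval_local_exp[OF assms(1,2,3), of t h l] eval_local_exp[OF assms(1,4,5), of t' h' l']
    eval_forward_exp[OF assms(2,3,4), of t h l t' j' h' l'] eval_forward_exp[OF assms(4,5,2), of t' h' l' t j h l]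
  by (simp del: eval_NOT) (simp only: eval_NOT eval_EQ; auto)

definition pack_exp :: "exp \<Rightarrow> exp \<Rightarrow> exp \<Rightarrow> exp \<Rightarrow> exp \<Rightarrow> exp" where
  "pack_exp t j a h l =
     Add (Mul (Add (Mul (Add (Mul (Add (Mul t (Const k)) j) (Const len)) a) T_exp) h) T_exp) l"

lemma eval_pack_exp:
  "\<rho> 0 = length x \<Longrightarrow> eval x (pack_exp t j a h l) \<rho> =
    pack (T x) ((eval x t \<rho>, eval x j \<rho>), (eval x a \<rho>, eval x h \<rho>, eval x l \<rho>))"
  by (simp add: pack_exp_def pack_def T_eval T_def)

definition exists5 :: "nat \<Rightarrow> nat \<Rightarrow> nat \<Rightarrow> nat \<Rightarrow> nat \<Rightarrow> exp \<Rightarrow> exp" where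
  "exists5 t j a h l e =
     Sum t T_exp (Sum j (Const k) (Sum a (Const len) (Sum h T_exp (Sum l T_exp e))))"

text \<open>Variables 3 to 12 hold the decoded items.\<close>

definition conflict_exp :: "exp \<Rightarrow> exp \<Rightarrow> exp" where
  "conflict_exp e e' = Mul (NOT (EQ e e')) (NOT (exists5 3 4 5 6 7 (exists5 8 9 10 11 12
     (Mul (EQ e (pack_exp (Var 3) (Var 4) (Var 5) (Var 6) (Var 7)))
       (Mul (EQ e' (pack_exp (Var 8) (Var 9) (Var 10) (Var 11) (Var 12)))
         (compatible_exp (Var 3) (Var 4) (Var 5) (Var 6) (Var 7)
           (Var 8) (Var 9) (Var 10) (Var 11) (Var 12)))))))"

lemma eval_exists5:
  assumes "\<rho> 0 = length x" "0 \<notin> {t, j, a, h, l}"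
  shows "eval x (exists5 t j a h l e) \<rho> = 0 \<longleftrightarrow>
    \<not> (\<exists>n<T x. \<exists>j'<k. \<exists>a'<len. \<exists>h'<T x. \<exists>l'<T x.
      eval x e (\<rho>(t := n, j := j', a := a', h := h', l := l')) \<noteq> 0)"
  using assms by (simp add: exists5_def eval_Sum_eq_0 T_eval T_def del: eval.simps(6))

lemma bex_items:
  "(\<exists>q\<in>nodes x \<times> vals x. R q) \<longleftrightarrow>
    (\<exists>t<T x. \<exists>j<k. \<exists>a<len. \<exists>h<T x. \<exists>l<T x. R ((t, j), (a, h, l)))"
  by (auto simp: nodes_def vals_def) blast+

text \<open>The side conditions keep \<open>u\<close> and \<open>u'\<close> from being captured by
  the quantified variables 3 to 12.\<close>

lemma eval_conflict_exp:
  assumes "\<rho> 0 = length x" "u < 3 \<or> u > 12" "u' < 3 \<or> u' > 12"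
  shows "eval x (conflict_exp (Var u) (Var u')) \<rho> = of_bool (conflict x (\<rho> u) (\<rho> u'))"
proof -
  let ?C = "Mul (EQ (Var u) (pack_exp (Var 3) (Var 4) (Var 5) (Var 6) (Var 7)))
       (Mul (EQ (Var u') (pack_exp (Var 8) (Var 9) (Var 10) (Var 11) (Var 12)))
         (compatible_exp (Var 3) (Var 4) (Var 5) (Var 6) (Var 7)
           (Var 8) (Var 9) (Var 10) (Var 11) (Var 12)))"
  have inner: "eval x (exists5 8 9 10 11 12 ?C) (\<rho>(3 := t, 4 := j, 5 := a, 6 := h, 7 := l)) = 0 \<longleftrightarrow>
      \<not> (\<exists>t'<T x. \<exists>j'<k. \<exists>a'<len. \<exists>h'<T x. \<exists>l'<T x.
        eval x ?C (\<rho>(3 := t, 4 := j, 5 := a, 6 := h, 7 := l, 8 := t', 9 := j', 10 := a', 11 := h', 12 := l')) \<noteq> 0)"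
    for t j a h l by (rule eval_exists5) (use assms(1) in simp_all)
  have outer: "eval x (exists5 3 4 5 6 7 (exists5 8 9 10 11 12 ?C)) \<rho> = 0 \<longleftrightarrow>
      \<not> (\<exists>t<T x. \<exists>j<k. \<exists>a<len. \<exists>h<T x. \<exists>l<T x.
        eval x (exists5 8 9 10 11 12 ?C) (\<rho>(3 := t, 4 := j, 5 := a, 6 := h, 7 := l)) \<noteq> 0)"
    by (rule eval_exists5) (use assms(1) in simp_all)
  have "eval x (exists5 3 4 5 6 7 (exists5 8 9 10 11 12 ?C)) \<rho> \<noteq> 0 \<longleftrightarrow>
      (\<exists>t<T x. \<exists>j<k. \<exists>a<len. \<exists>h<T x. \<exists>l<T x. \<exists>t'<T x. \<exists>j'<k. \<exists>a'<len. \<exists>h'<T x. \<exists>l'<T x.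
        eval x ?C (\<rho>(3 := t, 4 := j, 5 := a, 6 := h, 7 := l, 8 := t', 9 := j', 10 := a', 11 := h', 12 := l')) \<noteq> 0)"
    unfolding outer unfolding inner not_not ..
  also have "\<dots> \<longleftrightarrow>
      (\<exists>t<T x. \<exists>j<k. \<exists>a<len. \<exists>h<T x. \<exists>l<T x. \<exists>t'<T x. \<exists>j'<k. \<exists>a'<len. \<exists>h'<T x. \<exists>l'<T x.
        \<rho> u = pack (T x) ((t, j), (a, h, l)) \<and> \<rho> u' = pack (T x) ((t', j'), (a', h', l')) \<and>
        compatible trs x (T x) ((t, j), (a, h, l)) ((t', j'), (a', h', l')))"
  proof -
    have "eval x ?C (\<rho>(3 := t, 4 := j, 5 := a, 6 := h, 7 := l, 8 := t', 9 := j', 10 := a', 11 := h', 12 := l')) \<noteq> 0 \<longleftrightarrow>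
        \<rho> u = pack (T x) ((t, j), (a, h, l)) \<and> \<rho> u' = pack (T x) ((t', j'), (a', h', l')) \<and>
        compatible trs x (T x) ((t, j), (a, h, l)) ((t', j'), (a', h', l'))"
      if r: "j < k" "a < len" "j' < k" "a' < len" for t j a h l t' j' a' h' l'
    proof -
      let ?\<rho> = "\<rho>(3 := t, 4 := j, 5 := a, 6 := h, 7 := l, 8 := t', 9 := j', 10 := a', 11 := h', 12 := l')"
      have r0: "?\<rho> 0 = length x" using assms(1) by simp
      have "eval x (compatible_exp (Var 3) (Var 4) (Var 5) (Var 6) (Var 7)
           (Var 8) (Var 9) (Var 10) (Var 11) (Var 12)) ?\<rho> \<noteq> 0 \<longleftrightarrow>
           compatible trs x (T x) ((t, j), (a, h, l)) ((t', j'), (a', h', l'))"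
        using eval_compatible_exp[of ?\<rho> x "Var 5" "Var 4" "Var 10" "Var 9" "Var 3" "Var 6" "Var 7"
          "Var 8" "Var 11" "Var 12", OF r0] r by simp
      moreover have "eval x (pack_exp (Var 3) (Var 4) (Var 5) (Var 6) (Var 7)) ?\<rho> = pack (T x) ((t, j), (a, h, l))"
        "eval x (pack_exp (Var 8) (Var 9) (Var 10) (Var 11) (Var 12)) ?\<rho> = pack (T x) ((t', j'), (a', h', l'))"
        using eval_pack_exp[of ?\<rho> x, OF r0] by simp_all
      moreover have "?\<rho> u = \<rho> u" "?\<rho> u' = \<rho> u'" using assms(2,3) by auto
      ultimately show ?thesis by (simp only: eval.simps eval_EQ) auto
    qed
    then show ?thesis by (intro ex_cong1 conj_cong refl) simp
  qed
  also have "\<dots> \<longleftrightarrow> (\<exists>q\<in>nodes x \<times> vals x. \<exists>q'\<in>nodes x \<times> vals x.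
         \<rho> u = pack (T x) q \<and> \<rho> u' = pack (T x) q' \<and> compatible trs x (T x) q q')"
    by (simp only: bex_items)
  finally show ?thesis
    unfolding conflict_exp_def conflict_def by (simp add: of_bool_mult_eq)
qed

lemma bounded_T_exp: "V \<ge> 1 \<Longrightarrow> bounded V T_exp"
  using bounded_mono[OF T_bounded] by simp

lemma bounded_conflict_exp: "u < V \<Longrightarrow> u' < V \<Longrightarrow> V \<ge> 13 \<Longrightarrow> bounded V (conflict_exp (Var u) (Var u'))"
  by (simp add: conflict_exp_def exists5_def pack_exp_def compatible_exp_def local_exp_def forward_exp_def
      bounded_T_exp)

definition nodes_number :: "bool list \<Rightarrow> nat" where
  "nodes_number x = T x * k"

definition items_exp :: exp where
  "items_exp = Add (Mul (Mul (Mul (Mul T_exp (Const k)) (Const len)) T_exp) T_exp) one"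

definition nodes_exp :: exp where
  "nodes_exp = Mul T_exp (Const k)"

definition penalty_exp :: exp where
  "penalty_exp = Add (Mul items_exp items_exp) one"

definition base_exp :: exp where
  "base_exp = Add (Add (Add (Add (Mul (Mul (Const 2) items_exp) nodes_exp)
     (Mul penalty_exp (Mul items_exp items_exp))) penalty_exp) (Mul (Const 2) items_exp)) one"

definition root_exp :: "nat \<Rightarrow> exp" where
  "root_exp u = Sub (Add (Add base_exp (Mul (Const 2) nodes_exp))
     (Mul penalty_exp (Sum 13 items_exp (conflict_exp (Var u) (Var 13)))))
     (Add (Mul (Const 2) items_exp) one)"

definition attr_exp :: "nat \<Rightarrow> nat \<Rightarrow> exp" where
  "attr_exp u u' = IF (EQ (Var u) items_exp) (root_exp u') (IF (EQ (Var u') items_exp) (root_exp u)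
     (Sub (Add base_exp (Const 2)) (Mul penalty_exp (conflict_exp (Var u) (Var u')))))"

text \<open>Variables 1 and 2 are row and column. The loop sum uses variable 18, as 3 to 13 are
  bound inside \<open>attr_exp\<close> and 14 to 17 belong to the printing loops.\<close>

definition weight_exp :: exp where
  "weight_exp = IF (EQ (Var 1) (Var 2))
     (Sub (Mul base_exp (Add items_exp one))
       (Sum 18 (Add items_exp one) (IF (EQ (Var 18) (Var 1)) zero (attr_exp 1 18))))
     (Mul (Const 2) (attr_exp 1 2))"

lemma eval_items_exp: "\<rho> 0 = length x \<Longrightarrow> eval x items_exp \<rho> = items x"
  by (simp add: items_exp_def items_def T_eval T_def)

lemma eval_nodes_exp: "\<rho> 0 = length x \<Longrightarrow> eval x nodes_exp \<rho> = nodes_number x"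
  by (simp add: nodes_exp_def nodes_number_def T_eval T_def)

lemma eval_penalty_exp: "\<rho> 0 = length x \<Longrightarrow> eval x penalty_exp \<rho> = penalty (items x)"
  by (simp add: penalty_exp_def penalty_def eval_items_exp)

lemma eval_base_exp: "\<rho> 0 = length x \<Longrightarrow> eval x base_exp \<rho> = base_attr (items x) (nodes_number x)"
  by (simp add: base_exp_def base_attr_def eval_items_exp eval_nodes_exp eval_penalty_exp)

lemma eval_root_exp:
  assumes "\<rho> 0 = length x" "u < 3 \<or> u > 13"
  shows "eval x (root_exp u) \<rho> = root_attr (items x) (nodes_number x) (conflict x) (\<rho> u)"
proof -
  have "eval x (conflict_exp (Var u) (Var 13)) (\<rho>(13 := j)) = of_bool (conflict x (\<rho> u) j)" for j
    using assms eval_conflict_exp[of "\<rho>(13 := j)" x u 13] by auto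
  then show ?thesis using assms(1)
    by (simp add: root_exp_def root_attr_def eval_items_exp eval_nodes_exp eval_penalty_exp eval_base_exp)
qed

lemma eval_attr_exp:
  assumes "\<rho> 0 = length x" "u < 3 \<or> u > 13" "u' < 3 \<or> u' > 13"
  shows "eval x (attr_exp u u') \<rho> = attr (items x) (nodes_number x) (conflict x) (\<rho> u) (\<rho> u')"
proof -
  have "eval x (conflict_exp (Var u) (Var u')) \<rho> = of_bool (conflict x (\<rho> u) (\<rho> u'))"
    using assms by (intro eval_conflict_exp) auto
  then show ?thesis using assms
    by (simp add: attr_exp_def attr_def eval_root_exp eval_items_exp eval_penalty_exp eval_base_exp)
qed

abbreviation "W x \<equiv> clique_weight (items x) (nodes_number x) (conflict x)"

lemma eval_weight_exp:
  assumes "\<rho> 0 = length x"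
  shows "eval x weight_exp \<rho> = W x (\<rho> 1) (\<rho> 2)"
proof -
  have "eval x (attr_exp 1 18) (\<rho>(18 := j)) = attr (items x) (nodes_number x) (conflict x) (\<rho> 1) j" for j
    using assms eval_attr_exp[of "\<rho>(18 := j)" x 1 18] by simp
  moreover have "eval x (attr_exp 1 2) \<rho> = attr (items x) (nodes_number x) (conflict x) (\<rho> 1) (\<rho> 2)"
    using assms by (intro eval_attr_exp) auto
  ultimately show ?thesis using assms
    by (simp add: weight_exp_def clique_weight_def eval_items_exp eval_base_exp cong: if_cong)
qed

text \<open>All pairs are edges, even those of weight 0, and all weights are integers; so each entry
  is the edge bit, the numerator and the denominator 1.\<close>

definition network_cmd :: cmd where
  "network_cmd = Then (For 1 (Add items_exp one) (Print one)) (Then (Print zero)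
     (For 1 (Add items_exp one) (For 2 (Add (Var 1) one)
       (Then (Print one) (Then (print_nat weight_exp) (print_nat one))))))"

lemma bounded_network_cmd: "cmd_bounded 19 network_cmd"
proof -
  have "bounded 19 items_exp" "bounded 19 nodes_exp"
    by (simp_all add: items_exp_def nodes_exp_def bounded_T_exp)
  then have "bounded 19 weight_exp"
    by (simp add: weight_exp_def attr_exp_def root_exp_def base_exp_def penalty_exp_def bounded_conflict_exp)
  then show ?thesis
    using \<open>bounded 19 items_exp\<close> by (simp add: network_cmd_def bounded_print_nat)
qed

definition network_of :: "bool list \<Rightarrow> nat network" where
  "network_of x = complete_network {0..<Suc (items x)} (\<lambda>e. of_nat (W x (Max e) (Min e)))"

lemma enc_rat_of_nat: "enc_rat (of_nat w) = enc_nat w @ enc_nat 1"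
proof -
  have "quotient_of (of_nat w) = (int w, 1)"
    using quotient_of_int[of "int w"] by simp
  then show ?thesis by (simp add: enc_rat_def)
qed

lemma out_network_cmd: "out x network_cmd (input_env x) = enc_network (network_of x)"
proof -
  let ?n = "Suc (items x)" and ?e = "input_env x"
  have e: "?e 0 = length x" by (simp add: input_env_def)
  have n: "eval x (Add items_exp one) ?e = ?n" using e by (simp add: eval_items_exp)
  have "concat (map (\<lambda>i. [True]) [0..<n]) = replicate n True" for n
    by (induction n) (auto simp: replicate_append_same)
  then have 1: "out x (For 1 (Add items_exp one) (Print one)) ?e = replicate ?n True"
    unfolding out.simps n by (simp add: replicate_append_same)
  have body: "out x (Then (Print one) (Then (print_nat weight_exp) (print_nat one))) (?e(1 := i, 2 := j)) =
      enc_entry (network_of x) {i, j}" if "j \<le> i" "i < ?n" for i j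
  proof -
    let ?\<rho> = "?e(1 := i, 2 := j)"
    have "out x (print_nat weight_exp) ?\<rho> = enc_nat (W x i j)"
      by (rule out_print_nat) (use e in \<open>simp_all add: eval_weight_exp\<close>)
    moreover have "out x (print_nat one) ?\<rho> = enc_nat 1"
      by (rule out_print_nat) simp_all
    \<comment> \<open>In the lower triangle the row index is the larger endpoint.\<close>
    moreover have "Max {i, j} = i" "Min {i, j} = j" using that(1) by (auto simp: max_def min_def)
    moreover have "{i, j} \<in> edges (network_of x)"
    proof -
      have "\<exists>i' j'. {i, j} = {i', j'} \<and> i' < ?n \<and> j' < ?n"
        by (rule exI[of _ i], rule exI[of _ j]) (use that in simp)
      then show ?thesis by (simp add: network_of_def)
    qed
    moreover have "weight (network_of x) {i, j} = of_nat (W x (Max {i, j}) (Min {i, j}))"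
      by (simp add: network_of_def)
    ultimately show ?thesis by (simp add: enc_entry_def enc_rat_of_nat)
  qed
  have row: "out x (For 2 (Add (Var 1) one) (Then (Print one) (Then (print_nat weight_exp) (print_nat one)))) (?e(1 := i)) =
      concat (map (\<lambda>j. enc_entry (network_of x) {i, j}) [0..<Suc i])" if "i < ?n" for i
  proof -
    have "eval x (Add (Var 1) one) (?e(1 := i)) = Suc i" by simp
    then show ?thesis unfolding out.simps(4) using that body
      by (intro arg_cong[where f = concat] map_cong) (auto simp del: out.simps)
  qed
  have "card (verts (network_of x)) = ?n" by (simp add: network_of_def)
  moreover have "out x (For 1 (Add items_exp one) (For 2 (Add (Var 1) one)
       (Then (Print one) (Then (print_nat weight_exp) (print_nat one))))) ?e =
      concat (map (\<lambda>i. concat (map (\<lambda>j. enc_entry (network_of x) {i, j}) [0..<Suc i])) [0..<?n])"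
    unfolding out.simps(4)[of x 1] n using row
    by (intro arg_cong[where f = concat] map_cong) (auto simp del: out.simps)
  ultimately show ?thesis
    unfolding network_cmd_def out.simps(2) 1 enc_network_def Let_def by simp
qed

lemma conflict_graph: "conflict_graph (items x) (nodes_number x) (conflict x)"
proof
  show "1 \<le> nodes_number x" using k_pos by (simp add: nodes_number_def T_def)
  show "conflict x j i" if "conflict x i j" for i j using that by (rule conflict_sym)
qed (simp_all add: items_def conflict_def)

lemma network_instance_network_of: "network_instance (network_of x)"
proof -
  interpret conflict_graph "items x" "nodes_number x" "conflict x" by (rule conflict_graph)
  show ?thesis using wn by (auto simp: network_instance_def network_of_def)
qed

lemma approximation_decides:
  assumes "community_structure (network_of x) P" "\<rho> > 0"
    "real_of_rat (modularity (network_of x) P) \<ge> \<rho> * of_rat (Q_OPT (network_of x))"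
    and "\<And>t c. (step M ^^ t) (init M x) c \<Longrightarrow> t < T x"
  shows "accepts M x \<longleftrightarrow> P \<noteq> {{0..<Suc (items x)}}"
proof -
  interpret conflict_graph "items x" "nodes_number x" "conflict x" by (rule conflict_graph)
  have "P \<noteq> {{0..<Suc (items x)}} \<longleftrightarrow> (\<exists>I. clique I)"
    using assms(1-3) unfolding network_of_def by (rule approximation_detects_clique)
  also have "\<dots> \<longleftrightarrow> accepts M x"
  proof -
    have "accepts M x \<longleftrightarrow>
        (\<exists>I\<subseteq>{..<items x}. card I = T x * k \<and> (\<forall>i\<in>I. \<forall>i'\<in>I. \<not> conflict x i i'))"
      using assms(4) by (rule accepts_iff_clique)
    then show ?thesis unfolding clique_def unfolding nodes_number_def by blast
  qed
  finally show ?thesis by blast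
qed

end

lemma partition_of_labels_trivial:
  "partition_of_labels (l # ls) = {{0..<length (l # ls)}} \<longleftrightarrow> (\<forall>l'\<in>set ls. l' = l)"
proof
  let ?ls = "l # ls"
  assume triv: "partition_of_labels ?ls = {{0..<length ?ls}}"
  have "{v. v < length ?ls \<and> ?ls ! v = ?ls ! 0} \<in> partition_of_labels ?ls"
    unfolding partition_of_labels_def by (intro imageI) simp
  then have eq: "{v. v < length ?ls \<and> ?ls ! v = ?ls ! 0} = {0..<length ?ls}" using triv by simp
  show "\<forall>l'\<in>set ls. l' = l"
  proof
    fix l' assume "l' \<in> set ls"
    then obtain i where i: "i < length ls" "ls ! i = l'" by (auto simp: in_set_conv_nth)
    then have "Suc i \<in> {v. v < length ?ls \<and> ?ls ! v = ?ls ! 0}" unfolding eq by simp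
    then show "l' = l" using i by simp
  qed
next
  let ?ls = "l # ls"
  assume all: "\<forall>l'\<in>set ls. l' = l"
  have l: "?ls ! v = l" if "v < length ?ls" for v
    using all that nth_mem[of v ?ls] by auto
  have "{v. v < length ?ls \<and> ?ls ! v = ?ls ! u} = {0..<length ?ls}" if "u < length ?ls" for u
    using l that by auto
  then have "(\<lambda>u. {v. v < length ?ls \<and> ?ls ! v = ?ls ! u}) ` {0..<length ?ls} =
      (\<lambda>u. {0..<length ?ls}) ` {0..<length ?ls}"
    by (intro image_cong refl) simp
  then show "partition_of_labels ?ls = {{0..<length ?ls}}"
    unfolding partition_of_labels_def by auto
qed

text \<open>The nondeterministic machine is fixed, so its transitions and its time polynomial are
  constants of the generator; only the input string varies.\<close>

theorem class_NP_subset_class_P: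
  assumes "\<rho> > 0" and A: "poly_time_modularity_approx \<rho> A"
  shows "class_NP \<subseteq> class_P"
proof
  fix L assume "L \<in> class_NP"
  then obtain M where M: "wf_tm M" "poly_time_on M UNIV" and L: "L = {x. accepts M x}"
    unfolding class_NP_def by blast
  obtain p where p: "\<And>x t c. (step M ^^ t) (init M x) c \<Longrightarrow> t \<le> poly p (length x)"
    using M(2) unfolding poly_time_on_def by blast
  obtain trs where trs: "set trs = transitions M"
    using finite_list[OF finite_transitions[OF M(1)]] by blast
  obtain T_exp where T: "bounded 1 T_exp" "\<And>x \<rho>. eval x T_exp \<rho> = poly (p + [:2:]) (\<rho> 0)"
    using poly_exp[of "p + [:2:]"] by blast
  interpret ntm_reduction M trs p T_exp
    by unfold_locales (use M trs T in auto)
  have time: "t < T x" if "(step M ^^ t) (init M x) c" for x t c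
    using p[OF that] by (simp add: T_def)
  show "L \<in> class_P"
  proof (rule class_P_via_labels)
    show "wf_tm A" "deterministic A" "poly_time_on A (enc_network ` {G. network_instance G})"
      using A by (simp_all add: poly_time_modularity_approx_def)
    show "cmd_bounded 19 network_cmd" "(1::nat) \<le> 19" by (simp_all add: bounded_network_cmd)
    fix x
    show "out x network_cmd (input_env x) \<in> enc_network ` {G. network_instance G}"
      using network_instance_network_of out_network_cmd by auto
    let ?G = "network_of x"
    have card: "card (verts ?G) = Suc (items x)" by (simp add: network_of_def)
    obtain y P where y: "computes A (enc_network ?G) y" "encodes_partition (card (verts ?G)) y P"
      "community_structure ?G P" "of_rat (modularity ?G P) \<ge> \<rho> * of_rat (Q_OPT ?G)"
      using A network_instance_network_of[of x] unfolding poly_time_modularity_approx_def by blast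
    obtain ls' where ls': "length ls' = Suc (items x)" "y = concat (map enc_nat ls')" "P = partition_of_labels ls'"
      using y(2) unfolding encodes_partition_def card by blast
    \<comment> \<open>The root makes the number of vertices positive, so there is a first
      label.\<close>
    then obtain l ls where ls: "ls' = l # ls" by (cases ls') auto
    have "x \<in> L \<longleftrightarrow> P \<noteq> {{0..<Suc (items x)}}"
      unfolding L using approximation_decides[OF y(3) assms(1) y(4) time] by simp
    also have "\<dots> \<longleftrightarrow> (\<exists>l'\<in>set ls. l' \<noteq> l)"
      using partition_of_labels_trivial[of l ls] ls' ls by auto
    finally show "\<exists>l ls. computes A (out x network_cmd (input_env x)) (concat (map enc_nat (l # ls))) \<and>
        (x \<in> L \<longleftrightarrow> (\<exists>l'\<in>set ls. l' \<noteq> l))"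
      using y(1) ls' ls unfolding out_network_cmd by blast
  qed
qed

lemma class_P_subset_class_NP: "class_P \<subseteq> class_NP"
  unfolding class_P_def class_NP_def by blast

theorem theorem1:
  fixes \<rho> :: real
  assumes "\<rho> > 0"
    and "class_P \<noteq> class_NP"
  shows "\<not> (\<exists>M. poly_time_modularity_approx \<rho> M)"
  using class_NP_subset_class_P[OF assms(1)] class_P_subset_class_NP assms(2) by blast

end
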